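(* Let $H$ be a compact Hopf $*$-algebra over $\mathbb{C}$, let $\check H$ be $H$ with the convolution product and the involution $f^\star=S(f^* )$, and let $H_{C^*}$ be the completion of $\check H$ with respect to the norm $\|f\|_{C^*}=\sup_{\lambda\in\Lambda}\|\pi_\lambda(f)\|$, where $\|\pi_\lambda(f)\|$ is the operator norm for the unitary scalar product of the simple comodule $V_\lambda$. Then there exists a one-to-one correspondence between (equivalence classes of) irreducible unitary representations of $H_{C^*}$ and those of $\check H$.
   Context: $S$ is the antipode of $H$; Sweedler's notation is used. A compact Hopf $*$-algebra is a co-semisimple Hopf algebra $H$ over $\mathbb{C}$ with an involutive antilinear algebra anti-homomorphism $^*$ with $\Delta(h^* )=h_1^*\otimes h_2^*$, such that every simple right comodule $V$, $\delta(v)=v_0\otimes v_1$, has a scalar product (called unitary; it is unique up to a positive factor) with $\langle v_0,w\rangle S(v_1)=\langle v,w_0\rangle w_1^*$ for all $v,w\in V$. Its integral is the invariant functional $x_1\int(x_2)=\int(x)1_H=\int(x_1)x_2$, normalized by $\int(1_H)=1$. The convolution product is $g*f:=\int(fS(g_1))\,g_2$. $\Lambda$ indexes the isomorphism classes of simple $H$-comodules $V_\lambda$; each $V_\lambda$ is a simple $\check H$-module via $h*v:=v_0\int(v_1S(h))$, this representation is denoted $\pi_\lambda$, and $\|\pi_\lambda(f)\|$ is the operator norm of $\pi_\lambda(f)$ on $V_\lambda$ with its unitary scalar product. $H_{C^*}$ is regarded as a $C^*$-algebra with the involution extending $\star$. A unitary representation of $\check H$ or $H_{C^*}$ is a $\star$-representation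 by bounded operators on a Hilbert space; irreducible representations are understood to be nonzero, i.e. not the zero action.
   Formalization: It is assumed, not derived, that the completion H_{C*} is a C*-algebra whose involution extends f^⋆=S(f^* ); with the stated conventions this holds only when S²=id (it fails for SU_q(2)), so the result concerns only those H for which H_{C*} is defined with this involution. *)

theory Defs
  imports "HOL-Analysis.Analysis"
begin

section \<open>Complex vector spaces and algebras\<close>

class complex_vector = ab_group_add +
  fixes scaleC :: "complex \<Rightarrow> 'a \<Rightarrow> 'a"  (infixr "*\<^sub>C" 75)
  assumes scaleC_add_right: "c *\<^sub>C (x + y) = c *\<^sub>C x + c *\<^sub>C y"
    and scaleC_add_left: "(c + d) *\<^sub>C x = c *\<^sub>C x + d *\<^sub>C x"
    and scaleC_scaleC: "c *\<^sub>C d *\<^sub>C x = (c * d) *\<^sub>C x"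
    and scaleC_one: "1 *\<^sub>C x = x"

global_interpretation cvec: vector_space "scaleC :: complex \<Rightarrow> 'a \<Rightarrow> 'a::complex_vector"
  by unfold_locales
    (simp_all add: scaleC_add_right scaleC_add_left scaleC_scaleC scaleC_one)

class complex_algebra = complex_vector + ring +
  assumes mult_scaleC_left: "(c *\<^sub>C x) * y = c *\<^sub>C (x * y)"
    and mult_scaleC_right: "x * (c *\<^sub>C y) = c *\<^sub>C (x * y)"

class complex_algebra_1 = complex_algebra + ring_1

instantiation complex :: complex_vector
begin
definition scaleC_complex :: "complex \<Rightarrow> complex \<Rightarrow> complex"
  where "scaleC_complex c z = c * z"
instance
  by standard (simp_all add: scaleC_complex_def algebra_simps)
end

abbreviation clinear :: "('a::complex_vector \<Rightarrow> 'b::complex_vector) \<Rightarrow> bool"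
  where "clinear \<equiv> Vector_Spaces.linear scaleC scaleC"

lemma clinear_iff:
  "clinear f \<longleftrightarrow> (\<forall>x y. f (x + y) = f x + f y) \<and> (\<forall>c x. f (c *\<^sub>C x) = c *\<^sub>C f x)"
  for f :: "'a::complex_vector \<Rightarrow> 'b::complex_vector"
  by (simp add: Vector_Spaces.linear_iff cvec.vector_space_axioms)

lemma clinear_zero: "clinear f \<Longrightarrow> f 0 = 0"
  by (metis add_cancel_right_right clinear_iff)

definition clinear_on :: "'a::complex_vector set \<Rightarrow> ('a \<Rightarrow> 'b::complex_vector) \<Rightarrow> bool"
  where "clinear_on V f \<longleftrightarrow>
    (\<forall>v\<in>V. \<forall>w\<in>V. f (v + w) = f v + f w) \<and> (\<forall>c. \<forall>v\<in>V. f (c *\<^sub>C v) = c *\<^sub>C f v)"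

text \<open>C*-algebras are not required to be unital.\<close>

class cstar_algebra = complex_algebra + real_normed_algebra + banach +
  fixes cadj :: "'a \<Rightarrow> 'a"
  assumes scaleR_eq_scaleC: "r *\<^sub>R x = complex_of_real r *\<^sub>C x"
    and norm_scaleC: "norm (c *\<^sub>C x) = cmod c * norm x"
    and cadj_cadj: "cadj (cadj x) = x"
    and cadj_add: "cadj (x + y) = cadj x + cadj y"
    and cadj_scaleC: "cadj (c *\<^sub>C x) = cnj c *\<^sub>C cadj x"
    and cadj_mult: "cadj (x * y) = cadj y * cadj x"
    and cstar_identity: "norm (cadj x * x) = (norm x)\<^sup>2"


section \<open>The algebraic tensor product\<close>

text \<open>
  A list of pairs stands for the finite sum of the corresponding pure tensors.  Two such sums
  are the same element of the tensor product over the complex numbers iff no bilinear form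
  distinguishes them.
\<close>

definition cbilinear :: "('a::complex_vector \<Rightarrow> 'b::complex_vector \<Rightarrow> 'c::complex_vector) \<Rightarrow> bool"
  where "cbilinear B \<longleftrightarrow> (\<forall>x. clinear (B x)) \<and> (\<forall>y. clinear (\<lambda>x. B x y))"

definition pair_sum :: "('a \<Rightarrow> 'b \<Rightarrow> 'c::comm_monoid_add) \<Rightarrow> ('a \<times> 'b) list \<Rightarrow> 'c"
  where "pair_sum B l = sum_list (map (\<lambda>(x, y). B x y) l)"

definition tensor_rel ::
    "('a::complex_vector \<times> 'b::complex_vector) list \<Rightarrow> ('a \<times> 'b) list \<Rightarrow> bool"
  where "tensor_rel l m \<longleftrightarrow>
    (\<forall>B::'a \<Rightarrow> 'b \<Rightarrow> complex. cbilinear B \<longrightarrow> pair_sum B l = pair_sum B m)"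

quotient_type (overloaded) ('a, 'b) tensor =
    "('a::complex_vector \<times> 'b::complex_vector) list" / tensor_rel
  by (rule equivpI) (auto simp: reflp_def symp_def transp_def tensor_rel_def)

lemma pair_sum_simps [simp]:
  "pair_sum B [] = 0"
  "pair_sum B (p # l) = B (fst p) (snd p) + pair_sum B l"
  "pair_sum B (l @ m) = pair_sum B l + pair_sum B m"
  by (simp_all add: pair_sum_def case_prod_beta)

lemma cbilinearD:
  assumes "cbilinear B"
  shows "B (x + x') y = B x y + B x' y" "B x (y + y') = B x y + B x y'"
    "B (c *\<^sub>C x) y = c *\<^sub>C B x y" "B x (c *\<^sub>C y) = c *\<^sub>C B x y"
proof -
  have 1: "clinear (B x)" and 2: "clinear (\<lambda>x. B x y)" for x y
    using assms by (auto simp: cbilinear_def)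
  show "B x (y + y') = B x y + B x y'" "B x (c *\<^sub>C y) = c *\<^sub>C B x y"
    using 1[of x] by (simp_all add: clinear_iff)
  show "B (x + x') y = B x y + B x' y" "B (c *\<^sub>C x) y = c *\<^sub>C B x y"
    using 2[of y] by (simp_all add: clinear_iff)
qed

lemma pair_sum_scale:
  assumes "cbilinear B"
  shows "pair_sum B (map (apfst (scaleC c)) l) = c *\<^sub>C pair_sum B l"
  by (induction l) (simp_all add: cbilinearD[OF assms] scaleC_add_right)

instantiation tensor :: (complex_vector, complex_vector) complex_vector
begin

lift_definition zero_tensor :: "('a, 'b) tensor" is "[]" .

lift_definition plus_tensor :: "('a, 'b) tensor \<Rightarrow> ('a, 'b) tensor \<Rightarrow> ('a, 'b) tensor"
  is "(@)" by (simp add: tensor_rel_def)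

lift_definition scaleC_tensor :: "complex \<Rightarrow> ('a, 'b) tensor \<Rightarrow> ('a, 'b) tensor"
  is "\<lambda>c. map (apfst (scaleC c))" by (simp add: tensor_rel_def pair_sum_scale)

definition uminus_tensor :: "('a, 'b) tensor \<Rightarrow> ('a, 'b) tensor"
  where "uminus_tensor t = (- 1) *\<^sub>C t"

definition minus_tensor :: "('a, 'b) tensor \<Rightarrow> ('a, 'b) tensor \<Rightarrow> ('a, 'b) tensor"
  where "minus_tensor s t = s + (- t)"

instance
proof
  fix a b c :: "('a, 'b) tensor" and r s :: complex
  show "a + b + c = a + (b + c)"
    by transfer (simp add: tensor_rel_def)
  show "a + b = b + a"
    by transfer (simp add: tensor_rel_def)
  show "0 + a = a"
    by transfer (simp add: tensor_rel_def)
  show "- a + a = 0"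
    unfolding uminus_tensor_def
    by transfer (simp add: tensor_rel_def pair_sum_scale scaleC_complex_def)
  show "a - b = a + - b"
    by (simp add: minus_tensor_def)
  show "r *\<^sub>C (a + b) = r *\<^sub>C a + r *\<^sub>C b"
    by transfer (simp add: tensor_rel_def)
  show "(r + s) *\<^sub>C a = r *\<^sub>C a + s *\<^sub>C a"
    by transfer (simp add: tensor_rel_def pair_sum_scale scaleC_complex_def algebra_simps)
  show "r *\<^sub>C s *\<^sub>C a = (r * s) *\<^sub>C a"
    by transfer (simp add: tensor_rel_def pair_sum_scale scaleC_complex_def del: map_map)
  show "1 *\<^sub>C a = a"
    by transfer (simp add: tensor_rel_def pair_sum_scale scaleC_complex_def)
qed

end

lift_definition pure_tensor ::
    "'a::complex_vector \<Rightarrow> 'b::complex_vector \<Rightarrow> ('a, 'b) tensor"  (infixr "\<otimes>" 72)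
  is "\<lambda>x y. [(x, y)]" .

text \<open>The subspace $V \otimes W$ of the tensor product of the ambient spaces.\<close>

definition tensor_within ::
    "'a::complex_vector set \<Rightarrow> 'b::complex_vector set \<Rightarrow> ('a, 'b) tensor set"
  where "tensor_within V W = {abs_tensor l |l. set l \<subseteq> V \<times> W}"

text \<open>
  Sweedler sums: for \<open>t = \<Sum>\<^sub>i x\<^sub>i \<otimes> y\<^sub>i\<close> with all \<open>x\<^sub>i\<close> in \<open>V\<close>,
  \<open>sweedler_on V t B = \<Sum>\<^sub>i B x\<^sub>i y\<^sub>i\<close>.  The value does not depend on the
  representation when \<open>B\<close> is bilinear on \<open>V\<close>, and also when it is antilinear in both arguments;
  see \<open>sweedler_on_abs_tensor\<close> below.
\<close>

definition sweedler_on ::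
    "'a::complex_vector set \<Rightarrow> ('a, 'b::complex_vector) tensor \<Rightarrow>
     ('a \<Rightarrow> 'b \<Rightarrow> 'c::comm_monoid_add) \<Rightarrow> 'c"
  where "sweedler_on V t B = pair_sum B (SOME l. set l \<subseteq> V \<times> UNIV \<and> abs_tensor l = t)"

abbreviation sweedler ::
    "('a::complex_vector, 'b::complex_vector) tensor \<Rightarrow>
     ('a \<Rightarrow> 'b \<Rightarrow> 'c::comm_monoid_add) \<Rightarrow> 'c"
  where "sweedler \<equiv> sweedler_on UNIV"

lemma exists_functional:
  fixes x :: "'a::complex_vector"
  assumes "x \<noteq> 0"
  shows "\<exists>f::'a \<Rightarrow> complex. clinear f \<and> f x \<noteq> 0"
proof -
  interpret vector_space_pair "scaleC :: complex \<Rightarrow> 'a \<Rightarrow> 'a" "scaleC :: complex \<Rightarrow> complex \<Rightarrow> complex"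
    by unfold_locales
  have "cvec.independent {x}"
    using assms by simp
  from linear_independent_extend[OF this, of "\<lambda>_. 1"] show ?thesis
    by auto
qed

lemma exists_projection:
  fixes V :: "'a::complex_vector set"
  assumes "cvec.subspace V"
  shows "\<exists>p::'a \<Rightarrow> 'a. clinear p \<and> range p \<subseteq> V \<and> (\<forall>v\<in>V. p v = v)"
proof -
  interpret vector_space_pair "scaleC :: complex \<Rightarrow> 'a \<Rightarrow> 'a" "scaleC :: complex \<Rightarrow> 'a \<Rightarrow> 'a"
    by unfold_locales
  have id: "clinear (\<lambda>x::'a. x)"
    by (simp add: clinear_iff)
  from linear_exists_left_inverse_on[OF id assms] obtain g :: "'a \<Rightarrow> 'a"
    where "g ` UNIV \<subseteq> V" "clinear g" "\<forall>v\<in>V. g v = v"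
    by auto
  then show ?thesis by blast
qed

lemma sweedler_on_abs_tensor:
  fixes B :: "'a::complex_vector \<Rightarrow> 'b::complex_vector \<Rightarrow> 'c::complex_vector"
  assumes V: "cvec.subspace V" and l: "set l \<subseteq> V \<times> UNIV"
    and \<sigma>: "\<sigma> = id \<or> \<sigma> = cnj"
    and add_left: "\<And>x x' y. x \<in> V \<Longrightarrow> x' \<in> V \<Longrightarrow> B (x + x') y = B x y + B x' y"
    and add_right: "\<And>x y y'. x \<in> V \<Longrightarrow> B x (y + y') = B x y + B x y'"
    and scale_left: "\<And>c x y. x \<in> V \<Longrightarrow> B (c *\<^sub>C x) y = \<sigma> c *\<^sub>C B x y"
    and scale_right: "\<And>c x y. x \<in> V \<Longrightarrow> B x (c *\<^sub>C y) = \<sigma> c *\<^sub>C B x y"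
  shows "sweedler_on V (abs_tensor l) B = pair_sum B l"
proof -
  define m where "m = (SOME m. set m \<subseteq> V \<times> UNIV \<and> abs_tensor m = abs_tensor l)"
  have "set m \<subseteq> V \<times> UNIV \<and> abs_tensor m = abs_tensor l"
    unfolding m_def by (rule someI[of _ l]) (use l in simp)
  then have m: "set m \<subseteq> V \<times> UNIV" and rel: "tensor_rel m l"
    by (simp_all add: tensor.abs_eq_iff)
  have \<sigma>_simps: "\<sigma> (c + d) = \<sigma> c + \<sigma> d" "\<sigma> (c * d) = \<sigma> c * \<sigma> d" "\<sigma> (\<sigma> c) = c" "\<sigma> 0 = 0" for c d
    using \<sigma> by auto
  obtain p :: "'a \<Rightarrow> 'a" where p: "clinear p" "range p \<subseteq> V" "\<forall>v\<in>V. p v = v"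
    using exists_projection[OF V] by blast
  have pV: "p x \<in> V" for x using p(2) by blast
  have *: "F (pair_sum B m) = F (pair_sum B l)" if F: "clinear F" for F :: "'c \<Rightarrow> complex"
  proof -
    have Fs: "F (u + v) = F u + F v" "F (c *\<^sub>C u) = c * F u" "F 0 = 0" for u v c
      using F clinear_zero[OF F] by (simp_all add: clinear_iff scaleC_complex_def)
    have ps: "p (x + y) = p x + p y" "p (c *\<^sub>C x) = c *\<^sub>C p x" for x y c
      using p(1) by (simp_all add: clinear_iff)
    let ?G = "\<lambda>x y. \<sigma> (F (B (p x) y))"
    have "cbilinear ?G"
      by (auto simp: cbilinear_def clinear_iff ps Fs \<sigma>_simps add_left add_right scale_left
          scale_right pV scaleC_complex_def)
    with rel have G: "pair_sum ?G m = pair_sum ?G l"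
      by (simp add: tensor_rel_def)
    have "pair_sum ?G k = \<sigma> (F (pair_sum B k))" if "set k \<subseteq> V \<times> UNIV" for k
      using that by (induction k) (use p(3) in \<open>auto simp: Fs \<sigma>_simps\<close>)
    with G m l have "\<sigma> (F (pair_sum B m)) = \<sigma> (F (pair_sum B l))"
      by simp
    then show ?thesis
      by (metis \<sigma>_simps(3))
  qed
  have "pair_sum B m = pair_sum B l"
  proof (rule ccontr)
    assume "pair_sum B m \<noteq> pair_sum B l"
    then obtain F :: "'c \<Rightarrow> complex" where F: "clinear F" "F (pair_sum B m - pair_sum B l) \<noteq> 0"
      using exists_functional[of "pair_sum B m - pair_sum B l"] by auto
    have "F (pair_sum B m - pair_sum B l) = F (pair_sum B m) - F (pair_sum B l)"
      using F(1) by (rule module_hom.diff[OF Vector_Spaces.linear.axioms(3)])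
    with *[OF F(1)] F(2) show False by simp
  qed
  then show ?thesis
    by (simp add: sweedler_on_def m_def)
qed


section \<open>Hopf algebras, comodules\<close>

locale hopf_algebra =
  fixes \<Delta> :: "'a::complex_algebra_1 \<Rightarrow> ('a, 'a) tensor"
    and \<epsilon> :: "'a \<Rightarrow> complex"
    and S :: "'a \<Rightarrow> 'a"
  assumes linear_comult: "clinear \<Delta>"
    and linear_counit: "clinear \<epsilon>"
    and linear_antipode: "clinear S"
    and coassoc: "sweedler (\<Delta> h) (\<lambda>h1 h2. sweedler (\<Delta> h1) (\<lambda>h11 h12. (h11 \<otimes> h12) \<otimes> h2)) =
      sweedler (\<Delta> h) (\<lambda>h1 h2. sweedler (\<Delta> h2) (\<lambda>h21 h22. (h1 \<otimes> h21) \<otimes> h22))"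
    and counit_left: "sweedler (\<Delta> h) (\<lambda>h1 h2. \<epsilon> h1 *\<^sub>C h2) = h"
    and counit_right: "sweedler (\<Delta> h) (\<lambda>h1 h2. \<epsilon> h2 *\<^sub>C h1) = h"
    and comult_one: "\<Delta> 1 = 1 \<otimes> 1"
    and comult_mult: "\<Delta> (g * h) =
      sweedler (\<Delta> g) (\<lambda>g1 g2. sweedler (\<Delta> h) (\<lambda>h1 h2. (g1 * h1) \<otimes> (g2 * h2)))"
    and counit_one: "\<epsilon> 1 = 1"
    and counit_mult: "\<epsilon> (g * h) = \<epsilon> g * \<epsilon> h"
    and antipode_left: "sweedler (\<Delta> h) (\<lambda>h1 h2. S h1 * h2) = \<epsilon> h *\<^sub>C 1"
    and antipode_right: "sweedler (\<Delta> h) (\<lambda>h1 h2. h1 * S h2) = \<epsilon> h *\<^sub>C 1"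

definition subcoalgebra :: "('a::complex_vector \<Rightarrow> ('a, 'a) tensor) \<Rightarrow> 'a set \<Rightarrow> bool"
  where "subcoalgebra \<Delta> C \<longleftrightarrow> cvec.subspace C \<and> \<Delta> ` C \<subseteq> tensor_within C C"

definition simple_subcoalgebra :: "('a::complex_vector \<Rightarrow> ('a, 'a) tensor) \<Rightarrow> 'a set \<Rightarrow> bool"
  where "simple_subcoalgebra \<Delta> C \<longleftrightarrow> subcoalgebra \<Delta> C \<and> C \<noteq> {0} \<and>
    (\<forall>D. subcoalgebra \<Delta> D \<and> D \<subseteq> C \<longrightarrow> D = {0} \<or> D = C)"

definition cosemisimple :: "('a::complex_vector \<Rightarrow> ('a, 'a) tensor) \<Rightarrow> bool"
  where "cosemisimple \<Delta> \<longleftrightarrow> cvec.span (\<Union> {C. simple_subcoalgebra \<Delta> C}) = UNIV"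

text \<open>
  A comodule is given by a carrier \<open>V\<close>, a subspace of an ambient complex vector space, and a
  coaction whose values outside \<open>V\<close> are irrelevant.
\<close>

definition comodule ::
    "('a::complex_vector \<Rightarrow> ('a, 'a) tensor) \<Rightarrow> ('a \<Rightarrow> complex) \<Rightarrow>
     'w::complex_vector set \<Rightarrow> ('w \<Rightarrow> ('w, 'a) tensor) \<Rightarrow> bool"
  where "comodule \<Delta> \<epsilon> V \<delta> \<longleftrightarrow>
    cvec.subspace V \<and> clinear_on V \<delta> \<and> \<delta> ` V \<subseteq> tensor_within V UNIV \<and>
    (\<forall>v\<in>V. sweedler_on V (\<delta> v) (\<lambda>v0 v1. sweedler_on V (\<delta> v0) (\<lambda>v00 v01. (v00 \<otimes> v01) \<otimes> v1)) =
       sweedler_on V (\<delta> v) (\<lambda>v0 v1. sweedler (\<Delta> v1) (\<lambda>v11 v12. (v0 \<otimes> v11) \<otimes> v12))) \<and>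
    (\<forall>v\<in>V. sweedler_on V (\<delta> v) (\<lambda>v0 v1. \<epsilon> v1 *\<^sub>C v0) = v)"

definition simple_comodule ::
    "('a::complex_vector \<Rightarrow> ('a, 'a) tensor) \<Rightarrow> ('a \<Rightarrow> complex) \<Rightarrow>
     'w::complex_vector set \<Rightarrow> ('w \<Rightarrow> ('w, 'a) tensor) \<Rightarrow> bool"
  where "simple_comodule \<Delta> \<epsilon> V \<delta> \<longleftrightarrow> comodule \<Delta> \<epsilon> V \<delta> \<and> V \<noteq> {0} \<and>
    (\<forall>W. cvec.subspace W \<and> W \<subseteq> V \<and> \<delta> ` W \<subseteq> tensor_within W UNIV \<longrightarrow> W = {0} \<or> W = V)"

definition comodule_iso ::
    "'w::complex_vector set \<Rightarrow> ('w \<Rightarrow> ('w, 'a::complex_vector) tensor) \<Rightarrow>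
     'u::complex_vector set \<Rightarrow> ('u \<Rightarrow> ('u, 'a) tensor) \<Rightarrow> bool"
  where "comodule_iso V \<delta> V' \<delta>' \<longleftrightarrow> (\<exists>\<phi>. clinear_on V \<phi> \<and> bij_betw \<phi> V V' \<and>
    (\<forall>v\<in>V. \<delta>' (\<phi> v) = sweedler_on V (\<delta> v) (\<lambda>v0 v1. \<phi> v0 \<otimes> v1)))"


section \<open>Scalar products\<close>

text \<open>Scalar products are linear in the first and antilinear in the second argument.\<close>

definition scalar_product :: "'v::complex_vector set \<Rightarrow> ('v \<Rightarrow> 'v \<Rightarrow> complex) \<Rightarrow> bool"
  where "scalar_product V ip \<longleftrightarrow>
    (\<forall>w\<in>V. clinear_on V (\<lambda>v. ip v w)) \<and>
    (\<forall>v\<in>V. \<forall>w\<in>V. ip w v = cnj (ip v w)) \<and>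
    (\<forall>v\<in>V. v \<noteq> 0 \<longrightarrow> Re (ip v v) > 0)"

definition ip_norm :: "('v \<Rightarrow> 'v \<Rightarrow> complex) \<Rightarrow> 'v \<Rightarrow> real"
  where "ip_norm ip v = sqrt (Re (ip v v))"

definition op_norm :: "'v set \<Rightarrow> ('v \<Rightarrow> 'v \<Rightarrow> complex) \<Rightarrow> ('v \<Rightarrow> 'v) \<Rightarrow> real"
  where "op_norm V ip T = Sup {ip_norm ip (T v) |v. v \<in> V \<and> ip_norm ip v \<le> 1}"

definition unitary_product ::
    "('a::complex_algebra_1 \<Rightarrow> 'a) \<Rightarrow> ('a \<Rightarrow> 'a) \<Rightarrow>
     'w::complex_vector set \<Rightarrow> ('w \<Rightarrow> ('w, 'a) tensor) \<Rightarrow> ('w \<Rightarrow> 'w \<Rightarrow> complex) \<Rightarrow> bool"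
  where "unitary_product S st V \<delta> ip \<longleftrightarrow> scalar_product V ip \<and>
    (\<forall>v\<in>V. \<forall>w\<in>V. sweedler_on V (\<delta> v) (\<lambda>v0 v1. ip v0 w *\<^sub>C S v1) =
       sweedler_on V (\<delta> w) (\<lambda>w0 w1. ip v w0 *\<^sub>C st w1))"


section \<open>Compact Hopf $*$-algebras and the convolution algebra\<close>

text \<open>
  Every simple comodule \<open>V\<close> is isomorphic to one whose carrier is a subspace of the Hopf algebra
  itself, via \<open>v \<mapsto> f(v\<^sub>0) v\<^sub>1\<close> for any nonzero functional \<open>f\<close> on \<open>V\<close>.  So it suffices to
  quantify over comodules with carrier in the type of the Hopf algebra, both here and in
  \<open>simple_comodule_representatives\<close>.
\<close>

locale compact_hopf_star_algebra = hopf_algebra \<Delta> \<epsilon> S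
  for \<Delta> :: "'a::complex_algebra_1 \<Rightarrow> ('a, 'a) tensor" and \<epsilon> S +
  fixes st :: "'a \<Rightarrow> 'a"
  assumes cosemisimple: "cosemisimple \<Delta>"
    and star_star: "st (st h) = h"
    and star_add: "st (g + h) = st g + st h"
    and star_scale: "st (c *\<^sub>C h) = cnj c *\<^sub>C st h"
    and star_mult: "st (g * h) = st h * st g"
    and comult_star: "\<Delta> (st h) = sweedler (\<Delta> h) (\<lambda>h1 h2. st h1 \<otimes> st h2)"
    and unitarizable: "\<And>(V :: 'a set) \<delta>. simple_comodule \<Delta> \<epsilon> V \<delta> \<Longrightarrow>
      \<exists>ip. unitary_product S st V \<delta> ip"

definition hopf_integral ::
    "('a::complex_algebra_1 \<Rightarrow> ('a, 'a) tensor) \<Rightarrow> ('a \<Rightarrow> complex) \<Rightarrow> bool"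
  where "hopf_integral \<Delta> J \<longleftrightarrow> clinear J \<and> J 1 = 1 \<and>
    (\<forall>x. sweedler (\<Delta> x) (\<lambda>x1 x2. J x2 *\<^sub>C x1) = J x *\<^sub>C 1) \<and>
    (\<forall>x. sweedler (\<Delta> x) (\<lambda>x1 x2. J x1 *\<^sub>C x2) = J x *\<^sub>C 1)"

definition convolution ::
    "('a::complex_algebra_1 \<Rightarrow> ('a, 'a) tensor) \<Rightarrow> ('a \<Rightarrow> 'a) \<Rightarrow> ('a \<Rightarrow> complex) \<Rightarrow> 'a \<Rightarrow> 'a \<Rightarrow> 'a"
  where "convolution \<Delta> S J g f = sweedler (\<Delta> g) (\<lambda>g1 g2. J (f * S g1) *\<^sub>C g2)"

definition conv_star :: "('a \<Rightarrow> 'a) \<Rightarrow> ('a \<Rightarrow> 'a) \<Rightarrow> 'a \<Rightarrow> 'a"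
  where "conv_star S st f = S (st f)"

definition conv_action ::
    "('a::complex_algebra_1 \<Rightarrow> 'a) \<Rightarrow> ('a \<Rightarrow> complex) \<Rightarrow>
     'w::complex_vector set \<Rightarrow> ('w \<Rightarrow> ('w, 'a) tensor) \<Rightarrow> 'a \<Rightarrow> 'w \<Rightarrow> 'w"
  where "conv_action S J V \<delta> h v = sweedler_on V (\<delta> v) (\<lambda>v0 v1. J (v1 * S h) *\<^sub>C v0)"

text \<open>
  The family \<open>V \<alpha>\<close>, for \<open>\<alpha>\<close> in \<open>\<Lambda>\<close>, represents each isomorphism class of simple comodules
  exactly once, and \<open>ip \<alpha>\<close> is the unitary scalar product of \<open>V \<alpha>\<close>.
\<close>

definition simple_comodule_representatives ::
    "('a::complex_algebra_1 \<Rightarrow> ('a, 'a) tensor) \<Rightarrow> ('a \<Rightarrow> complex) \<Rightarrow> ('a \<Rightarrow> 'a) \<Rightarrow> ('a \<Rightarrow> 'a) \<Rightarrow>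
     'l set \<Rightarrow> ('l \<Rightarrow> 'w::complex_vector set) \<Rightarrow> ('l \<Rightarrow> 'w \<Rightarrow> ('w, 'a) tensor) \<Rightarrow>
     ('l \<Rightarrow> 'w \<Rightarrow> 'w \<Rightarrow> complex) \<Rightarrow> bool"
  where "simple_comodule_representatives \<Delta> \<epsilon> S st \<Lambda> V \<delta> ip \<longleftrightarrow>
    (\<forall>\<alpha>\<in>\<Lambda>. simple_comodule \<Delta> \<epsilon> (V \<alpha>) (\<delta> \<alpha>) \<and> unitary_product S st (V \<alpha>) (\<delta> \<alpha>) (ip \<alpha>)) \<and>
    (\<forall>\<alpha>\<in>\<Lambda>. \<forall>\<beta>\<in>\<Lambda>. comodule_iso (V \<alpha>) (\<delta> \<alpha>) (V \<beta>) (\<delta> \<beta>) \<longrightarrow> \<alpha> = \<beta>) \<and>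
    (\<forall>(W :: 'a set) \<gamma>. simple_comodule \<Delta> \<epsilon> W \<gamma> \<longrightarrow>
       (\<exists>\<alpha>\<in>\<Lambda>. comodule_iso W \<gamma> (V \<alpha>) (\<delta> \<alpha>)))"

definition cstar_norm ::
    "('a::complex_algebra_1 \<Rightarrow> 'a) \<Rightarrow> ('a \<Rightarrow> complex) \<Rightarrow>
     'l set \<Rightarrow> ('l \<Rightarrow> 'w::complex_vector set) \<Rightarrow> ('l \<Rightarrow> 'w \<Rightarrow> ('w, 'a) tensor) \<Rightarrow>
     ('l \<Rightarrow> 'w \<Rightarrow> 'w \<Rightarrow> complex) \<Rightarrow> 'a \<Rightarrow> real"
  where "cstar_norm S J \<Lambda> V \<delta> ip f =
    (SUP \<alpha>\<in>\<Lambda>. op_norm (V \<alpha>) (ip \<alpha>) (conv_action S J (V \<alpha>) (\<delta> \<alpha>) f))"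

text \<open>
  A C*-algebra together with an isometric dense embedding of the given normed $*$-algebra,
  i.e. its completion.
\<close>

definition cstar_completion ::
    "('a::complex_vector \<Rightarrow> 'a \<Rightarrow> 'a) \<Rightarrow> ('a \<Rightarrow> 'a) \<Rightarrow> ('a \<Rightarrow> real) \<Rightarrow>
     ('a \<Rightarrow> 'b::cstar_algebra) \<Rightarrow> bool"
  where "cstar_completion mul invol nrm \<iota> \<longleftrightarrow> clinear \<iota> \<and>
    (\<forall>f g. \<iota> (mul f g) = \<iota> f * \<iota> g) \<and> (\<forall>f. \<iota> (invol f) = cadj (\<iota> f)) \<and>
    (\<forall>f. norm (\<iota> f) = nrm f) \<and> closure (range \<iota>) = UNIV"


section \<open>Unitary representations\<close>

text \<open>
  A Hilbert space is given by a carrier, a subspace of an ambient complex vector space, and a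
  scalar product on the carrier; neither topology nor scalar product come from the ambient space.
  Every Hilbert space is isomorphic to such a one for a suitable ambient space.
\<close>

definition hilbert_space :: "'v::complex_vector set \<Rightarrow> ('v \<Rightarrow> 'v \<Rightarrow> complex) \<Rightarrow> bool"
  where "hilbert_space X ip \<longleftrightarrow> cvec.subspace X \<and> scalar_product X ip \<and>
    (\<forall>x::nat \<Rightarrow> 'v. range x \<subseteq> X \<and>
       (\<forall>e>0. \<exists>N. \<forall>m\<ge>N. \<forall>n\<ge>N. ip_norm ip (x m - x n) < e) \<longrightarrow>
       (\<exists>y\<in>X. (\<lambda>n. ip_norm ip (x n - y)) \<longlonglongrightarrow> 0))"

definition closed_subspace ::
    "'v::complex_vector set \<Rightarrow> ('v \<Rightarrow> 'v \<Rightarrow> complex) \<Rightarrow> 'v set \<Rightarrow> bool"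
  where "closed_subspace X ip Y \<longleftrightarrow> cvec.subspace Y \<and> Y \<subseteq> X \<and>
    (\<forall>y::nat \<Rightarrow> 'v. \<forall>x\<in>X. range y \<subseteq> Y \<and> (\<lambda>n. ip_norm ip (y n - x)) \<longlonglongrightarrow> 0 \<longrightarrow> x \<in> Y)"

definition bounded_operator ::
    "'v::complex_vector set \<Rightarrow> ('v \<Rightarrow> 'v \<Rightarrow> complex) \<Rightarrow> ('v \<Rightarrow> 'v) \<Rightarrow> bool"
  where "bounded_operator X ip T \<longleftrightarrow> T ` X \<subseteq> X \<and> clinear_on X T \<and>
    (\<exists>K. \<forall>x\<in>X. ip_norm ip (T x) \<le> K * ip_norm ip x)"

type_synonym ('h, 'v) rep = "'v set \<times> ('v \<Rightarrow> 'v \<Rightarrow> complex) \<times> ('h \<Rightarrow> 'v \<Rightarrow> 'v)"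

definition unitary_rep ::
    "('h::complex_vector \<Rightarrow> 'h \<Rightarrow> 'h) \<Rightarrow> ('h \<Rightarrow> 'h) \<Rightarrow> ('h, 'v::complex_vector) rep \<Rightarrow> bool"
  where "unitary_rep mul invol = (\<lambda>(X, ip, \<pi>). hilbert_space X ip \<and>
    (\<forall>a. bounded_operator X ip (\<pi> a)) \<and>
    (\<forall>x\<in>X. clinear (\<lambda>a. \<pi> a x)) \<and>
    (\<forall>a b. \<forall>x\<in>X. \<pi> (mul a b) x = \<pi> a (\<pi> b x)) \<and>
    (\<forall>a. \<forall>x\<in>X. \<forall>y\<in>X. ip (\<pi> a x) y = ip x (\<pi> (invol a) y)))"

definition irreducible_unitary_rep ::
    "('h::complex_vector \<Rightarrow> 'h \<Rightarrow> 'h) \<Rightarrow> ('h \<Rightarrow> 'h) \<Rightarrow> ('h, 'v::complex_vector) rep \<Rightarrow> bool"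
  where "irreducible_unitary_rep mul invol = (\<lambda>(X, ip, \<pi>). unitary_rep mul invol (X, ip, \<pi>) \<and>
    (\<exists>a. \<exists>x\<in>X. \<pi> a x \<noteq> 0) \<and>
    (\<forall>Y. closed_subspace X ip Y \<and> (\<forall>a. \<pi> a ` Y \<subseteq> Y) \<longrightarrow> Y = {0} \<or> Y = X))"

definition unitarily_equivalent ::
    "('h, 'v::complex_vector) rep \<Rightarrow> ('h, 'v) rep \<Rightarrow> bool"
  where "unitarily_equivalent = (\<lambda>(X, ip, \<pi>) (X', ip', \<pi>'). \<exists>U. clinear_on X U \<and>
    bij_betw U X X' \<and> (\<forall>x\<in>X. \<forall>y\<in>X. ip' (U x) (U y) = ip x y) \<and>
    (\<forall>a. \<forall>x\<in>X. U (\<pi> a x) = \<pi>' a (U x)))"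

definition irreps ::
    "('h::complex_vector \<Rightarrow> 'h \<Rightarrow> 'h) \<Rightarrow> ('h \<Rightarrow> 'h) \<Rightarrow> ('h, 'v::complex_vector) rep set"
  where "irreps mul invol = {\<rho>. irreducible_unitary_rep mul invol \<rho>}"

definition irrep_equiv ::
    "('h::complex_vector \<Rightarrow> 'h \<Rightarrow> 'h) \<Rightarrow> ('h \<Rightarrow> 'h) \<Rightarrow>
     (('h, 'v::complex_vector) rep \<times> ('h, 'v) rep) set"
  where "irrep_equiv mul invol = {(\<rho>, \<sigma>). \<rho> \<in> irreps mul invol \<and> \<sigma> \<in> irreps mul invol \<and>
    unitarily_equivalent \<rho> \<sigma>}"

end

theory Submission
  imports Defs
begin

text \<open>
  It suffices that every unitary representation \<open>\<sigma>\<close> of the convolution algebra is contractive for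
  the C*-norm, for then it extends uniquely to the completion, with the same closed invariant
  subspaces and intertwiners.  If \<open>h\<close> is selfadjoint of norm less than \<open>1\<close> and
  \<open>k = 1 - sqrt (1 - h)\<close>, then \<open>\<langle>\<sigma>(h) x, x\<rangle> = |x|^2 - |x - \<sigma>(k) x|^2\<close>, which bounds \<open>\<sigma>\<close> as soon
  as \<open>k\<close> belongs to the algebra.  It does because \<open>h\<close> generates a finite-dimensional right ideal
  of the convolution algebra, whose image in the completion is closed.

  The elements of seminorm \<open>0\<close> must act as \<open>0\<close> for this.  As every simple subcoalgebra is spanned by
  the left translates of a simple right coideal, such an \<open>f\<close> satisfies \<open>\<integral> w S(f) = 0\<close> for all \<open>w\<close>,
  and then \<open>\<epsilon>(f) = \<epsilon>(S(f)) = 0\<close>.  These elements form an ideal, so \<open>\<integral> f S(g) = \<epsilon>(g * f) = 0\<close> for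
  all \<open>g\<close>, which gives \<open>g * f = 0\<close> and in particular \<open>|\<sigma>(f) x|^2 = \<langle>x, \<sigma>(f\<^sup>\<star> * f) x\<rangle> = 0\<close>.
\<close>

section \<open>Finite dual bases\<close>

text \<open>A star representation of a bare star algebra carries no continuity, and the convolution
  algebra has in general no unit, so a spectral argument is not directly at hand. The single element
  \<open>k\<close> replaces it: the identity is used for \<open>h\<close> equal to
  \<open>a\<^sup>\<star> * a / s\<^sup>2\<close> with \<open>s\<close> above the norm of
  \<open>a\<close>, and \<open>s\<close> then decreases to that norm. The equation
  \<open>2 k = h + k\<^sup>2\<close> makes sense without a unit and is solved by a contraction
  inside any closed subspace stable under squaring. The same argument with the identity embedding
  makes representations of the completion contractive, hence continuous, so that restricting and
  then extending gives back the original representation. A second obstacle is the norm itself. The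
  supremum over \<open>\<Lambda>\<close> is a total operation on sets of reals, so its finiteness is
  not built into the definition. It is deduced from the existence of the completion, with the unit
  of the Hopf algebra as a test element: by invariance of the integral it acts on a simple comodule
  as a projection to the coinvariants.\<close>

lemma finite_dual_basis:
  fixes A :: "'a::complex_vector set"
  assumes "finite A"
  obtains E and \<phi> :: "'a \<Rightarrow> 'a \<Rightarrow> complex" where "finite E" "E \<subseteq> A" "\<And>e. clinear (\<phi> e)"
    "\<And>a. a \<in> A \<Longrightarrow> a = (\<Sum>e\<in>E. \<phi> e a *\<^sub>C e)"
proof -
  interpret vector_space_pair "scaleC :: complex \<Rightarrow> 'a \<Rightarrow> 'a" "scaleC :: complex \<Rightarrow> complex \<Rightarrow> complex"
    by unfold_locales
  obtain E where E: "E \<subseteq> A" "cvec.independent E" "A \<subseteq> cvec.span E"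
    using cvec.maximal_independent_subset by blast
  have fE: "finite E" using E(1) assms finite_subset by blast
  have "\<exists>f::'a \<Rightarrow> complex. clinear f \<and> (\<forall>b\<in>E. f b = (if b = e then 1 else 0))" for e
    using linear_independent_extend[OF E(2), of "\<lambda>b. if b = e then 1 else 0"] by auto
  then obtain \<phi> :: "'a \<Rightarrow> 'a \<Rightarrow> complex" where \<phi>: "\<And>e. clinear (\<phi> e)"
    "\<And>e b. b \<in> E \<Longrightarrow> \<phi> e b = (if b = e then 1 else 0)"
    by metis
  have *: "a = (\<Sum>e\<in>E. \<phi> e a *\<^sub>C e)" if "a \<in> cvec.span E" for a
    using that
  proof (induction rule: cvec.span_induct_alt)
    case base
    then show ?case using clinear_zero[OF \<phi>(1)] by simp
  next
    case (step c x y)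
    have "\<phi> e (c *\<^sub>C x + y) = (if x = e then c else 0) + \<phi> e y" if "e \<in> E" for e
      using \<phi>(1)[of e] \<phi>(2)[OF step(1)] by (simp add: clinear_iff scaleC_complex_def)
    then have "(\<Sum>e\<in>E. \<phi> e (c *\<^sub>C x + y) *\<^sub>C e) =
        (\<Sum>e\<in>E. (if x = e then c *\<^sub>C e else 0)) + (\<Sum>e\<in>E. \<phi> e y *\<^sub>C e)"
      by (auto simp: scaleC_add_left sum.distrib[symmetric] intro!: sum.cong)
    also have "(\<Sum>e\<in>E. (if x = e then c *\<^sub>C e else 0)) = c *\<^sub>C x"
      using fE step(1) by simp
    finally show ?case using step(2) by simp
  qed
  show ?thesis
    by (rule that[of E \<phi>, OF fE E(1) \<phi>(1)]) (use * E(3) in blast)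
qed

section \<open>Sweedler sums\<close>

lemma abs_tensor_Cons: "abs_tensor ((x, y) # l) = x \<otimes> y + abs_tensor l"
  by (simp add: pure_tensor.abs_eq plus_tensor.abs_eq)

lemma abs_tensor_Nil: "abs_tensor [] = 0"
  by (simp add: zero_tensor_def)

lemma tensor_eqI:
  fixes s t :: "('a::complex_vector, 'b::complex_vector) tensor"
  assumes "\<And>B :: 'a \<Rightarrow> 'b \<Rightarrow> complex. cbilinear B \<Longrightarrow> pair_sum B l = pair_sum B m"
  shows "abs_tensor l = abs_tensor m"
  using assms by (simp add: tensor.abs_eq_iff tensor_rel_def)

lemma tensor_withinE:
  assumes "t \<in> tensor_within V W"
  obtains l where "set l \<subseteq> V \<times> W" "t = abs_tensor l"
  using assms by (auto simp: tensor_within_def)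

lemma tensor_within_UNIV [simp]: "t \<in> tensor_within UNIV UNIV"
  by (induction t rule: tensor.abs_induct) (auto simp: tensor_within_def)

lemma tensor_exhaust:
  obtains l where "t = abs_tensor l"
  by (induction t rule: tensor.abs_induct) auto

text \<open>The list chosen by \<open>sweedler_on\<close> has its first factors in \<open>V\<close>,
  where \<open>B'\<close> and \<open>B\<close> agree. This trades sums relative to a carrier for
  global ones, whose bilinear calculus has no side conditions.\<close>

lemma sweedler_on_eq:
  assumes V: "cvec.subspace V" and t: "t \<in> tensor_within V UNIV" and B: "cbilinear B"
    and eq: "\<And>a b. a \<in> V \<Longrightarrow> B' a b = B a b"
  shows "sweedler_on V t B' = sweedler t B"
proof -
  from t obtain l where l: "set l \<subseteq> V \<times> UNIV" "t = abs_tensor l" by (rule tensor_withinE)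
  define m where "m = (SOME l. set l \<subseteq> V \<times> UNIV \<and> abs_tensor l = t)"
  have m: "set m \<subseteq> V \<times> UNIV" 
    using someI[of "\<lambda>l. set l \<subseteq> V \<times> UNIV \<and> abs_tensor l = t" l] l by (simp add: m_def)
  have "sweedler_on V t B' = pair_sum B' m" by (simp add: sweedler_on_def m_def)
  also have "\<dots> = pair_sum B m"
    using m eq by (induction m) auto
  also have "\<dots> = sweedler_on V t B" by (simp add: sweedler_on_def m_def)
  also have "\<dots> = pair_sum B l"
    unfolding l(2) by (rule sweedler_on_abs_tensor[OF V l(1), where \<sigma> = id])
      (auto simp: cbilinearD[OF B])
  also have "\<dots> = sweedler t B"
    unfolding l(2) by (rule sweedler_on_abs_tensor[symmetric, where \<sigma> = id])
      (auto simp: cbilinearD[OF B])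
  finally show ?thesis .
qed

lemma sweedler_abs_tensor: "cbilinear B \<Longrightarrow> sweedler (abs_tensor l) B = pair_sum B l"
  by (rule sweedler_on_abs_tensor[where \<sigma> = id]) (auto simp: cbilinearD)

lemma sweedler_pure: "cbilinear B \<Longrightarrow> sweedler (x \<otimes> y) B = B x y"
  by (simp add: pure_tensor.abs_eq sweedler_abs_tensor)

lemma clinear_sweedler:
  assumes "cbilinear B"
  shows "clinear (\<lambda>t. sweedler t B)"
proof -
  have "sweedler (s + t) B = sweedler s B + sweedler t B" for s t
    by (rule tensor_exhaust[of s], rule tensor_exhaust[of t])
      (simp add: plus_tensor.abs_eq sweedler_abs_tensor[OF assms])
  moreover have "sweedler (c *\<^sub>C t) B = c *\<^sub>C sweedler t B" for c t
    by (rule tensor_exhaust[of t])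
      (simp add: scaleC_tensor.abs_eq sweedler_abs_tensor[OF assms] pair_sum_scale[OF assms])
  ultimately show ?thesis by (simp add: clinear_iff)
qed

lemma additive_pair_sum:
  assumes "\<And>x y. F (x + y) = F x + F y" "F 0 = 0"
  shows "F (pair_sum B l) = pair_sum (\<lambda>a b. F (B a b)) l"
  using assms by (induction l) auto

lemma clinear_pair_sum: "clinear F \<Longrightarrow> F (pair_sum B l) = pair_sum (\<lambda>a b. F (B a b)) l"
  by (rule additive_pair_sum) (simp_all add: clinear_iff clinear_zero[unfolded clinear_iff])

text \<open>Both sides sum over the same representing list, which is chosen from \<open>V\<close>
  and \<open>t\<close> alone. The rules below for linear maps, sums and scalar multiples rest on the
  same remark.\<close>

lemma additive_sweedler:
  assumes "\<And>x y. F (x + y) = F x + F y" "F 0 = 0"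
  shows "F (sweedler_on V t B) = sweedler_on V t (\<lambda>a b. F (B a b))"
  unfolding sweedler_on_def by (rule additive_pair_sum[OF assms])

lemma clinear_sweedler_out:
  assumes "clinear F"
  shows "F (sweedler_on V t B) = sweedler_on V t (\<lambda>a b. F (B a b))"
  by (rule additive_sweedler) (use assms clinear_zero[OF assms] in \<open>auto simp: clinear_iff\<close>)

lemma sweedler_on_add:
  "sweedler_on V t (\<lambda>a b. B a b + C a b :: 'c::comm_monoid_add) = sweedler_on V t B + sweedler_on V t C"
proof -
  have "pair_sum (\<lambda>a b. B a b + C a b) l = pair_sum B l + pair_sum C l" for l
    by (induction l) (auto simp: algebra_simps)
  then show ?thesis by (simp add: sweedler_on_def)
qed

lemma sweedler_on_scale:
  "sweedler_on V t (\<lambda>a b. c *\<^sub>C B a b) = c *\<^sub>C sweedler_on V t B"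
proof -
  have "pair_sum (\<lambda>a b. c *\<^sub>C B a b) l = c *\<^sub>C pair_sum B l" for l
    by (induction l) (auto simp: scaleC_add_right)
  then show ?thesis by (simp add: sweedler_on_def)
qed

lemma sweedler_on_zero: "sweedler_on V t (\<lambda>a b. 0) = 0"
proof -
  have "pair_sum (\<lambda>a b. 0) l = 0" for l by (induction l) auto
  then show ?thesis by (simp add: sweedler_on_def)
qed

lemma clinear_sweedler_arg:
  assumes "\<And>a b. clinear (\<lambda>x. B x a b)"
  shows "clinear (\<lambda>x. sweedler_on V t (B x))"
proof -
  have "B (x + y) = (\<lambda>a b. B x a b + B y a b)" "B (c *\<^sub>C x) = (\<lambda>a b. c *\<^sub>C B x a b)" for x y c
    using assms by (intro ext; simp add: clinear_iff)+
  then show ?thesis by (simp add: clinear_iff sweedler_on_add sweedler_on_scale)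
qed

lemma clinear_compose: "clinear f \<Longrightarrow> clinear g \<Longrightarrow> clinear (\<lambda>x. f (g x))"
  by (simp add: clinear_iff)

lemma clinear_mult_left: "clinear f \<Longrightarrow> clinear (\<lambda>x. (a::'a::complex_algebra) * f x)"
  by (simp add: clinear_iff mult_scaleC_right distrib_left)

lemma clinear_mult_right: "clinear f \<Longrightarrow> clinear (\<lambda>x. f x * (a::'a::complex_algebra))"
  by (simp add: clinear_iff mult_scaleC_left distrib_right)

lemma clinear_scaleC_left: "clinear f \<Longrightarrow> clinear (\<lambda>x. f x *\<^sub>C v)"
  by (simp add: clinear_iff scaleC_add_left scaleC_complex_def scaleC_scaleC)

lemma clinear_scaleC_right: "clinear f \<Longrightarrow> clinear (\<lambda>x. c *\<^sub>C f x)"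
  by (simp add: clinear_iff scaleC_add_right scaleC_scaleC mult.commute)

lemma clinear_times_left: "clinear f \<Longrightarrow> clinear (\<lambda>x. c * f x :: complex)"
  by (simp add: clinear_iff scaleC_complex_def distrib_left)

lemma clinear_times_right: "clinear f \<Longrightarrow> clinear (\<lambda>x. f x * c :: complex)"
  by (simp add: clinear_iff scaleC_complex_def distrib_right)

lemma clinear_ident: "clinear (\<lambda>x. x)"
  by (simp add: clinear_iff)

lemma clinear_pure_left: "clinear f \<Longrightarrow> clinear (\<lambda>x. f x \<otimes> y)"
  unfolding clinear_iff
  by (auto simp: pure_tensor.abs_eq plus_tensor.abs_eq scaleC_tensor.abs_eq intro!: tensor_eqI
      simp: cbilinearD)

lemma clinear_pure_right: "clinear f \<Longrightarrow> clinear (\<lambda>x. y \<otimes> f x)"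
  unfolding clinear_iff
  by (auto simp: pure_tensor.abs_eq plus_tensor.abs_eq scaleC_tensor.abs_eq intro!: tensor_eqI
      simp: cbilinearD)

lemmas clinear_intros = clinear_mult_left clinear_mult_right clinear_scaleC_left
  clinear_scaleC_right clinear_times_left clinear_times_right clinear_ident
  clinear_pure_left clinear_pure_right

lemma cbilinearI:
  "(\<And>x. clinear (B x)) \<Longrightarrow> (\<And>y. clinear (\<lambda>x. B x y)) \<Longrightarrow> cbilinear B"
  by (simp add: cbilinear_def)

lemma cbilinear_pure: "cbilinear (\<otimes>)"
  by (intro cbilinearI clinear_pure_left clinear_pure_right clinear_ident)

lemma subspace_pair_sum:
  assumes "cvec.subspace W" "\<And>a b. (a, b) \<in> set l \<Longrightarrow> B a b \<in> W"
  shows "pair_sum B l \<in> W"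
  using assms(2) by (induction l) (auto intro!: cvec.subspace_add[OF assms(1)] cvec.subspace_0[OF assms(1)])

lemma tensor_within_sweedler:
  assumes "t \<in> tensor_within V W" "cbilinear B" "cvec.subspace U"
    and "\<And>a b. a \<in> V \<Longrightarrow> b \<in> W \<Longrightarrow> B a b \<in> U"
  shows "sweedler t B \<in> U"
proof -
  from assms(1) obtain l where l: "set l \<subseteq> V \<times> W" "t = abs_tensor l" by (rule tensor_withinE)
  show ?thesis
    unfolding l(2) sweedler_abs_tensor[OF assms(2)]
    by (rule subspace_pair_sum[OF assms(3)]) (use l assms(4) in auto)
qed

lemma pair_sum_sum_swap:
  "(\<Sum>e\<in>E. pair_sum (B e) l) = pair_sum (\<lambda>a b. \<Sum>e\<in>E. B e a b) l"
  by (induction l) (auto simp: sum.distrib)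

lemma pair_sum_cong:
  "(\<And>a b. (a, b) \<in> set l \<Longrightarrow> B a b = C a b) \<Longrightarrow> pair_sum B l = pair_sum C l"
  by (induction l) auto

lemma abs_tensor_pair_sum: "abs_tensor l = pair_sum (\<otimes>) l"
  by (induction l) (auto simp: abs_tensor_Cons abs_tensor_Nil)

lemma clinear_diff: "clinear f \<Longrightarrow> f (x - y) = f x - f y"
  by (rule module_hom.diff[OF Vector_Spaces.linear.axioms(3)])

lemma clinear_sum: "clinear f \<Longrightarrow> f (sum g A) = (\<Sum>x\<in>A. f (g x))"
  by (rule module_hom.sum[OF Vector_Spaces.linear.axioms(3)])

lemma sum_in_tensor_within:
  fixes V :: "'a::complex_vector set" and W :: "'b::complex_vector set"
  assumes "finite E" "\<And>e. e \<in> E \<Longrightarrow> a e \<in> V" "\<And>e. e \<in> E \<Longrightarrow> b e \<in> W"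
  shows "(\<Sum>e\<in>E. a e \<otimes> b e) \<in> tensor_within V W"
  using assms
proof (induction E)
  case empty
  have "(0::('a,'b) tensor) = abs_tensor []" by (simp add: abs_tensor_Nil)
  then show ?case unfolding tensor_within_def by (auto intro!: exI[of _ "[]"])
next
  case (insert e E)
  then obtain l where "set l \<subseteq> V \<times> W" "(\<Sum>e\<in>E. a e \<otimes> b e) = abs_tensor l"
    by (auto elim!: tensor_withinE)
  with insert show ?case unfolding tensor_within_def
    by (auto intro!: exI[of _ "(a e, b e) # l"] simp: abs_tensor_Cons)
qed

text \<open>Writing the first factors in coordinates and collecting terms leaves a slice of
  \<open>t\<close> next to each basis vector. Slices depend on \<open>t\<close> only, not on a list,
  so conditions on slices become conditions on \<open>t\<close>.\<close>

lemma tensor_expand_left: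
  fixes t :: "('a::complex_vector, 'b::complex_vector) tensor"
  assumes "t \<in> tensor_within V UNIV"
  obtains E \<phi> where "finite E" "E \<subseteq> V" "\<And>e. clinear (\<phi> e :: 'a \<Rightarrow> complex)"
    "t = (\<Sum>e\<in>E. e \<otimes> sweedler t (\<lambda>a b. \<phi> e a *\<^sub>C b))"
proof -
  from assms obtain l where l: "set l \<subseteq> V \<times> UNIV" "t = abs_tensor l" by (rule tensor_withinE)
  obtain E and \<phi> :: "'a \<Rightarrow> 'a \<Rightarrow> complex" where E: "finite E" "E \<subseteq> fst ` set l"
    "\<And>e. clinear (\<phi> e)" "\<And>a. a \<in> fst ` set l \<Longrightarrow> a = (\<Sum>e\<in>E. \<phi> e a *\<^sub>C e)"
    using finite_dual_basis[of "fst ` set l"] by auto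
  have bl: "cbilinear (\<lambda>a b::'b. \<phi> e a *\<^sub>C b)" for e
    by (intro cbilinearI clinear_intros E)
  have "t = pair_sum (\<otimes>) l" by (simp add: l abs_tensor_pair_sum)
  also have "\<dots> = pair_sum (\<lambda>a b. \<Sum>e\<in>E. e \<otimes> (\<phi> e a *\<^sub>C b)) l"
  proof (rule pair_sum_cong)
    fix a b assume "(a, b) \<in> set l"
    then have "a = (\<Sum>e\<in>E. \<phi> e a *\<^sub>C e)" by (intro E(4)) force
    then have "a \<otimes> b = (\<Sum>e\<in>E. \<phi> e a *\<^sub>C e) \<otimes> b" by simp
    also have "\<dots> = (\<Sum>e\<in>E. (\<phi> e a *\<^sub>C e) \<otimes> b)"
      by (rule clinear_sum) (intro clinear_intros)
    also have "\<dots> = (\<Sum>e\<in>E. e \<otimes> (\<phi> e a *\<^sub>C b))"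
      by (simp add: cbilinearD[OF cbilinear_pure])
    finally show "a \<otimes> b = (\<Sum>e\<in>E. e \<otimes> (\<phi> e a *\<^sub>C b))" .
  qed
  also have "\<dots> = (\<Sum>e\<in>E. pair_sum (\<lambda>a b. e \<otimes> (\<phi> e a *\<^sub>C b)) l)"
    by (simp add: pair_sum_sum_swap)
  also have "\<dots> = (\<Sum>e\<in>E. e \<otimes> sweedler t (\<lambda>a b. \<phi> e a *\<^sub>C b))"
  proof (rule sum.cong[OF refl])
    fix e assume e: "e \<in> E"
    have "clinear (\<lambda>y::'b. e \<otimes> y)" by (intro clinear_intros)
    then have "e \<otimes> pair_sum (\<lambda>a b. \<phi> e a *\<^sub>C b) l = pair_sum (\<lambda>a b. e \<otimes> (\<phi> e a *\<^sub>C b)) l"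
      by (rule clinear_pair_sum)
    then show "pair_sum (\<lambda>a b. e \<otimes> (\<phi> e a *\<^sub>C b)) l = e \<otimes> sweedler t (\<lambda>a b. \<phi> e a *\<^sub>C b)"
      by (simp add: l sweedler_abs_tensor[OF bl])
  qed
  finally show ?thesis using E(1-3) l(1) by (intro that[of E \<phi>]) force+
qed

lemma tensor_expand_right:
  fixes t :: "('a::complex_vector, 'b::complex_vector) tensor"
  assumes "t \<in> tensor_within UNIV W"
  obtains E \<phi> where "finite E" "E \<subseteq> W" "\<And>e. clinear (\<phi> e :: 'b \<Rightarrow> complex)"
    "t = (\<Sum>e\<in>E. sweedler t (\<lambda>a b. \<phi> e b *\<^sub>C a) \<otimes> e)"
proof -
  from assms obtain l where l: "set l \<subseteq> UNIV \<times> W" "t = abs_tensor l" by (rule tensor_withinE)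
  obtain E and \<phi> :: "'b \<Rightarrow> 'b \<Rightarrow> complex" where E: "finite E" "E \<subseteq> snd ` set l"
    "\<And>e. clinear (\<phi> e)" "\<And>a. a \<in> snd ` set l \<Longrightarrow> a = (\<Sum>e\<in>E. \<phi> e a *\<^sub>C e)"
    using finite_dual_basis[of "snd ` set l"] by auto
  have bl: "cbilinear (\<lambda>(a::'a) b. \<phi> e b *\<^sub>C a)" for e
    by (intro cbilinearI clinear_intros E)
  have "t = pair_sum (\<otimes>) l" by (simp add: l abs_tensor_pair_sum)
  also have "\<dots> = pair_sum (\<lambda>a b. \<Sum>e\<in>E. (\<phi> e b *\<^sub>C a) \<otimes> e) l"
  proof (rule pair_sum_cong)
    fix a b assume "(a, b) \<in> set l"
    then have "b = (\<Sum>e\<in>E. \<phi> e b *\<^sub>C e)" by (intro E(4)) force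
    then have "a \<otimes> b = a \<otimes> (\<Sum>e\<in>E. \<phi> e b *\<^sub>C e)" by simp
    also have "\<dots> = (\<Sum>e\<in>E. a \<otimes> (\<phi> e b *\<^sub>C e))"
      by (rule clinear_sum) (intro clinear_intros)
    also have "\<dots> = (\<Sum>e\<in>E. (\<phi> e b *\<^sub>C a) \<otimes> e)"
      by (simp add: cbilinearD[OF cbilinear_pure])
    finally show "a \<otimes> b = (\<Sum>e\<in>E. (\<phi> e b *\<^sub>C a) \<otimes> e)" .
  qed
  also have "\<dots> = (\<Sum>e\<in>E. pair_sum (\<lambda>a b. (\<phi> e b *\<^sub>C a) \<otimes> e) l)"
    by (simp add: pair_sum_sum_swap)
  also have "\<dots> = (\<Sum>e\<in>E. sweedler t (\<lambda>a b. \<phi> e b *\<^sub>C a) \<otimes> e)"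
  proof (rule sum.cong[OF refl])
    fix e assume e: "e \<in> E"
    have "clinear (\<lambda>y::'a. y \<otimes> e)" by (intro clinear_intros)
    then have "pair_sum (\<lambda>a b. \<phi> e b *\<^sub>C a) l \<otimes> e = pair_sum (\<lambda>a b. (\<phi> e b *\<^sub>C a) \<otimes> e) l"
      by (rule clinear_pair_sum[where F = "\<lambda>y. y \<otimes> e"])
    then show "pair_sum (\<lambda>a b. (\<phi> e b *\<^sub>C a) \<otimes> e) l = sweedler t (\<lambda>a b. \<phi> e b *\<^sub>C a) \<otimes> e"
      by (simp add: l sweedler_abs_tensor[OF bl])
  qed
  finally show ?thesis using E(1-3) l(1) by (intro that[of E \<phi>]) force+
qed

text \<open>Expanding along the left factors leaves slices in \<open>W\<close> on the right. A
  second expansion along right factors taken from \<open>W\<close> then leaves slices in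
  \<open>V\<close> on the left. All invariance claims for coactions are proved through this
  criterion.\<close>

lemma tensor_withinI:
  fixes t :: "('a::complex_vector, 'b::complex_vector) tensor"
  assumes "\<And>\<phi> :: 'b \<Rightarrow> complex. clinear \<phi> \<Longrightarrow> sweedler t (\<lambda>a b. \<phi> b *\<^sub>C a) \<in> V"
    and "\<And>\<phi> :: 'a \<Rightarrow> complex. clinear \<phi> \<Longrightarrow> sweedler t (\<lambda>a b. \<phi> a *\<^sub>C b) \<in> W"
  shows "t \<in> tensor_within V W"
proof -
  obtain E \<phi> where E: "finite E" "\<And>e. clinear (\<phi> e :: 'a \<Rightarrow> complex)"
    "t = (\<Sum>e\<in>E. e \<otimes> sweedler t (\<lambda>a b. \<phi> e a *\<^sub>C b))"
    using tensor_expand_left[of t UNIV] by auto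
  have "t \<in> tensor_within UNIV W"
    by (subst E(3), rule sum_in_tensor_within) (use E(1,2) assms(2) in auto)
  then obtain F \<psi> where F: "finite F" "F \<subseteq> W" "\<And>e. clinear (\<psi> e :: 'b \<Rightarrow> complex)"
    "t = (\<Sum>e\<in>F. sweedler t (\<lambda>a b. \<psi> e b *\<^sub>C a) \<otimes> e)"
    by (rule tensor_expand_right) (rule that, assumption+)
  show ?thesis
    by (subst F(4), rule sum_in_tensor_within) (use F(1-3) assms(1) in auto)
qed

section \<open>Comodules\<close>

definition trilinear ::
    "('a::complex_vector \<Rightarrow> 'b::complex_vector \<Rightarrow> 'c::complex_vector \<Rightarrow> 'd::complex_vector) \<Rightarrow> bool"
  where "trilinear T \<longleftrightarrow> (\<forall>b c. clinear (\<lambda>a. T a b c)) \<and> (\<forall>a c. clinear (\<lambda>b. T a b c)) \<and>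
    (\<forall>a b. clinear (T a b))"

lemma trilinearI:
  "(\<And>b c. clinear (\<lambda>a. T a b c)) \<Longrightarrow> (\<And>a c. clinear (\<lambda>b. T a b c)) \<Longrightarrow>
    (\<And>a b. clinear (\<lambda>c. T a b c)) \<Longrightarrow> trilinear T"
  by (simp add: trilinear_def)

text \<open>The hypothesis is an equation in an iterated tensor product. Applying the linear map
  induced by \<open>T\<close> to it gives the form in which coassociativity is used in computations,
  for coactions and for \<open>\<Delta>\<close> itself.\<close>

lemma coaction_trilinear:
  fixes T :: "'w::complex_vector \<Rightarrow> 'a::complex_vector \<Rightarrow> 'a \<Rightarrow> 'd::complex_vector"
  assumes eq: "sweedler (\<delta> v) (\<lambda>x y. sweedler (\<delta> x) (\<lambda>a b. (a \<otimes> b) \<otimes> y)) =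
      sweedler (\<delta> v) (\<lambda>x y. sweedler (\<Delta> y) (\<lambda>a b. (x \<otimes> a) \<otimes> b))"
    and T: "trilinear T"
  shows "sweedler (\<delta> v) (\<lambda>x y. sweedler (\<delta> x) (\<lambda>a b. T a b y)) =
    sweedler (\<delta> v) (\<lambda>x y. sweedler (\<Delta> y) (T x))"
proof -
  have T': "clinear (\<lambda>a. T a b c)" "clinear (\<lambda>b. T a b c)" "clinear (\<lambda>c. T a b c)" for a b c
    using T by (auto simp: trilinear_def)
  define Q where "Q = (\<lambda>t c. sweedler t (\<lambda>a b. T a b c))"
  have bl: "cbilinear (\<lambda>a b. T a b c)" for c
    by (intro cbilinearI T')
  have Q: "cbilinear Q"
    unfolding Q_def by (intro cbilinearI clinear_sweedler clinear_sweedler_arg bl T')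
  have F: "clinear (\<lambda>t. sweedler t Q)" by (rule clinear_sweedler[OF Q])
  have "sweedler ((a \<otimes> b) \<otimes> c) Q = T a b c" for a b c
    by (simp add: sweedler_pure[OF Q]) (simp add: Q_def sweedler_pure[OF bl])
  with arg_cong[OF eq, of "\<lambda>t. sweedler t Q"] show ?thesis
    by (simp add: clinear_sweedler_out[OF F])
qed

lemma subspace_preimage:
  "clinear f \<Longrightarrow> cvec.subspace W \<Longrightarrow> cvec.subspace {x. f x \<in> W}"
  by (simp add: cvec.subspace_def clinear_iff clinear_zero)

lemma subspace_range_of_functionals:
  fixes L :: "('a::complex_vector \<Rightarrow> complex) \<Rightarrow> 'b::complex_vector"
  assumes "\<And>\<phi> \<psi>. L (\<lambda>x. \<phi> x + \<psi> x) = L \<phi> + L \<psi>" "\<And>c \<phi>. L (\<lambda>x. c * \<phi> x) = c *\<^sub>C L \<phi>"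
  shows "cvec.subspace {L \<phi> |\<phi>. clinear \<phi>}"
  unfolding cvec.subspace_def
proof (intro conjI ballI allI)
  have "clinear (\<lambda>x::'a. 0 * 0 :: complex)" by (simp add: clinear_iff)
  moreover have "L (\<lambda>x. 0 * 0) = 0" using assms(2)[of 0 "\<lambda>x. 0"] by simp
  ultimately show "0 \<in> {L \<phi> |\<phi>. clinear \<phi>}" by (metis (mono_tags, lifting) mem_Collect_eq)
  fix x assume "x \<in> {L \<phi> |\<phi>. clinear \<phi>}"
  then obtain \<phi> where \<phi>: "clinear \<phi>" "x = L \<phi>" by blast
  then have "clinear (\<lambda>x. c * \<phi> x)" "c *\<^sub>C x = L (\<lambda>x. c * \<phi> x)" for c
    by (simp_all add: assms clinear_times_left)
  then show "c *\<^sub>C x \<in> {L \<phi> |\<phi>. clinear \<phi>}" for c by blast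
  fix y assume "y \<in> {L \<phi> |\<phi>. clinear \<phi>}"
  then obtain \<psi> where \<psi>: "clinear \<psi>" "y = L \<psi>" by blast
  have "clinear (\<lambda>x. \<phi> x + \<psi> x)" using \<phi> \<psi> by (simp add: clinear_iff algebra_simps)
  moreover have "x + y = L (\<lambda>x. \<phi> x + \<psi> x)" using \<phi> \<psi> by (simp add: assms)
  ultimately show "x + y \<in> {L \<phi> |\<phi>. clinear \<phi>}" by blast
qed

lemma subspace_slices:
  fixes t :: "('a::complex_vector, 'b::complex_vector) tensor"
  shows "cvec.subspace {sweedler t (\<lambda>a b. \<phi> b *\<^sub>C a) |\<phi> :: 'b \<Rightarrow> complex. clinear \<phi>}"
    and "cvec.subspace {sweedler t (\<lambda>a b. \<phi> a *\<^sub>C b) |\<phi> :: 'a \<Rightarrow> complex. clinear \<phi>}"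
  by (rule subspace_range_of_functionals;
      simp only: scaleC_add_left sweedler_on_add sweedler_on_scale scaleC_scaleC[symmetric])+

text \<open>The source of finite dimensionality throughout: every slice is a combination of the
  factors in one fixed representing list.\<close>

lemma finite_span_slices:
  fixes t :: "('a::complex_vector, 'b::complex_vector) tensor"
  obtains F G where "finite F" "finite G"
    "{sweedler t (\<lambda>a b. \<phi> b *\<^sub>C a) |\<phi> :: 'b \<Rightarrow> complex. clinear \<phi>} \<subseteq> cvec.span F"
    "{sweedler t (\<lambda>a b. \<phi> a *\<^sub>C b) |\<phi> :: 'a \<Rightarrow> complex. clinear \<phi>} \<subseteq> cvec.span G"
proof -
  obtain l where l: "t = abs_tensor l" by (rule tensor_exhaust)
  have t: "t \<in> tensor_within (fst ` set l) (snd ` set l)"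
    unfolding l tensor_within_def by force
  have "sweedler t (\<lambda>a b. \<phi> b *\<^sub>C a) \<in> cvec.span (fst ` set l)"
    if \<phi>: "clinear \<phi>" for \<phi> :: "'b \<Rightarrow> complex"
  proof (rule tensor_within_sweedler[OF t _ cvec.subspace_span])
    show "cbilinear (\<lambda>(a::'a) b. \<phi> b *\<^sub>C a)" by (intro cbilinearI clinear_intros \<phi>)
  qed (rule cvec.span_scale[OF cvec.span_base])
  moreover have "sweedler t (\<lambda>a b. \<phi> a *\<^sub>C b) \<in> cvec.span (snd ` set l)"
    if \<phi>: "clinear \<phi>" for \<phi> :: "'a \<Rightarrow> complex"
  proof (rule tensor_within_sweedler[OF t _ cvec.subspace_span])
    show "cbilinear (\<lambda>a (b::'b). \<phi> a *\<^sub>C b)" by (intro cbilinearI clinear_intros \<phi>)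
  qed (rule cvec.span_scale[OF cvec.span_base])
  ultimately show ?thesis by (intro that[of "fst ` set l" "snd ` set l"]) auto
qed

text \<open>
  A coaction on \<open>V\<close> extended linearly to the ambient space, which allows Sweedler sums over
  arbitrary tensors.
\<close>

locale global_comodule = hopf_algebra \<Delta> \<epsilon> S
  for \<Delta> :: "'a::complex_algebra_1 \<Rightarrow> ('a, 'a) tensor" and \<epsilon> S +
  fixes V :: "'w::complex_vector set" and \<delta> :: "'w \<Rightarrow> ('w, 'a) tensor"
  assumes V: "cvec.subspace V"
    and linear_coact: "clinear \<delta>"
    and coact_in: "\<delta> v \<in> tensor_within V UNIV"
    and coact_coassoc: "v \<in> V \<Longrightarrow> sweedler (\<delta> v) (\<lambda>x y. sweedler (\<delta> x) (\<lambda>a b. (a \<otimes> b) \<otimes> y)) =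
      sweedler (\<delta> v) (\<lambda>x y. sweedler (\<Delta> y) (\<lambda>a b. (x \<otimes> a) \<otimes> b))"
    and coact_counit: "v \<in> V \<Longrightarrow> sweedler (\<delta> v) (\<lambda>a b. \<epsilon> b *\<^sub>C a) = v"
begin

lemma slice_in: "clinear \<phi> \<Longrightarrow> sweedler (\<delta> v) (\<lambda>a b. \<phi> b *\<^sub>C a) \<in> V"
  by (rule tensor_within_sweedler[OF coact_in _ V])
    (intro cbilinearI clinear_intros | assumption | erule cvec.subspace_scale[OF V])+

lemma clinear_slice: "clinear \<phi> \<Longrightarrow> clinear (\<lambda>v. sweedler (\<delta> v) (\<lambda>a b. \<phi> b *\<^sub>C a))"
  by (intro clinear_compose[OF clinear_sweedler linear_coact] cbilinearI clinear_intros)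

text \<open>For \<open>v\<close> in \<open>V\<close> this is the subcomodule generated by
  \<open>v\<close>, seen as the orbit of \<open>v\<close> under the dual algebra acting by
  slices.\<close>

definition orbit :: "'w \<Rightarrow> 'w set"
  where "orbit v = {sweedler (\<delta> v) (\<lambda>a b. \<phi> b *\<^sub>C a) |\<phi>. clinear \<phi>}"

lemma subspace_orbit: "cvec.subspace (orbit v)"
  unfolding orbit_def by (rule subspace_slices)

lemma orbit_finite: obtains F where "finite F" "orbit v \<subseteq> cvec.span F"
  by (rule finite_span_slices[of "\<delta> v"], rule that) (simp_all add: orbit_def)

lemma orbit_subset: "orbit v \<subseteq> V"
  using slice_in by (auto simp: orbit_def)

lemma orbit_self: "v \<in> V \<Longrightarrow> v \<in> orbit v"
  unfolding orbit_def using coact_counit linear_counit by (auto intro!: exI[of _ \<epsilon>])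

text \<open>By coassociativity, slicing by \<open>\<phi>\<close> and then by \<open>\<psi>\<close>
  is slicing once by a convolution product of the two functionals, so slices of \<open>u\<close> are
  again slices of \<open>v\<close>.\<close>

lemma orbit_closed:
  assumes "v \<in> V" "u \<in> orbit v"
  shows "\<delta> u \<in> tensor_within (orbit v) UNIV"
proof (rule tensor_withinI)
  fix \<psi> :: "'a \<Rightarrow> complex" assume \<psi>: "clinear \<psi>"
  from assms(2) obtain \<phi> where \<phi>: "clinear \<phi>" and u: "u = sweedler (\<delta> v) (\<lambda>a b. \<phi> b *\<^sub>C a)"
    by (auto simp: orbit_def)
  have T: "trilinear (\<lambda>a b c. \<phi> c *\<^sub>C \<psi> b *\<^sub>C a)"
    by (intro trilinearI clinear_intros \<phi> \<psi>)
  have lin: "clinear (\<lambda>y. sweedler (\<Delta> y) (\<lambda>a b. \<phi> b * \<psi> a))"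
    by (intro clinear_compose[OF clinear_sweedler linear_comult] cbilinearI clinear_intros \<phi> \<psi>)
  have out: "clinear (\<lambda>c. c *\<^sub>C x)" for x :: 'w by (intro clinear_intros)
  have "sweedler (\<delta> u) (\<lambda>a b. \<psi> b *\<^sub>C a) =
      sweedler (\<delta> v) (\<lambda>x y. \<phi> y *\<^sub>C sweedler (\<delta> x) (\<lambda>a b. \<psi> b *\<^sub>C a))"
    unfolding u
    using clinear_sweedler_out[OF clinear_slice[OF \<psi>], of UNIV "\<delta> v" "\<lambda>a b. \<phi> b *\<^sub>C a"]
      clinear_slice[OF \<psi>]
    by (simp add: clinear_iff)
  also have "\<dots> = sweedler (\<delta> v) (\<lambda>x y. sweedler (\<delta> x) (\<lambda>a b. \<phi> y *\<^sub>C \<psi> b *\<^sub>C a))"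
    by (simp only: sweedler_on_scale)
  also have "\<dots> = sweedler (\<delta> v) (\<lambda>x y. sweedler (\<Delta> y) (\<lambda>a b. \<phi> b *\<^sub>C \<psi> a *\<^sub>C x))"
    by (rule coaction_trilinear[OF coact_coassoc[OF assms(1)] T])
  also have "\<dots> = sweedler (\<delta> v) (\<lambda>x y. sweedler (\<Delta> y) (\<lambda>a b. \<phi> b * \<psi> a) *\<^sub>C x)"
    by (simp add: clinear_sweedler_out[OF out] scaleC_scaleC)
  finally show "sweedler (\<delta> u) (\<lambda>a b. \<psi> b *\<^sub>C a) \<in> orbit v"
    using lin by (auto simp: orbit_def)
qed auto

end

text \<open>The extension is \<open>\<delta>\<close> composed with a linear projection onto
  \<open>V\<close>. Since values of the coaction have their first factors in \<open>V\<close>,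
  \<open>sweedler_on_eq\<close> carries the axioms over.\<close>

lemma (in hopf_algebra) comodule_extend:
  assumes "comodule \<Delta> \<epsilon> V \<delta>"
  obtains \<delta>' where "global_comodule \<Delta> \<epsilon> S V \<delta>'" "\<And>v. v \<in> V \<Longrightarrow> \<delta>' v = \<delta> v"
proof -
  have V: "cvec.subspace V" and lin: "clinear_on V \<delta>" and tw: "\<And>v. v \<in> V \<Longrightarrow> \<delta> v \<in> tensor_within V UNIV"
    and coass: "\<And>v. v \<in> V \<Longrightarrow> sweedler_on V (\<delta> v) (\<lambda>v0 v1. sweedler_on V (\<delta> v0) (\<lambda>v00 v01. (v00 \<otimes> v01) \<otimes> v1)) =
       sweedler_on V (\<delta> v) (\<lambda>v0 v1. sweedler (\<Delta> v1) (\<lambda>v11 v12. (v0 \<otimes> v11) \<otimes> v12))"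
    and coun: "\<And>v. v \<in> V \<Longrightarrow> sweedler_on V (\<delta> v) (\<lambda>v0 v1. \<epsilon> v1 *\<^sub>C v0) = v"
    using assms by (auto simp: comodule_def)
  obtain p where p: "clinear p" "range p \<subseteq> V" "\<forall>v\<in>V. p v = v"
    using exists_projection[OF V] by blast
  define \<delta>' where "\<delta>' v = \<delta> (p v)" for v
  have pV: "p x \<in> V" for x using p(2) by blast
  have lin': "clinear \<delta>'"
    using p(1) lin pV by (simp add: clinear_iff clinear_on_def \<delta>'_def)
  have eq: "\<delta>' v = \<delta> v" if "v \<in> V" for v using that p by (simp add: \<delta>'_def)
  have bl: "cbilinear (\<lambda>a b. (a \<otimes> b) \<otimes> y)" for y :: 'a
    by (intro cbilinearI clinear_intros)
  have bl1: "cbilinear (\<lambda>x y. sweedler (\<delta>' x) (\<lambda>a b. (a \<otimes> b) \<otimes> y))"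
    by (intro cbilinearI clinear_compose[OF clinear_sweedler lin'] clinear_sweedler_arg clinear_intros)
  have bl2: "cbilinear (\<lambda>x y. sweedler (\<Delta> y) (\<lambda>a b. (x \<otimes> a) \<otimes> b))" for x :: 'b
    by (intro cbilinearI clinear_compose[OF clinear_sweedler linear_comult] clinear_sweedler_arg clinear_intros)
  have bl3: "cbilinear (\<lambda>x y. \<epsilon> y *\<^sub>C x)"
    by (intro cbilinearI clinear_intros linear_counit)
  have "global_comodule \<Delta> \<epsilon> S V \<delta>'"
  proof (intro global_comodule.intro global_comodule_axioms.intro hopf_algebra_axioms V lin')
    show "\<delta>' v \<in> tensor_within V UNIV" for v by (simp add: \<delta>'_def tw pV)
    fix v assume v: "v \<in> V"
    have "sweedler (\<delta>' v) (\<lambda>x y. sweedler (\<delta>' x) (\<lambda>a b. (a \<otimes> b) \<otimes> y)) =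
        sweedler_on V (\<delta> v) (\<lambda>v0 v1. sweedler_on V (\<delta> v0) (\<lambda>v00 v01. (v00 \<otimes> v01) \<otimes> v1))"
      unfolding eq[OF v]
    proof (rule sweedler_on_eq[symmetric, OF V tw[OF v] bl1])
      fix x and y :: 'a assume "x \<in> V"
      then show "sweedler_on V (\<delta> x) (\<lambda>a b. (a \<otimes> b) \<otimes> y) = sweedler (\<delta>' x) (\<lambda>a b. (a \<otimes> b) \<otimes> y)"
        unfolding eq[OF \<open>x \<in> V\<close>] by (rule sweedler_on_eq[OF V tw bl refl])
    qed
    also note coass[OF v]
    also have "sweedler_on V (\<delta> v) (\<lambda>v0 v1. sweedler (\<Delta> v1) (\<lambda>v11 v12. (v0 \<otimes> v11) \<otimes> v12)) =
        sweedler (\<delta>' v) (\<lambda>x y. sweedler (\<Delta> y) (\<lambda>a b. (x \<otimes> a) \<otimes> b))"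
      unfolding eq[OF v] by (rule sweedler_on_eq[OF V tw[OF v] bl2 refl])
    finally show "sweedler (\<delta>' v) (\<lambda>x y. sweedler (\<delta>' x) (\<lambda>a b. (a \<otimes> b) \<otimes> y)) =
        sweedler (\<delta>' v) (\<lambda>x y. sweedler (\<Delta> y) (\<lambda>a b. (x \<otimes> a) \<otimes> b))" .
    show "sweedler (\<delta>' v) (\<lambda>a b. \<epsilon> b *\<^sub>C a) = v"
      unfolding eq[OF v] using sweedler_on_eq[OF V tw[OF v] bl3 refl] coun[OF v] by (rule trans[OF sym])
  qed
  then show ?thesis using eq that by blast
qed

lemma finite_basis_of_subspace:
  fixes U :: "'a::complex_vector set"
  assumes "cvec.subspace U" "U \<subseteq> cvec.span F" "finite F"
  obtains B where "finite B" "cvec.independent B" "U = cvec.span B" "card B \<le> card F"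
proof -
  obtain B where B: "B \<subseteq> U" "cvec.independent B" "U \<subseteq> cvec.span B"
    using cvec.maximal_independent_subset by blast
  moreover from B assms(2) have "B \<subseteq> cvec.span F" by blast
  from cvec.independent_span_bound[OF assms(3) B(2) this] have "finite B" "card B \<le> card F" by auto
  moreover have "cvec.span B \<subseteq> U" using B(1) assms(1) by (rule cvec.span_minimal)
  ultimately show ?thesis using B by (intro that[of B]) auto
qed

text \<open>The orbit of a nonzero vector is a nonzero subcomodule with a finite spanning set, so
  simplicity makes it all of \<open>V\<close>.\<close>

lemma simple_comodule_finite_dim:
  assumes "hopf_algebra \<Delta> \<epsilon> S" "simple_comodule \<Delta> \<epsilon> V \<delta>"
  obtains B where "finite B" "V = cvec.span B"
proof -
  interpret hopf_algebra \<Delta> \<epsilon> S by fact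
  from assms(2) have cm: "comodule \<Delta> \<epsilon> V \<delta>" and "V \<noteq> {0}"
    and sub: "\<And>W. cvec.subspace W \<Longrightarrow> W \<subseteq> V \<Longrightarrow> \<delta> ` W \<subseteq> tensor_within W UNIV \<Longrightarrow> W = {0} \<or> W = V"
    by (auto simp: simple_comodule_def)
  obtain \<delta>' where \<delta>': "global_comodule \<Delta> \<epsilon> S V \<delta>'" "\<And>v. v \<in> V \<Longrightarrow> \<delta>' v = \<delta> v"
    using comodule_extend[OF cm] by blast
  interpret g: global_comodule \<Delta> \<epsilon> S V \<delta>' by fact
  obtain v where v: "v \<in> V" "v \<noteq> 0"
    using \<open>V \<noteq> {0}\<close> cvec.subspace_0[OF g.V] by auto
  have "g.orbit v = {0} \<or> g.orbit v = V"
  proof (rule sub[OF g.subspace_orbit g.orbit_subset])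
    show "\<delta> ` g.orbit v \<subseteq> tensor_within (g.orbit v) UNIV"
      using g.orbit_closed[OF v(1)] g.orbit_subset[of v] by (auto simp flip: \<delta>'(2))
  qed
  with g.orbit_self[OF v(1)] v(2) have "g.orbit v = V" by auto
  then obtain F where F: "finite F" "V \<subseteq> cvec.span F" by (metis g.orbit_finite)
  show ?thesis by (rule finite_basis_of_subspace[OF g.V F(2,1)]) (rule that)
qed

section \<open>Right coideals, simple subcoalgebras and functionals on a cosemisimple
  coalgebra\<close>

context hopf_algebra
begin

lemma comult_global_comodule: "global_comodule \<Delta> \<epsilon> S UNIV \<Delta>"
  by (intro global_comodule.intro global_comodule_axioms.intro hopf_algebra_axioms
      cvec.subspace_UNIV linear_comult tensor_within_UNIV coassoc counit_right)

lemmas coassoc_trilinear = coaction_trilinear[where \<delta> = \<Delta> and \<Delta> = \<Delta>, OF coassoc]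

lemma right_coideal_comodule:
  assumes W: "cvec.subspace W" and sub: "\<And>w. w \<in> W \<Longrightarrow> \<Delta> w \<in> tensor_within W UNIV"
  shows "comodule \<Delta> \<epsilon> W \<Delta>"
proof -
  have bl: "cbilinear (\<lambda>a b. (a \<otimes> b) \<otimes> y)" for y :: 'a
    by (intro cbilinearI clinear_intros)
  have bl1: "cbilinear (\<lambda>x y. sweedler (\<Delta> x) (\<lambda>a b. (a \<otimes> b) \<otimes> y))"
    by (intro cbilinearI clinear_compose[OF clinear_sweedler linear_comult] clinear_sweedler_arg clinear_intros)
  have bl2: "cbilinear (\<lambda>x y. sweedler (\<Delta> y) (\<lambda>a b. (x \<otimes> a) \<otimes> b))" for x :: 'a
    by (intro cbilinearI clinear_compose[OF clinear_sweedler linear_comult] clinear_sweedler_arg clinear_intros)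
  have bl3: "cbilinear (\<lambda>x y. \<epsilon> y *\<^sub>C x)"
    by (intro cbilinearI clinear_intros linear_counit)
  have lhs: "sweedler_on W (\<Delta> v) (\<lambda>x y. sweedler_on W (\<Delta> x) (\<lambda>a b. (a \<otimes> b) \<otimes> y)) =
      sweedler (\<Delta> v) (\<lambda>x y. sweedler (\<Delta> x) (\<lambda>a b. (a \<otimes> b) \<otimes> y))" if "v \<in> W" for v
    by (rule sweedler_on_eq[OF W sub[OF that] bl1]) (rule sweedler_on_eq[OF W sub bl refl])
  show ?thesis
    unfolding comodule_def
    using W sub linear_comult
    by (auto simp: clinear_on_def clinear_iff lhs coassoc counit_right
        sweedler_on_eq[OF W sub bl2 refl] sweedler_on_eq[OF W sub bl3 refl])
qed

text \<open>A nonzero right coideal in \<open>C\<close> of least dimension is simple. The orbit of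
  any nonzero element of \<open>C\<close> shows that finite-dimensional ones exist.\<close>

lemma ex_simple_right_coideal:
  assumes C: "subcoalgebra \<Delta> C" "C \<noteq> {0}"
  obtains W where "W \<subseteq> C" "simple_comodule \<Delta> \<epsilon> W \<Delta>"
proof -
  interpret g: global_comodule \<Delta> \<epsilon> S UNIV \<Delta> by (rule comult_global_comodule)
  \<comment> \<open>\<open>n\<close> counts some finite spanning set, possibly dependent. Minimizing
    over all such sets makes it the dimension, without a separate dimension theory.\<close>
  define P where "P n W \<longleftrightarrow> W \<subseteq> C \<and> W \<noteq> {0} \<and> cvec.subspace W \<and> \<Delta> ` W \<subseteq> tensor_within W UNIV \<and>
    (\<exists>F. finite F \<and> W = cvec.span F \<and> card F = n)" for n W
  have sC: "cvec.subspace C" and CC: "\<And>c. c \<in> C \<Longrightarrow> \<Delta> c \<in> tensor_within C C"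
    using C by (auto simp: subcoalgebra_def)
  obtain c where c: "c \<in> C" "c \<noteq> 0"
    using C(2) cvec.subspace_0[OF sC] by auto
  have "g.orbit c \<subseteq> C"
    unfolding g.orbit_def
    by (auto intro!: tensor_within_sweedler[OF CC[OF c(1)] _ sC] cbilinearI clinear_intros
        cvec.subspace_scale[OF sC])
  moreover have "c \<in> g.orbit c" by (simp add: g.orbit_self)
  moreover obtain F where F: "finite F" "g.orbit c \<subseteq> cvec.span F" by (rule g.orbit_finite)
  obtain B where "finite B" "g.orbit c = cvec.span B"
    by (rule finite_basis_of_subspace[OF g.subspace_orbit F(2,1)])
  ultimately have "\<exists>W. P (card B) W"
    unfolding P_def using c(2) g.subspace_orbit[of c] g.orbit_closed[of c]
    by (intro exI[of _ "g.orbit c"]) auto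
  then have ex: "\<exists>n W. P n W" by blast
  define n where "n = (LEAST n. \<exists>W. P n W)"
  have "\<exists>W. P n W" unfolding n_def by (rule LeastI_ex[OF ex])
  then obtain W where W: "P n W" by blast
  have min: "n \<le> m" if "P m U" for m U
    unfolding n_def by (rule Least_le) (use that in blast)
  from W obtain F where F: "finite F" "W = cvec.span F" "card F = n" by (auto simp: P_def)
  have "comodule \<Delta> \<epsilon> W \<Delta>"
    by (rule right_coideal_comodule) (use W in \<open>auto simp: P_def\<close>)
  moreover have "U = {0} \<or> U = W"
    if U: "cvec.subspace U" "U \<subseteq> W" "\<Delta> ` U \<subseteq> tensor_within U UNIV" for U
  proof (rule ccontr)
    assume *: "\<not> (U = {0} \<or> U = W)"
    obtain B where B: "finite B" "cvec.independent B" "U = cvec.span B" "card B \<le> card F"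
      by (rule finite_basis_of_subspace[OF U(1) U(2)[unfolded F(2)] F(1)])
    have "P (card B) U"
      unfolding P_def using * U B W by (auto simp: P_def)
    then have "n \<le> card B" by (rule min)
    from * U obtain x where x: "x \<in> W" "x \<notin> U" by blast
    have xB: "x \<notin> B" using x(2) B(3) cvec.span_base by blast
    \<comment> \<open>A vector of \<open>W\<close> outside \<open>U\<close> enlarges the basis of
      \<open>U\<close>, so \<open>U\<close> would be spanned by fewer than \<open>n\<close> vectors,
      against minimality.\<close>
    have "cvec.independent (insert x B)"
      using B(2,3) x(2) cvec.independent_insertI by blast
    moreover have "insert x B \<subseteq> cvec.span F"
      using x(1) F(2) U(2) B(3) cvec.span_superset by blast
    ultimately have "card (insert x B) \<le> card F"
      using cvec.independent_span_bound[OF F(1)] by blast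
    with xB B(1) \<open>n \<le> card B\<close> F(3) show False by simp
  qed
  ultimately show ?thesis
    using W by (intro that[of W]) (auto simp: P_def simple_comodule_def)
qed

text \<open>The span of the left slices of \<open>W\<close> is a subcoalgebra between
  \<open>W\<close> and \<open>C\<close>: a further left slice only convolves the functionals, and a
  right slice commutes with the left one and is absorbed by the right coideal \<open>W\<close>.
  Simplicity of \<open>C\<close> does the rest.\<close>

lemma simple_subcoalgebra_span:
  assumes C: "simple_subcoalgebra \<Delta> C" and W: "W \<subseteq> C" "simple_comodule \<Delta> \<epsilon> W \<Delta>"
  shows "C = cvec.span {sweedler (\<Delta> w) (\<lambda>a b. \<phi> a *\<^sub>C b) |\<phi> w. clinear \<phi> \<and> w \<in> W}"
    (is "C = cvec.span ?G")
proof -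
  let ?D = "cvec.span ?G"
  have sC: "cvec.subspace C" and CC: "\<And>c. c \<in> C \<Longrightarrow> \<Delta> c \<in> tensor_within C C"
    and simp: "\<And>D. subcoalgebra \<Delta> D \<Longrightarrow> D \<subseteq> C \<Longrightarrow> D = {0} \<or> D = C"
    using C by (auto simp: simple_subcoalgebra_def subcoalgebra_def)
  have sW: "cvec.subspace W" and WW: "\<And>w. w \<in> W \<Longrightarrow> \<Delta> w \<in> tensor_within W UNIV" and "W \<noteq> {0}"
    using W(2) by (auto simp: simple_comodule_def comodule_def)
  have lin1: "clinear (\<lambda>x. sweedler (\<Delta> x) (\<lambda>a b. \<psi> a *\<^sub>C b))"
    and lin2: "clinear (\<lambda>x. sweedler (\<Delta> x) (\<lambda>a b. \<psi> b *\<^sub>C a))" if "clinear \<psi>" for \<psi> :: "'a \<Rightarrow> complex"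
    by (intro clinear_compose[OF clinear_sweedler linear_comult] cbilinearI clinear_intros that)+
  have "W \<subseteq> ?D"
  proof
    fix w assume "w \<in> W"
    then have "w \<in> ?G" using counit_left[of w, symmetric] linear_counit by blast
    then show "w \<in> ?D" by (rule cvec.span_base)
  qed
  have "?D \<subseteq> C"
  proof (rule cvec.span_minimal[OF _ sC])
    show "?G \<subseteq> C"
      using W(1)
      by (auto intro!: tensor_within_sweedler[OF CC _ sC] cbilinearI clinear_intros
        cvec.subspace_scale[OF sC])
  qed
  moreover have "subcoalgebra \<Delta> ?D"
    unfolding subcoalgebra_def
  proof (intro conjI cvec.subspace_span image_subsetI)
    fix d assume d: "d \<in> ?D"
    show "\<Delta> d \<in> tensor_within ?D ?D"
    proof (rule tensor_withinI)
      fix \<psi> :: "'a \<Rightarrow> complex" assume \<psi>: "clinear \<psi>"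
      show "sweedler (\<Delta> d) (\<lambda>a b. \<psi> b *\<^sub>C a) \<in> ?D"
        using d
      proof (induction rule: cvec.span_induct)
        case base
        show ?case by (rule subspace_preimage[OF lin2[OF \<psi>] cvec.subspace_span])
      next
        case (step d)
        then obtain \<phi> w where \<phi>: "clinear \<phi>" and w: "w \<in> W"
          and d: "d = sweedler (\<Delta> w) (\<lambda>a b. \<phi> a *\<^sub>C b)" by blast
        have T: "trilinear (\<lambda>a b c. \<phi> a *\<^sub>C \<psi> c *\<^sub>C b)"
          by (intro trilinearI clinear_intros \<phi> \<psi>)
        have w': "sweedler (\<Delta> w) (\<lambda>a b. \<psi> b *\<^sub>C a) \<in> W"
          by (rule tensor_within_sweedler[OF WW[OF w] _ sW])
            (auto intro!: cbilinearI clinear_intros \<psi> cvec.subspace_scale[OF sW])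
        \<comment> \<open>The target is the left slice by \<open>\<phi>\<close> of the right slice
          of \<open>w\<close> by \<open>\<psi>\<close>, the latter being an element of
          \<open>W\<close> by \<open>w'\<close>.\<close>
        have "sweedler (\<Delta> d) (\<lambda>a b. \<psi> b *\<^sub>C a) =
            sweedler (\<Delta> w) (\<lambda>x y. \<phi> x *\<^sub>C sweedler (\<Delta> y) (\<lambda>a b. \<psi> b *\<^sub>C a))"
          unfolding d clinear_sweedler_out[OF lin2[OF \<psi>]]
          using lin2[OF \<psi>] by (simp add: clinear_iff)
        also have "\<dots> = sweedler (\<Delta> w) (\<lambda>x y. sweedler (\<Delta> x) (\<lambda>a b. \<phi> a *\<^sub>C \<psi> y *\<^sub>C b))"
          unfolding sweedler_on_scale[symmetric] by (rule coassoc_trilinear[OF T, symmetric])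
        also have "\<dots> = sweedler (\<Delta> w) (\<lambda>x y. \<psi> y *\<^sub>C sweedler (\<Delta> x) (\<lambda>a b. \<phi> a *\<^sub>C b))"
          unfolding sweedler_on_scale[symmetric] by (simp add: mult.commute)
        also have "\<dots> = sweedler (\<Delta> (sweedler (\<Delta> w) (\<lambda>a b. \<psi> b *\<^sub>C a))) (\<lambda>a b. \<phi> a *\<^sub>C b)"
          unfolding clinear_sweedler_out[OF lin1[OF \<phi>]]
          using lin1[OF \<phi>] by (simp add: clinear_iff)
        finally show ?case using w' \<phi> by (intro cvec.span_base) blast
      qed
    next
      fix \<psi> :: "'a \<Rightarrow> complex" assume \<psi>: "clinear \<psi>"
      show "sweedler (\<Delta> d) (\<lambda>a b. \<psi> a *\<^sub>C b) \<in> ?D"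
        using d
      proof (induction rule: cvec.span_induct)
        case base
        show ?case by (rule subspace_preimage[OF lin1[OF \<psi>] cvec.subspace_span])
      next
        case (step d)
        then obtain \<phi> w where \<phi>: "clinear \<phi>" and w: "w \<in> W"
          and d: "d = sweedler (\<Delta> w) (\<lambda>a b. \<phi> a *\<^sub>C b)" by blast
        have T: "trilinear (\<lambda>a b c. \<phi> a *\<^sub>C \<psi> b *\<^sub>C c)"
          by (intro trilinearI clinear_intros \<phi> \<psi>)
        have lin: "clinear (\<lambda>x. sweedler (\<Delta> x) (\<lambda>a b. \<phi> a * \<psi> b))"
          by (intro clinear_compose[OF clinear_sweedler linear_comult] cbilinearI clinear_intros \<phi> \<psi>)
        have out: "clinear (\<lambda>c. c *\<^sub>C y)" for y :: 'a by (intro clinear_intros)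
        have "sweedler (\<Delta> d) (\<lambda>a b. \<psi> a *\<^sub>C b) =
            sweedler (\<Delta> w) (\<lambda>x y. \<phi> x *\<^sub>C sweedler (\<Delta> y) (\<lambda>a b. \<psi> a *\<^sub>C b))"
          unfolding d clinear_sweedler_out[OF lin1[OF \<psi>]]
          using lin1[OF \<psi>] by (simp add: clinear_iff)
        also have "\<dots> = sweedler (\<Delta> w) (\<lambda>x y. sweedler (\<Delta> x) (\<lambda>a b. \<phi> a *\<^sub>C \<psi> b *\<^sub>C y))"
          unfolding sweedler_on_scale[symmetric] by (rule coassoc_trilinear[OF T, symmetric])
        also have "\<dots> = sweedler (\<Delta> w) (\<lambda>x y. sweedler (\<Delta> x) (\<lambda>a b. \<phi> a * \<psi> b) *\<^sub>C y)"
          by (simp add: clinear_sweedler_out[OF out] scaleC_scaleC)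
        finally show ?case using w lin
          by (intro cvec.span_base CollectI exI[of _ "\<lambda>x. sweedler (\<Delta> x) (\<lambda>a b. \<phi> a * \<psi> b)"]
              exI[of _ w] conjI)
      qed
    qed
  qed
  ultimately have "?D = {0} \<or> ?D = C" by (intro simp) auto
  then show ?thesis
    using \<open>W \<subseteq> ?D\<close> \<open>W \<noteq> {0}\<close> cvec.subspace_0[OF sW] by blast
qed

text \<open>Applying \<open>F\<close> to a left slice by \<open>\<phi>\<close> gives the same number
  as applying \<open>\<phi>\<close> to the right slice by \<open>F\<close>, which vanishes by
  \<open>zero\<close>. Left slices of a simple right coideal span its simple subcoalgebra, and the
  simple subcoalgebras span everything.\<close>

lemma functional_eq_0:
  assumes cos: "cosemisimple \<Delta>" and F: "clinear F"
    and zero: "\<And>W w. simple_comodule \<Delta> \<epsilon> W \<Delta> \<Longrightarrow> w \<in> W \<Longrightarrow> sweedler (\<Delta> w) (\<lambda>a b. F b *\<^sub>C a) = 0"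
  shows "F x = (0 :: complex)"
proof -
  have F_simps: "F (x + y) = F x + F y" "F (c *\<^sub>C x) = c * F x" "F 0 = 0" for x y c
    using F clinear_zero[OF F] by (auto simp: clinear_iff scaleC_complex_def)
  have ker: "cvec.subspace {x. F x = 0}"
    by (auto simp: cvec.subspace_def F_simps)
  have "C \<subseteq> {x. F x = 0}" if C: "simple_subcoalgebra \<Delta> C" for C
  proof -
    obtain W where W: "W \<subseteq> C" "simple_comodule \<Delta> \<epsilon> W \<Delta>"
      using ex_simple_right_coideal[of C] C unfolding simple_subcoalgebra_def by blast
    have "F (sweedler (\<Delta> w) (\<lambda>a b. \<phi> a *\<^sub>C b)) = 0" if "clinear \<phi>" "w \<in> W" for \<phi> w
    proof -
      have "F (sweedler (\<Delta> w) (\<lambda>a b. \<phi> a *\<^sub>C b)) = sweedler (\<Delta> w) (\<lambda>a b. \<phi> (F b *\<^sub>C a))"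
        unfolding clinear_sweedler_out[OF F] using that(1)
        by (simp add: F_simps clinear_iff scaleC_complex_def mult.commute)
      also have "\<dots> = \<phi> (sweedler (\<Delta> w) (\<lambda>a b. F b *\<^sub>C a))"
        by (simp add: clinear_sweedler_out[OF that(1)])
      also have "\<dots> = 0" using zero[OF W(2) that(2)] clinear_zero[OF that(1)] by simp
      finally show ?thesis .
    qed
    then have "cvec.span {sweedler (\<Delta> w) (\<lambda>a b. \<phi> a *\<^sub>C b) |\<phi> w. clinear \<phi> \<and> w \<in> W} \<subseteq> {x. F x = 0}"
      by (intro cvec.span_minimal[OF _ ker]) auto
    then show ?thesis using simple_subcoalgebra_span[OF C W] by simp
  qed
  then have "cvec.span (\<Union> {C. simple_subcoalgebra \<Delta> C}) \<subseteq> {x. F x = 0}"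
    by (intro cvec.span_minimal[OF _ ker]) auto
  then show ?thesis using cos by (auto simp: cosemisimple_def)
qed

end

section \<open>Scalar products on subspaces\<close>

locale inner_space =
  fixes X :: "'v::complex_vector set" and ip :: "'v \<Rightarrow> 'v \<Rightarrow> complex"
  assumes X: "cvec.subspace X" and scp: "scalar_product X ip"
begin

abbreviation n :: "'v \<Rightarrow> real" where "n \<equiv> ip_norm ip"

lemmas X_closed [simp] = cvec.subspace_0[OF X] cvec.subspace_add[OF X] cvec.subspace_diff[OF X]
  cvec.subspace_scale[OF X] cvec.subspace_neg[OF X]

lemma ip_add_left: "x \<in> X \<Longrightarrow> y \<in> X \<Longrightarrow> z \<in> X \<Longrightarrow> ip (x + y) z = ip x z + ip y z"
  and ip_scale_left: "x \<in> X \<Longrightarrow> z \<in> X \<Longrightarrow> ip (c *\<^sub>C x) z = c * ip x z"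
  and ip_cnj: "x \<in> X \<Longrightarrow> y \<in> X \<Longrightarrow> ip y x = cnj (ip x y)"
  and ip_pos: "x \<in> X \<Longrightarrow> x \<noteq> 0 \<Longrightarrow> Re (ip x x) > 0"
proof -
  have scp': "\<forall>w\<in>X. clinear_on X (\<lambda>v. ip v w)" "\<forall>v\<in>X. \<forall>w\<in>X. ip w v = cnj (ip v w)"
    "\<forall>v\<in>X. v \<noteq> 0 \<longrightarrow> Re (ip v v) > 0"
    using scp[unfolded scalar_product_def] by - (elim conjE, assumption)+
  show "x \<in> X \<Longrightarrow> y \<in> X \<Longrightarrow> z \<in> X \<Longrightarrow> ip (x + y) z = ip x z + ip y z"
    "x \<in> X \<Longrightarrow> z \<in> X \<Longrightarrow> ip (c *\<^sub>C x) z = c * ip x z"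
    using scp'(1) by (auto simp: clinear_on_def scaleC_complex_def)
  show "x \<in> X \<Longrightarrow> y \<in> X \<Longrightarrow> ip y x = cnj (ip x y)" using scp'(2) by blast
  show "x \<in> X \<Longrightarrow> x \<noteq> 0 \<Longrightarrow> Re (ip x x) > 0" using scp'(3) by blast
qed

lemma ip_add_right: "x \<in> X \<Longrightarrow> y \<in> X \<Longrightarrow> z \<in> X \<Longrightarrow> ip z (x + y) = ip z x + ip z y"
  by (metis X_closed(2) complex_cnj_add ip_add_left ip_cnj)

lemma ip_scale_right: "x \<in> X \<Longrightarrow> z \<in> X \<Longrightarrow> ip z (c *\<^sub>C x) = cnj c * ip z x"
  by (metis X_closed(4) complex_cnj_mult ip_scale_left ip_cnj)

lemma ip_zero: "x \<in> X \<Longrightarrow> ip 0 x = 0" "x \<in> X \<Longrightarrow> ip x 0 = 0"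
  using ip_add_left[of 0 0 x] ip_add_right[of 0 0 x] by auto

lemma ip_diff_left: "x \<in> X \<Longrightarrow> y \<in> X \<Longrightarrow> z \<in> X \<Longrightarrow> ip (x - y) z = ip x z - ip y z"
  using ip_add_left[of "x - y" y z] by simp

lemma ip_diff_right: "x \<in> X \<Longrightarrow> y \<in> X \<Longrightarrow> z \<in> X \<Longrightarrow> ip z (x - y) = ip z x - ip z y"
  using ip_add_right[of "x - y" y z] by simp

lemma ip_self_nonneg: "x \<in> X \<Longrightarrow> Re (ip x x) \<ge> 0"
  using ip_pos[of x] ip_zero by (cases "x = 0") auto

lemma n_square: "x \<in> X \<Longrightarrow> (n x)\<^sup>2 = Re (ip x x)"
  by (simp add: ip_norm_def ip_self_nonneg)

lemma ip_self: "x \<in> X \<Longrightarrow> ip x x = of_real ((n x)\<^sup>2)"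
  using ip_cnj[of x x] by (simp add: n_square complex_eq_iff)

lemma n_nonneg [simp]: "x \<in> X \<Longrightarrow> n x \<ge> 0"
  by (simp add: ip_norm_def ip_self_nonneg)

lemma n_eq_0: "x \<in> X \<Longrightarrow> n x = 0 \<longleftrightarrow> x = 0"
  using ip_pos[of x] ip_zero[of 0] by (cases "x = 0") (auto simp: ip_norm_def)

lemma n_zero [simp]: "n 0 = 0"
  using n_eq_0[of 0] by simp

lemma n_scale: "x \<in> X \<Longrightarrow> n (c *\<^sub>C x) = cmod c * n x"
proof -
  assume x: "x \<in> X"
  have "ip (c *\<^sub>C x) (c *\<^sub>C x) = (c * cnj c) * ip x x"
    using x by (simp add: ip_scale_left ip_scale_right)
  also have "\<dots> = of_real ((cmod c * n x)\<^sup>2)"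
    using x by (simp add: ip_self power_mult_distrib del: of_real_power flip: complex_norm_square)
  finally have "(n (c *\<^sub>C x))\<^sup>2 = (cmod c * n x)\<^sup>2"
    using x by (simp add: n_square del: of_real_power)
  then show ?thesis using x by (simp add: power2_eq_iff_nonneg)
qed

lemma n_uminus: "x \<in> X \<Longrightarrow> n (- x) = n x"
  using n_scale[of x "- 1"] by (simp add: scaleC_one)

lemma n_minus_commute: "x \<in> X \<Longrightarrow> y \<in> X \<Longrightarrow> n (x - y) = n (y - x)"
  using n_uminus[of "x - y"] by simp

lemma n_diff_square:
  "x \<in> X \<Longrightarrow> y \<in> X \<Longrightarrow> (n (x - y))\<^sup>2 = (n x)\<^sup>2 - 2 * Re (ip x y) + (n y)\<^sup>2"
  using ip_cnj[of x y] by (simp add: n_square ip_diff_left ip_diff_right)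

lemma cauchy_schwarz:
  assumes x: "x \<in> X" and y: "y \<in> X"
  shows "cmod (ip x y) \<le> n x * n y"
proof (cases "y = 0")
  case False
  then have pos: "n y > 0" using y n_eq_0[of y] n_nonneg[of y] by linarith
  define c where "c = ip x y / of_real ((n y)\<^sup>2)"
  have "Re (ip x (c *\<^sub>C y)) = Re (ip x y * cnj (ip x y)) / (n y)\<^sup>2"
    using x y by (simp add: ip_scale_right c_def mult.commute del: of_real_power)
  also have "\<dots> = (cmod (ip x y))\<^sup>2 / (n y)\<^sup>2"
    by (simp del: of_real_power flip: complex_norm_square)
  finally have r: "Re (ip x (c *\<^sub>C y)) = (cmod (ip x y))\<^sup>2 / (n y)\<^sup>2" .
  have "n (c *\<^sub>C y) = cmod (ip x y) / n y"
    using y pos by (simp add: n_scale c_def norm_divide norm_mult power2_eq_square)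
  then have "(n (c *\<^sub>C y))\<^sup>2 = (cmod (ip x y))\<^sup>2 / (n y)\<^sup>2"
    by (simp add: power_divide)
  then have "0 \<le> (n x)\<^sup>2 - (cmod (ip x y))\<^sup>2 / (n y)\<^sup>2"
    using n_diff_square[of x "c *\<^sub>C y"] r x y zero_le_power2[of "n (x - c *\<^sub>C y)"] by simp
  then have "(cmod (ip x y))\<^sup>2 \<le> (n x * n y)\<^sup>2"
    using pos by (simp add: field_simps power_mult_distrib)
  then show ?thesis using x y by (rule_tac power2_le_imp_le) auto
qed (use x ip_zero in auto)

lemma n_triangle:
  assumes x: "x \<in> X" and y: "y \<in> X"
  shows "n (x + y) \<le> n x + n y"
proof -
  have "(n (x + y))\<^sup>2 = (n x)\<^sup>2 + 2 * Re (ip x y) + (n y)\<^sup>2"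
    using ip_cnj[of x y] x y by (simp add: n_square ip_add_left ip_add_right)
  also have "Re (ip x y) \<le> n x * n y"
    using cauchy_schwarz[OF x y] complex_Re_le_cmod[of "ip x y"] by linarith
  finally have "(n (x + y))\<^sup>2 \<le> (n x + n y)\<^sup>2"
    by (simp add: power2_sum)
  then show ?thesis by (rule power2_le_imp_le) (use x y in simp)
qed

lemma n_triangle_diff: "x \<in> X \<Longrightarrow> y \<in> X \<Longrightarrow> z \<in> X \<Longrightarrow> n (x - z) \<le> n (x - y) + n (y - z)"
  using n_triangle[of "x - y" "y - z"] by simp

section \<open>Limits with respect to the norm of a scalar product\<close>

text \<open>Spelled out by distances because the ambient type carries no topology and the norm is
  meaningful on \<open>X\<close> only.\<close>

definition conv :: "(nat \<Rightarrow> 'v) \<Rightarrow> 'v \<Rightarrow> bool"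
  where "conv u y \<longleftrightarrow> (\<lambda>k. n (u k - y)) \<longlonglongrightarrow> 0"

lemma conv_sandwich:
  assumes "\<And>k. n (u k - y) \<le> g k" "g \<longlonglongrightarrow> 0" "\<And>k. u k \<in> X" "y \<in> X"
  shows "conv u y"
  unfolding conv_def
  by (rule tendsto_sandwich[OF _ _ tendsto_const assms(2)]) (use assms in auto)

lemma conv_const: "y \<in> X \<Longrightarrow> conv (\<lambda>_. y) y"
  by (simp add: conv_def)

lemma conv_unique:
  assumes "conv u y" "conv u z" "\<And>k. u k \<in> X" "y \<in> X" "z \<in> X"
  shows "y = z"
proof -
  have "(\<lambda>k. n (u k - y) + n (u k - z)) \<longlonglongrightarrow> 0 + 0"
    using assms(1,2) unfolding conv_def by (rule tendsto_add)
  moreover have "n (y - z) \<le> n (u k - y) + n (u k - z)" for k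
    using n_triangle_diff[of y "u k" z] n_minus_commute[of y "u k"] assms by simp
  ultimately have "n (y - z) \<le> 0"
    by (intro LIMSEQ_le_const[where X = "\<lambda>k. n (u k - y) + n (u k - z)"]) auto
  then have "n (y - z) = 0" using n_nonneg[of "y - z"] assms by (simp del: n_nonneg)
  then show ?thesis using n_eq_0[of "y - z"] assms by simp
qed

lemma conv_add:
  assumes "conv u y" "conv v z" "\<And>k. u k \<in> X" "\<And>k. v k \<in> X" "y \<in> X" "z \<in> X"
  shows "conv (\<lambda>k. u k + v k) (y + z)"
proof (rule conv_sandwich)
  show "(\<lambda>k. n (u k - y) + n (v k - z)) \<longlonglongrightarrow> 0"
    using tendsto_add[OF assms(1,2)[unfolded conv_def]] by simp
  show "n (u k + v k - (y + z)) \<le> n (u k - y) + n (v k - z)" for k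
    using n_triangle[of "u k - y" "v k - z"] assms by (simp add: algebra_simps)
qed (use assms in auto)

lemma conv_scale:
  assumes "conv u y" "\<And>k. u k \<in> X" "y \<in> X"
  shows "conv (\<lambda>k. c *\<^sub>C u k) (c *\<^sub>C y)"
proof (rule conv_sandwich)
  show "(\<lambda>k. cmod c * n (u k - y)) \<longlonglongrightarrow> 0"
    using tendsto_mult_left[OF assms(1)[unfolded conv_def]] by simp
  show "n (c *\<^sub>C u k - c *\<^sub>C y) \<le> cmod c * n (u k - y)" for k
    using n_scale[of "u k - y" c] assms by (simp add: cvec.scale_right_diff_distrib)
qed (use assms in auto)

lemma conv_n_le:
  assumes "conv u y" "\<And>k. u k \<in> X" "y \<in> X" "\<And>k. n (u k) \<le> B k" "B \<longlonglongrightarrow> b"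
  shows "n y \<le> b"
proof -
  have "n y \<le> B k + n (u k - y)" for k
    using n_triangle[of "u k" "y - u k"] n_minus_commute[of y "u k"] assms(2,4)[of k] assms(3) by simp
  moreover have "(\<lambda>k. B k + n (u k - y)) \<longlonglongrightarrow> b + 0"
    using assms(5,1) unfolding conv_def by (rule tendsto_add)
  ultimately show ?thesis
    by (intro LIMSEQ_le_const[where X = "\<lambda>k. B k + n (u k - y)"]) auto
qed

lemma conv_ip:
  assumes "conv u y" "\<And>k. u k \<in> X" "y \<in> X" "z \<in> X"
  shows "(\<lambda>k. ip (u k) z) \<longlonglongrightarrow> ip y z"
proof (rule LIM_zero_cancel, rule tendsto_norm_zero_cancel, rule tendsto_sandwich[OF _ _ tendsto_const])
  show "(\<lambda>k. n (u k - y) * n z) \<longlonglongrightarrow> 0"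
    using tendsto_mult_right[OF assms(1)[unfolded conv_def]] by simp
  have "cmod (ip (u k) z - ip y z) \<le> n (u k - y) * n z" for k
    using cauchy_schwarz[of "u k - y" z] assms by (simp add: ip_diff_left)
  then show "\<forall>\<^sub>F k in sequentially. cmod (ip (u k) z - ip y z) \<le> n (u k - y) * n z"
    by simp
qed auto

end

section \<open>Contractivity of unitary representations\<close>

lemma norm_cadj: "norm (cadj x) = norm (x :: 'b::cstar_algebra)"
proof -
  have *: "norm x \<le> norm (cadj x)" for x :: 'b
  proof (cases "x = 0")
    case False
    have "norm x * norm x \<le> norm (cadj x) * norm x"
      using cstar_identity[of x] norm_mult_ineq[of "cadj x" x] by (simp add: power2_eq_square)
    then show ?thesis using False by simp
  qed simp
  show ?thesis using *[of x] *[of "cadj x"] by (simp add: cadj_cadj)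
qed

lemma cadj_diff: "cadj (x - y) = cadj x - cadj (y :: 'b::cstar_algebra)"
  using cadj_add[of "x - y" y] by simp

text \<open>\<open>k = 1 - sqrt (1 - q)\<close>, obtained without a unit as a fixed point.\<close>

lemma ex_selfadjoint_root:
  fixes q :: "'b::cstar_algebra"
  assumes q: "cadj q = q" "norm q < 1" and "q \<in> D" "closed D" "cvec.subspace D"
    and mult: "\<And>x. x \<in> D \<Longrightarrow> x * x \<in> D"
  obtains k where "k \<in> D" "cadj k = k" "k + k = q + k * k"
proof -
  \<comment> \<open>\<open>r\<close> is the scalar counterpart of \<open>k\<close>, the smaller
    solution of \<open>2 * r = norm q + r * r\<close>. It serves both as the radius of a ball mapped
    into itself by \<open>g\<close> below and as the contraction constant there, which is why
    \<open>norm q < 1\<close> must be strict.\<close>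
  define r where "r = 1 - sqrt (1 - norm q)"
  have r: "0 \<le> r" "r < 1" and qr: "norm q + r * r = 2 * r"
  proof -
    have "norm q \<ge> 0" "1 - norm q > 0" using q by auto
    then show "0 \<le> r" "r < 1" by (simp_all add: r_def)
    have "(1 - r)\<^sup>2 = 1 - norm q" using q by (simp add: r_def)
    then show "norm q + r * r = 2 * r" by (simp add: power2_eq_square algebra_simps)
  qed
  define g where "g k = (1/2) *\<^sub>R (q + k * k)" for k :: 'b
  have contr: "norm (g k - g l) \<le> r * norm (k - l)" if "norm k \<le> r" "norm l \<le> r" for k l
  proof -
    have "g k - g l = (1/2) *\<^sub>R (k * (k - l) + (k - l) * l)"
      by (simp add: g_def algebra_simps)
    then have "norm (g k - g l) = norm (k * (k - l) + (k - l) * l) / 2" by simp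
    also have "norm (k * (k - l) + (k - l) * l) \<le> norm k * norm (k - l) + norm (k - l) * norm l"
      by (intro norm_triangle_le add_mono norm_mult_ineq)
    also have "\<dots> \<le> r * norm (k - l) + norm (k - l) * r"
      using that by (intro add_mono mult_right_mono mult_left_mono) auto
    finally show ?thesis by simp
  qed
  have maps: "norm (g k) \<le> r" if "norm k \<le> r" for k
  proof -
    have "norm (g k) = norm (q + k * k) / 2" by (simp add: g_def)
    also have "norm (q + k * k) \<le> norm q + norm k * norm k"
      by (intro norm_triangle_le add_left_mono norm_mult_ineq)
    also have "norm k * norm k \<le> r * r" using that r by (intro mult_mono) auto
    finally show ?thesis using qr by simp
  qed
  have "\<exists>!k\<in>D \<inter> cball 0 r. g k = k"
  proof (rule Banach_fix[OF _ _ r])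
    show "complete (D \<inter> cball 0 r)"
      using assms(4) by (simp add: complete_eq_closed closed_Int)
    show "D \<inter> cball 0 r \<noteq> {}"
      using cvec.subspace_0[OF assms(5)] r(1) by auto
    show "g ` (D \<inter> cball 0 r) \<subseteq> D \<inter> cball 0 r"
    proof (intro image_subsetI IntI)
      fix k assume k: "k \<in> D \<inter> cball 0 r"
      then show "g k \<in> D"
        using mult assms(3,5) unfolding g_def scaleR_eq_scaleC
        by (intro cvec.subspace_scale cvec.subspace_add) auto
      show "g k \<in> cball 0 r" using maps k by simp
    qed
    show "dist (g x) (g y) \<le> r * dist x y" if "x \<in> D \<inter> cball 0 r" "y \<in> D \<inter> cball 0 r" for x y
      using contr that by (simp add: dist_norm)
  qed
  then obtain k where k: "k \<in> D" "norm k \<le> r" "g k = k" by auto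
  \<comment> \<open>\<open>cadj k\<close> is also a fixed point in the ball, but \<open>D\<close> is
    not assumed stable under \<open>cadj\<close>. Therefore the contraction estimate on the whole
    ball is used instead of uniqueness inside \<open>D\<close>.\<close>
  have "g (cadj k) = cadj (g k)"
    by (simp add: g_def scaleR_eq_scaleC cadj_scaleC cadj_add cadj_mult q(1))
  then have "norm (k - cadj k) \<le> r * norm (k - cadj k)"
    using contr[of k "cadj k"] k by (simp add: norm_cadj)
  then have "(1 - r) * norm (k - cadj k) \<le> 0" by (simp add: algebra_simps)
  then have "cadj k = k" using r by (simp add: mult_le_0_iff)
  moreover have "k + k = q + k * k"
  proof -
    have "k + k = 2 *\<^sub>R g k" using k(3) by (simp add: scaleR_2)
    then show ?thesis by (simp add: g_def)
  qed
  ultimately show ?thesis using k(1) that by blast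
qed

lemma unitary_repD:
  assumes "unitary_rep mul invol (X, ip, \<pi>)"
  shows "inner_space X ip" "hilbert_space X ip"
    "\<And>a x. x \<in> X \<Longrightarrow> \<pi> a x \<in> X" "\<And>a. clinear_on X (\<pi> a)" "\<And>x. x \<in> X \<Longrightarrow> clinear (\<lambda>a. \<pi> a x)"
    "\<And>a b x. x \<in> X \<Longrightarrow> \<pi> (mul a b) x = \<pi> a (\<pi> b x)"
    "\<And>a x y. x \<in> X \<Longrightarrow> y \<in> X \<Longrightarrow> ip (\<pi> a x) y = ip x (\<pi> (invol a) y)"
    "\<And>a. bounded_operator X ip (\<pi> a)"
  using assms by (fastforce simp: unitary_rep_def hilbert_space_def inner_space_def bounded_operator_def)+

text \<open>\<open>alg\<close> keeps the root inside the image of the algebra, so that it has a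
  preimage on which \<open>\<sigma>\<close> is defined. \<open>ker\<close> transports relations
  between images under \<open>\<iota>\<close> to relations between operators. The identity embedding
  with \<open>D = UNIV\<close> covers representations of a C*-algebra.\<close>

lemma unitary_rep_contractive:
  fixes \<iota> :: "'h::complex_vector \<Rightarrow> 'b::cstar_algebra"
  assumes rep: "unitary_rep mul invol (X, ip, \<sigma>)"
    and lin: "clinear \<iota>" and mult: "\<And>a b. \<iota> (mul a b) = \<iota> a * \<iota> b"
    and adj: "\<And>a. \<iota> (invol a) = cadj (\<iota> a)"
    and ker: "\<And>a x. \<iota> a = 0 \<Longrightarrow> x \<in> X \<Longrightarrow> \<sigma> a x = 0"
    and alg: "\<And>a. \<exists>D. a \<in> D \<and> cvec.subspace D \<and> closed (\<iota> ` D) \<and> (\<forall>b\<in>D. mul b b \<in> D)"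
    and x: "x \<in> X"
  shows "ip_norm ip (\<sigma> a x) \<le> norm (\<iota> a) * ip_norm ip x"
proof -
  interpret inner_space X ip using unitary_repD(1)[OF rep] .
  note \<sigma> = unitary_repD(3,5-7)[OF rep]
  define h where "h = mul (invol a) a"
  have \<iota>_simps: "\<iota> (u + v) = \<iota> u + \<iota> v" "\<iota> (u - v) = \<iota> u - \<iota> v" "\<iota> (c *\<^sub>C u) = c *\<^sub>C \<iota> u" for u v c
    using lin clinear_diff[OF lin] by (simp_all add: clinear_iff)
  have \<sigma>_simps: "\<sigma> (u + v) x = \<sigma> u x + \<sigma> v x" "\<sigma> (u - v) x = \<sigma> u x - \<sigma> v x"
    "\<sigma> (c *\<^sub>C u) x = c *\<^sub>C \<sigma> u x" for u v c
    using \<sigma>(2)[OF x] clinear_diff[OF \<sigma>(2)[OF x]] by (simp_all add: clinear_iff)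
  have \<iota>h: "\<iota> h = cadj (\<iota> a) * \<iota> a" by (simp add: h_def mult adj)
  obtain D where D: "h \<in> D" "cvec.subspace D" "closed (\<iota> ` D)" "\<And>b. b \<in> D \<Longrightarrow> mul b b \<in> D"
    using alg[of h] by blast
  have sub: "cvec.subspace (\<iota> ` D)"
    using D(2) by (auto simp: cvec.subspace_def simp flip: \<iota>_simps intro!: image_eqI[of 0 \<iota> 0] clinear_zero[OF lin, symmetric])
  have bound: "n (\<sigma> a x) \<le> s * n x" if s: "s > norm (\<iota> a)" for s
  proof -
    have s0: "s > 0" using s norm_ge_zero[of "\<iota> a"] by linarith
    \<comment> \<open>Dividing by \<open>s\<^sup>2\<close> brings the norm of
      \<open>\<iota> h\<close>, which is the square of the norm of \<open>\<iota> a\<close>,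
      strictly below \<open>1\<close>, as the root requires.\<close>
    define c where "c = complex_of_real (1 / s\<^sup>2)"
    have "(norm (\<iota> a))\<^sup>2 < s\<^sup>2" using s by (intro power_strict_mono) auto
    then have nq: "norm (c *\<^sub>C \<iota> h) < 1"
      using s0 by (simp add: \<iota>h norm_scaleC cstar_identity c_def norm_divide norm_power)
    have sa: "cadj (c *\<^sub>C \<iota> h) = c *\<^sub>C \<iota> h"
      by (simp add: \<iota>h cadj_scaleC cadj_mult cadj_cadj c_def)
    have inD: "c *\<^sub>C \<iota> h \<in> \<iota> ` D"
      by (rule cvec.subspace_scale[OF sub]) (use D in blast)
    obtain k where k: "k \<in> \<iota> ` D" "cadj k = k" "k + k = c *\<^sub>C \<iota> h + k * k"
      by (rule ex_selfadjoint_root[OF sa nq inD D(3) sub])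
        (use D(4) in \<open>auto simp flip: mult\<close>)
    then obtain d where d: "d \<in> D" "k = \<iota> d" by blast
    \<comment> \<open>Only the image of this difference is known to vanish; \<open>ker\<close> turns
      that into a relation between the operators. Selfadjointness of the root is transported in the
      same way.\<close>
    have "\<iota> (d + d - (c *\<^sub>C h + mul d d)) = 0"
      using k(3) by (simp add: \<iota>_simps mult d)
    then have "\<sigma> (d + d - (c *\<^sub>C h + mul d d)) x = 0" using x by (rule ker)
    then have eq: "\<sigma> d x + \<sigma> d x = c *\<^sub>C \<sigma> h x + \<sigma> d (\<sigma> d x)"
      by (simp add: \<sigma>_simps \<sigma>(3)[OF x])
    have "\<iota> (invol d - d) = 0" using k(2) by (simp add: \<iota>_simps adj d)
    then have "\<sigma> (invol d - d) x = 0" using x by (rule ker)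
    then have dd: "\<sigma> (invol d) x = \<sigma> d x" by (simp add: \<sigma>_simps)
    have dx: "\<sigma> d x \<in> X" by (rule \<sigma>(1)[OF x])
    have 1: "ip (\<sigma> d (\<sigma> d x)) x = of_real ((n (\<sigma> d x))\<^sup>2)"
      using \<sigma>(4)[OF dx x, of d] ip_self[OF dx] dd by simp
    have "ip x (\<sigma> h x) = of_real ((n (\<sigma> a x))\<^sup>2)"
      using \<sigma>(4)[OF x \<sigma>(1)[OF x], of a a] ip_self[OF \<sigma>(1)[OF x]] by (simp add: h_def \<sigma>(3)[OF x])
    then have 2: "ip (\<sigma> h x) x = of_real ((n (\<sigma> a x))\<^sup>2)"
      using ip_cnj[OF x \<sigma>(1)[OF x]] by simp
    have "ip (\<sigma> d x + \<sigma> d x) x = ip (c *\<^sub>C \<sigma> h x + \<sigma> d (\<sigma> d x)) x" by (simp only: eq)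
    then have "2 * ip (\<sigma> d x) x = c * ip (\<sigma> h x) x + ip (\<sigma> d (\<sigma> d x)) x"
      using x \<sigma>(1) by (simp add: ip_add_left ip_scale_left)
    then have "Re (2 * ip (\<sigma> d x) x) = Re (c * of_real ((n (\<sigma> a x))\<^sup>2) + of_real ((n (\<sigma> d x))\<^sup>2))"
      by (simp only: 1 2)
    then have "2 * Re (ip (\<sigma> d x) x) = (1 / s\<^sup>2) * (n (\<sigma> a x))\<^sup>2 + (n (\<sigma> d x))\<^sup>2"
      by (simp add: c_def flip: of_real_power of_real_mult of_real_divide)
    moreover have "Re (ip x (\<sigma> d x)) = Re (ip (\<sigma> d x) x)" using ip_cnj[OF x dx] by simp
    \<comment> \<open>The two formulas make
      \<open>(n x)\<^sup>2 - (1 / s\<^sup>2) * (n (\<sigma> a x))\<^sup>2\<close> equal to the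
      square \<open>(n (x - \<sigma> d x))\<^sup>2\<close>.\<close>
    ultimately have "(1 / s\<^sup>2) * (n (\<sigma> a x))\<^sup>2 \<le> (n x)\<^sup>2"
      using n_diff_square[OF x dx] zero_le_power2[of "n (x - \<sigma> d x)"] by simp
    then have "(n (\<sigma> a x))\<^sup>2 \<le> (s * n x)\<^sup>2"
      using s0 by (simp add: field_simps power_mult_distrib)
    then show ?thesis by (rule power2_le_imp_le) (use s0 x in simp)
  qed
  show ?thesis
  proof (rule field_le_epsilon)
    fix e :: real assume e: "e > 0"
    \<comment> \<open>The summand \<open>1\<close> in the denominator allows \<open>n x = 0\<close>
      and keeps the surplus \<open>e * (n x / (n x + 1))\<close> below \<open>e\<close>.\<close>
    define s where "s = norm (\<iota> a) + e / (n x + 1)"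
    have nx: "n x \<ge> 0" using x by simp
    have "n (\<sigma> a x) \<le> s * n x" using e nx by (intro bound) (simp add: s_def)
    also have "\<dots> = norm (\<iota> a) * n x + e * (n x / (n x + 1))" by (simp add: s_def algebra_simps)
    also have "n x / (n x + 1) \<le> 1" using nx by simp
    finally show "n (\<sigma> a x) \<le> norm (\<iota> a) * n x + e" using e by simp
  qed
qed

section \<open>Extension to the completion\<close>

locale bounded_rep =
  fixes mul :: "'h::complex_vector \<Rightarrow> 'h \<Rightarrow> 'h" and invol :: "'h \<Rightarrow> 'h"
    and \<iota> :: "'h \<Rightarrow> 'b::cstar_algebra"
    and X :: "'v::complex_vector set" and ip and \<sigma> :: "'h \<Rightarrow> 'v \<Rightarrow> 'v"
  assumes rep: "unitary_rep mul invol (X, ip, \<sigma>)"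
    and lin: "clinear \<iota>" and mult: "\<iota> (mul a b) = \<iota> a * \<iota> b" and adj: "\<iota> (invol a) = cadj (\<iota> a)"
    and dense: "closure (range \<iota>) = UNIV"
    and bound: "x \<in> X \<Longrightarrow> ip_norm ip (\<sigma> a x) \<le> norm (\<iota> a) * ip_norm ip x"
begin

sublocale inner_space X ip using unitary_repD(1)[OF rep] .

lemmas \<sigma> = unitary_repD(3-7)[OF rep]

lemma \<iota>_simps: "\<iota> (u + v) = \<iota> u + \<iota> v" "\<iota> (u - v) = \<iota> u - \<iota> v" "\<iota> (c *\<^sub>C u) = c *\<^sub>C \<iota> u"
  using lin clinear_diff[OF lin] by (simp_all add: clinear_iff)

lemma \<sigma>_simps:
  assumes "x \<in> X"
  shows "\<sigma> (u + v) x = \<sigma> u x + \<sigma> v x" "\<sigma> (u - v) x = \<sigma> u x - \<sigma> v x" "\<sigma> (c *\<^sub>C u) x = c *\<^sub>C \<sigma> u x"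
  using \<sigma>(3)[OF assms] clinear_diff[OF \<sigma>(3)[OF assms]] by (simp_all add: clinear_iff)

lemma \<sigma>_lin:
  assumes "x \<in> X" "y \<in> X"
  shows "\<sigma> u (x + y) = \<sigma> u x + \<sigma> u y" "\<sigma> u (x - y) = \<sigma> u x - \<sigma> u y" "\<sigma> u (c *\<^sub>C x) = c *\<^sub>C \<sigma> u x"
proof -
  show 1: "\<sigma> u (x + y) = \<sigma> u x + \<sigma> u y" and 2: "\<sigma> u (c *\<^sub>C x) = c *\<^sub>C \<sigma> u x"
    using \<sigma>(2)[of u] assms by (simp_all add: clinear_on_def)
  have "\<sigma> u ((x - y) + y) = \<sigma> u (x - y) + \<sigma> u y"
    using \<sigma>(2)[of u] assms(2) X_closed(3)[OF assms] unfolding clinear_on_def by blast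
  then show "\<sigma> u (x - y) = \<sigma> u x - \<sigma> u y" by simp
qed

lemma approx: obtains s where "(\<lambda>k. \<iota> (s k)) \<longlonglongrightarrow> b"
proof -
  have "b \<in> closure (range \<iota>)" by (simp add: dense)
  then obtain t where t: "\<forall>k. t k \<in> range \<iota>" "t \<longlonglongrightarrow> b" unfolding closure_sequential by blast
  then have "\<forall>k. \<exists>a. t k = \<iota> a" by auto
  from choice[OF this] obtain s where "\<forall>k. t k = \<iota> (s k)" ..
  then have "t = (\<lambda>k. \<iota> (s k))" by auto
  then show ?thesis using that[of s] t(2) by simp
qed

text \<open>The images of the approximants form a Cauchy sequence by \<open>bound\<close>, and the
  Hilbert space is complete. One \<open>y\<close> serves all approximating sequences at once, which
  frees later proofs to pick sequences adapted to sums, products and multiples.\<close>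

lemma ex_extension:
  assumes x: "x \<in> X"
  shows "\<exists>y\<in>X. \<forall>s. (\<lambda>k. \<iota> (s k)) \<longlonglongrightarrow> b \<longrightarrow> conv (\<lambda>k. \<sigma> (s k) x) y"
proof -
  obtain s where s: "(\<lambda>k. \<iota> (s k)) \<longlonglongrightarrow> b" by (rule approx)
  have diff: "n (\<sigma> u x - \<sigma> v x) \<le> norm (\<iota> u - \<iota> v) * n x" for u v
    using bound[OF x, of "u - v"] by (simp add: \<sigma>_simps[OF x] \<iota>_simps)
  have hil: "\<And>u. range u \<subseteq> X \<Longrightarrow> (\<And>e. e > 0 \<Longrightarrow> \<exists>N. \<forall>m\<ge>N. \<forall>k\<ge>N. n (u m - u k) < e) \<Longrightarrow>
      \<exists>y\<in>X. (\<lambda>k. n (u k - y)) \<longlonglongrightarrow> 0"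
    using unitary_repD(2)[OF rep] by (simp add: hilbert_space_def)
  have "\<exists>y\<in>X. (\<lambda>k. n (\<sigma> (s k) x - y)) \<longlonglongrightarrow> 0"
  proof (rule hil)
    show "range (\<lambda>k. \<sigma> (s k) x) \<subseteq> X" using \<sigma>(1)[OF x] by auto
    fix e :: real assume e: "e > 0"
    have nx: "n x \<ge> 0" using x by simp
    have "Cauchy (\<lambda>k. \<iota> (s k))" using s by (rule LIMSEQ_imp_Cauchy)
    then obtain N where N: "\<And>m k. m \<ge> N \<Longrightarrow> k \<ge> N \<Longrightarrow> norm (\<iota> (s m) - \<iota> (s k)) < e / (n x + 1)"
      using e nx unfolding Cauchy_iff by (metis add_nonneg_pos divide_pos_pos zero_less_one)
    have "n (\<sigma> (s m) x - \<sigma> (s k) x) < e" if "m \<ge> N" "k \<ge> N" for m k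
    proof -
      have "n (\<sigma> (s m) x - \<sigma> (s k) x) \<le> norm (\<iota> (s m) - \<iota> (s k)) * n x" by (rule diff)
      also have "\<dots> \<le> norm (\<iota> (s m) - \<iota> (s k)) * (n x + 1)" by (intro mult_left_mono) auto
      also have "\<dots> < e" using N[OF that] nx by (simp add: field_simps)
      finally show ?thesis .
    qed
    then show "\<exists>N. \<forall>m\<ge>N. \<forall>k\<ge>N. n (\<sigma> (s m) x - \<sigma> (s k) x) < e" by blast
  qed
  then obtain y where y: "y \<in> X" "(\<lambda>k. n (\<sigma> (s k) x - y)) \<longlonglongrightarrow> 0" by blast
  have "conv (\<lambda>k. \<sigma> (t k) x) y" if t: "(\<lambda>k. \<iota> (t k)) \<longlonglongrightarrow> b" for t
  proof (rule conv_sandwich)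
    show "n (\<sigma> (t k) x - y) \<le> norm (\<iota> (t k) - \<iota> (s k)) * n x + n (\<sigma> (s k) x - y)" for k
      using n_triangle_diff[OF \<sigma>(1)[OF x] \<sigma>(1)[OF x] y(1), of "t k" "s k"] diff[of "t k" "s k"] by linarith
    have "(\<lambda>k. norm (\<iota> (t k) - \<iota> (s k)) * n x + n (\<sigma> (s k) x - y)) \<longlonglongrightarrow> norm (b - b) * n x + 0"
      by (intro tendsto_intros s t y)
    then show "(\<lambda>k. norm (\<iota> (t k) - \<iota> (s k)) * n x + n (\<sigma> (s k) x - y)) \<longlonglongrightarrow> 0" by simp
  qed (use y \<sigma>(1)[OF x] in auto)
  with y(1) show ?thesis by blast
qed

definition ext :: "'b \<Rightarrow> 'v \<Rightarrow> 'v"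
  where "ext b x = (SOME y. y \<in> X \<and> (\<forall>s. (\<lambda>k. \<iota> (s k)) \<longlonglongrightarrow> b \<longrightarrow> conv (\<lambda>k. \<sigma> (s k) x) y))"

lemma ext_in: "x \<in> X \<Longrightarrow> ext b x \<in> X"
  and ext_conv: "x \<in> X \<Longrightarrow> (\<lambda>k. \<iota> (s k)) \<longlonglongrightarrow> b \<Longrightarrow> conv (\<lambda>k. \<sigma> (s k) x) (ext b x)"
proof -
  have "ext b x \<in> X \<and> (\<forall>s. (\<lambda>k. \<iota> (s k)) \<longlonglongrightarrow> b \<longrightarrow> conv (\<lambda>k. \<sigma> (s k) x) (ext b x))" if "x \<in> X"
    unfolding ext_def by (rule someI_ex) (use ex_extension[OF that] in blast)
  then show "x \<in> X \<Longrightarrow> ext b x \<in> X"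
    "x \<in> X \<Longrightarrow> (\<lambda>k. \<iota> (s k)) \<longlonglongrightarrow> b \<Longrightarrow> conv (\<lambda>k. \<sigma> (s k) x) (ext b x)"
    by blast+
qed

text \<open>Limits are unique, so one approximating sequence suffices to identify a value of
  \<open>ext\<close>. The algebraic laws of \<open>ext\<close> are checked along sequences assembled
  from those of the arguments.\<close>

lemma ext_eqI:
  assumes "x \<in> X" "(\<lambda>k. \<iota> (s k)) \<longlonglongrightarrow> b" "conv (\<lambda>k. \<sigma> (s k) x) y" "y \<in> X"
  shows "ext b x = y"
  by (rule conv_unique[OF ext_conv[OF assms(1,2)] assms(3)]) (use assms \<sigma>(1) ext_in in auto)

lemma ext_\<iota>: "x \<in> X \<Longrightarrow> ext (\<iota> a) x = \<sigma> a x"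
  by (rule ext_eqI[of x "\<lambda>_. a"]) (auto simp: conv_const \<sigma>(1))

lemma ext_bound:
  assumes x: "x \<in> X"
  shows "n (ext b x) \<le> norm b * n x"
proof -
  obtain s where s: "(\<lambda>k. \<iota> (s k)) \<longlonglongrightarrow> b" by (rule approx)
  show ?thesis
    by (rule conv_n_le[OF ext_conv[OF x s] \<sigma>(1)[OF x] ext_in[OF x] bound[OF x]])
      (intro tendsto_intros s)
qed

lemma ext_linear_left:
  assumes x: "x \<in> X"
  shows "clinear (\<lambda>b. ext b x)"
  unfolding clinear_iff
proof (intro conjI allI)
  fix b c
  obtain s where s: "(\<lambda>k. \<iota> (s k)) \<longlonglongrightarrow> b" by (rule approx)
  obtain t where t: "(\<lambda>k. \<iota> (t k)) \<longlonglongrightarrow> c" by (rule approx)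
  show "ext (b + c) x = ext b x + ext c x"
  proof (rule ext_eqI[OF x])
    show "(\<lambda>k. \<iota> (s k + t k)) \<longlonglongrightarrow> b + c"
      unfolding \<iota>_simps by (intro tendsto_intros s t)
    show "conv (\<lambda>k. \<sigma> (s k + t k) x) (ext b x + ext c x)"
      unfolding \<sigma>_simps[OF x]
      by (intro conv_add ext_conv[OF x] s t \<sigma>(1)[OF x] ext_in[OF x])
  qed (simp add: ext_in[OF x])
  fix z :: complex
  show "ext (z *\<^sub>C b) x = z *\<^sub>C ext b x"
  proof (rule ext_eqI[OF x])
    have "(\<lambda>k. norm (\<iota> (s k) - b)) \<longlonglongrightarrow> 0" using s by (simp add: LIM_zero tendsto_norm_zero)
    from tendsto_mult_left[OF this, of "cmod z"]
    have "(\<lambda>k. norm (z *\<^sub>C \<iota> (s k) - z *\<^sub>C b)) \<longlonglongrightarrow> 0"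
      unfolding cvec.scale_right_diff_distrib[symmetric] norm_scaleC by simp
    then show "(\<lambda>k. \<iota> (z *\<^sub>C s k)) \<longlonglongrightarrow> z *\<^sub>C b"
      unfolding \<iota>_simps by (rule LIM_zero_cancel[OF tendsto_norm_zero_cancel])
    show "conv (\<lambda>k. \<sigma> (z *\<^sub>C s k) x) (z *\<^sub>C ext b x)"
      unfolding \<sigma>_simps[OF x]
      by (intro conv_scale ext_conv[OF x] s \<sigma>(1)[OF x] ext_in[OF x])
  qed (simp add: ext_in[OF x])
qed

lemma ext_linear_right: "clinear_on X (ext b)"
  unfolding clinear_on_def
proof (intro conjI ballI allI)
  obtain s where s: "(\<lambda>k. \<iota> (s k)) \<longlonglongrightarrow> b" by (rule approx)
  fix x assume x: "x \<in> X"
  { fix y assume y: "y \<in> X"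
    show "ext b (x + y) = ext b x + ext b y"
    proof (rule ext_eqI[OF _ s])
      show "conv (\<lambda>k. \<sigma> (s k) (x + y)) (ext b x + ext b y)"
        unfolding \<sigma>_lin[OF x y]
        by (intro conv_add ext_conv s \<sigma>(1) ext_in x y)
    qed (simp_all add: ext_in x y) }
  fix c :: complex
  show "ext b (c *\<^sub>C x) = c *\<^sub>C ext b x"
  proof (rule ext_eqI[OF _ s])
    show "conv (\<lambda>k. \<sigma> (s k) (c *\<^sub>C x)) (c *\<^sub>C ext b x)"
      unfolding \<sigma>_lin[OF x x]
      by (intro conv_scale ext_conv s \<sigma>(1) ext_in x)
  qed (simp_all add: ext_in x)
qed

lemma ext_mult:
  assumes x: "x \<in> X"
  shows "ext (b * c) x = ext b (ext c x)"
proof -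
  obtain s where s: "(\<lambda>k. \<iota> (s k)) \<longlonglongrightarrow> b" by (rule approx)
  obtain t where t: "(\<lambda>k. \<iota> (t k)) \<longlonglongrightarrow> c" by (rule approx)
  have cx: "ext c x \<in> X" by (rule ext_in[OF x])
  show ?thesis
  proof (rule ext_eqI[OF x])
    show "(\<lambda>k. \<iota> (mul (s k) (t k))) \<longlonglongrightarrow> b * c"
      unfolding mult by (intro tendsto_intros s t)
    show "conv (\<lambda>k. \<sigma> (mul (s k) (t k)) x) (ext b (ext c x))"
    proof (rule conv_sandwich)
      \<comment> \<open>The intermediate point is \<open>\<sigma> (s k) (ext c x)\<close>. The first
        error carries the factor \<open>norm (\<iota> (s k))\<close>, which converges, so it
        vanishes in the limit although \<open>s\<close> and \<open>t\<close> move together.\<close>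
      have "(\<lambda>k. norm (\<iota> (s k)) * n (\<sigma> (t k) x - ext c x) + n (\<sigma> (s k) (ext c x) - ext b (ext c x)))
          \<longlonglongrightarrow> norm b * 0 + 0"
        using ext_conv[OF x t] ext_conv[OF cx s] unfolding conv_def by (intro tendsto_intros s)
      then show "(\<lambda>k. norm (\<iota> (s k)) * n (\<sigma> (t k) x - ext c x) + n (\<sigma> (s k) (ext c x) - ext b (ext c x)))
          \<longlonglongrightarrow> 0" by simp
      fix k
      have "n (\<sigma> (s k) (\<sigma> (t k) x) - \<sigma> (s k) (ext c x)) \<le> norm (\<iota> (s k)) * n (\<sigma> (t k) x - ext c x)"
        using bound[of "\<sigma> (t k) x - ext c x" "s k"] \<sigma>(1)[OF x] cx by (simp add: \<sigma>_lin)
      then show "n (\<sigma> (mul (s k) (t k)) x - ext b (ext c x)) \<le>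
          norm (\<iota> (s k)) * n (\<sigma> (t k) x - ext c x) + n (\<sigma> (s k) (ext c x) - ext b (ext c x))"
        using n_triangle_diff[of "\<sigma> (s k) (\<sigma> (t k) x)" "\<sigma> (s k) (ext c x)" "ext b (ext c x)"]
        by (simp add: \<sigma>(4)[OF x] \<sigma>(1) x cx ext_in)
    qed (simp_all add: \<sigma>(1) x cx ext_in)
  qed (rule ext_in[OF cx])
qed

lemma ext_adjoint:
  assumes x: "x \<in> X" and y: "y \<in> X"
  shows "ip (ext b x) y = ip x (ext (cadj b) y)"
proof -
  obtain s where s: "(\<lambda>k. \<iota> (s k)) \<longlonglongrightarrow> b" by (rule approx)
  have "(\<lambda>k. norm (\<iota> (s k) - b)) \<longlonglongrightarrow> 0" using s by (simp add: LIM_zero tendsto_norm_zero)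
  then have "(\<lambda>k. norm (\<iota> (invol (s k)) - cadj b)) \<longlonglongrightarrow> 0"
    by (simp add: adj norm_cadj flip: cadj_diff)
  then have s': "(\<lambda>k. \<iota> (invol (s k))) \<longlonglongrightarrow> cadj b"
    by (rule LIM_zero_cancel[OF tendsto_norm_zero_cancel])
  have "(\<lambda>k. ip (\<sigma> (s k) x) y) \<longlonglongrightarrow> ip (ext b x) y"
    by (intro conv_ip ext_conv s \<sigma>(1) ext_in x y)
  \<comment> \<open>\<open>conv_ip\<close> gives continuity in the first argument, hence the passage
    through conjugates.\<close>
  moreover have "(\<lambda>k. cnj (ip (\<sigma> (invol (s k)) y) x)) \<longlonglongrightarrow> cnj (ip (ext (cadj b) y) x)"
    by (intro tendsto_intros conv_ip ext_conv s' \<sigma>(1) ext_in x y)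
  moreover have "cnj (ip (\<sigma> (invol (s k)) y) x) = ip (\<sigma> (s k) x) y" for k
    using ip_cnj[OF \<sigma>(1)[OF y] x, of "invol (s k)"] \<sigma>(5)[OF x y] by simp
  ultimately have "ip (ext b x) y = cnj (ip (ext (cadj b) y) x)"
    by (simp add: LIMSEQ_unique)
  then show ?thesis using ip_cnj[OF ext_in[OF y] x] by simp
qed

lemma ext_unitary_rep: "unitary_rep (*) cadj (X, ip, ext)"
  unfolding unitary_rep_def bounded_operator_def prod.case
proof (intro conjI allI ballI)
  show "hilbert_space X ip" using unitary_repD(2)[OF rep] .
  show "ext b ` X \<subseteq> X" for b using ext_in by blast
  show "\<exists>K. \<forall>x\<in>X. ip_norm ip (ext b x) \<le> K * ip_norm ip x" for b
    using ext_bound by blast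
qed (fact ext_linear_right ext_linear_left ext_mult ext_adjoint)+

end

context bounded_rep
begin

text \<open>\<open>ext b y\<close> is a limit of vectors \<open>\<sigma> (s k) y\<close>, which a
  closed \<open>\<sigma>\<close>-invariant subspace contains; conversely \<open>\<sigma>\<close> is
  \<open>ext\<close> on the image of \<open>\<iota>\<close>.\<close>

lemma closed_subspace_ext_invariant:
  assumes Y: "closed_subspace X ip Y"
  shows "(\<forall>b. ext b ` Y \<subseteq> Y) \<longleftrightarrow> (\<forall>a. \<sigma> a ` Y \<subseteq> Y)"
proof -
  have YX: "Y \<subseteq> X" and cl: "\<And>u x. range u \<subseteq> Y \<Longrightarrow> x \<in> X \<Longrightarrow> (\<lambda>k. n (u k - x)) \<longlonglongrightarrow> 0 \<Longrightarrow> x \<in> Y"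
    using Y unfolding closed_subspace_def by blast+
  show ?thesis
  proof
    assume inv: "\<forall>b. ext b ` Y \<subseteq> Y"
    show "\<forall>a. \<sigma> a ` Y \<subseteq> Y"
    proof (intro allI image_subsetI)
      fix a y assume y: "y \<in> Y"
      then have "ext (\<iota> a) y \<in> Y" using inv by blast
      then show "\<sigma> a y \<in> Y" using ext_\<iota>[of y a] YX y by auto
    qed
  next
    assume inv: "\<forall>a. \<sigma> a ` Y \<subseteq> Y"
    show "\<forall>b. ext b ` Y \<subseteq> Y"
    proof (intro allI image_subsetI)
      fix b y assume y: "y \<in> Y"
      then have yX: "y \<in> X" using YX by blast
      obtain s where s: "(\<lambda>k. \<iota> (s k)) \<longlonglongrightarrow> b" by (rule approx)
      show "ext b y \<in> Y"
      proof (rule cl)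
        show "range (\<lambda>k. \<sigma> (s k) y) \<subseteq> Y" using inv y by blast
        show "(\<lambda>k. n (\<sigma> (s k) y - ext b y)) \<longlonglongrightarrow> 0"
          using ext_conv[OF yX s] by (simp add: conv_def)
      qed (rule ext_in[OF yX])
    qed
  qed
qed

lemma ext_nonzero: "(\<exists>b. \<exists>x\<in>X. ext b x \<noteq> 0) \<longleftrightarrow> (\<exists>a. \<exists>x\<in>X. \<sigma> a x \<noteq> 0)"
proof
  assume "\<exists>a. \<exists>x\<in>X. \<sigma> a x \<noteq> 0"
  then show "\<exists>b. \<exists>x\<in>X. ext b x \<noteq> 0" using ext_\<iota> by metis
next
  assume "\<exists>b. \<exists>x\<in>X. ext b x \<noteq> 0"
  then obtain b x where bx: "x \<in> X" "ext b x \<noteq> 0" by blast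
  show "\<exists>a. \<exists>x\<in>X. \<sigma> a x \<noteq> 0"
  proof (rule ccontr)
    assume *: "\<not> (\<exists>a. \<exists>x\<in>X. \<sigma> a x \<noteq> 0)"
    obtain s where s: "(\<lambda>k. \<iota> (s k)) \<longlonglongrightarrow> b" by (rule approx)
    have "ext b x = 0"
      by (rule ext_eqI[OF bx(1) s]) (use * bx(1) in \<open>simp_all add: conv_const\<close>)
    with bx show False by simp
  qed
qed

lemma ext_irreducible:
  "irreducible_unitary_rep (*) cadj (X, ip, ext) \<longleftrightarrow> irreducible_unitary_rep mul invol (X, ip, \<sigma>)"
  unfolding irreducible_unitary_rep_def prod.case
  using rep ext_unitary_rep ext_nonzero closed_subspace_ext_invariant by metis

end

text \<open>Operators are determined on the carrier only. A representation and the extension of its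
  restriction agree there, not necessarily as functions on the ambient type.\<close>

lemma irreducible_unitary_rep_cong:
  assumes eq: "\<And>a x. x \<in> X \<Longrightarrow> \<pi> a x = \<pi>' a x"
    and irr: "irreducible_unitary_rep mul invol (X, ip, \<pi>)"
  shows "irreducible_unitary_rep mul invol (X, ip, \<pi>')"
proof -
  have rep: "unitary_rep mul invol (X, ip, \<pi>)" and nz: "\<exists>a. \<exists>x\<in>X. \<pi> a x \<noteq> 0"
    and inv: "\<And>Y. closed_subspace X ip Y \<Longrightarrow> (\<And>a. \<pi> a ` Y \<subseteq> Y) \<Longrightarrow> Y = {0} \<or> Y = X"
    using irr by (auto simp: irreducible_unitary_rep_def)
  note r = unitary_repD[OF rep]
  interpret inner_space X ip by (rule r(1))
  have "unitary_rep mul invol (X, ip, \<pi>')"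
    unfolding unitary_rep_def prod.case
  proof (intro conjI allI ballI)
    show "hilbert_space X ip" by (rule r(2))
    show "bounded_operator X ip (\<pi>' a)" for a
      using r(8)[of a] eq by (simp add: bounded_operator_def clinear_on_def image_subset_iff)
    show "clinear (\<lambda>a. \<pi>' a x)" if "x \<in> X" for x
      using r(5)[OF that] eq[OF that] by simp
    show "\<pi>' (mul a b) x = \<pi>' a (\<pi>' b x)" if "x \<in> X" for a b x
      using r(6)[OF that, of a b] by (simp add: eq that eq[OF r(3)[OF that], symmetric] flip: eq)
    show "ip (\<pi>' a x) y = ip x (\<pi>' (invol a) y)" if "x \<in> X" "y \<in> X" for a x y
      using r(7)[OF that, of a] by (simp add: eq that)
  qed
  moreover have "\<exists>a. \<exists>x\<in>X. \<pi>' a x \<noteq> 0" using nz eq by metis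
  moreover have "Y = {0} \<or> Y = X" if "closed_subspace X ip Y" "\<And>a. \<pi>' a ` Y \<subseteq> Y" for Y
  proof (rule inv[OF that(1)])
    have "Y \<subseteq> X" using that(1) by (simp add: closed_subspace_def)
    then show "\<pi> a ` Y \<subseteq> Y" for a using that(2)[of a] eq by (auto simp: image_subset_iff subset_iff)
  qed
  ultimately show ?thesis by (simp add: irreducible_unitary_rep_def)
qed

section \<open>Equivalence classes of irreducible representations\<close>

lemma irreps_iff: "\<rho> \<in> irreps mul invol \<longleftrightarrow> irreducible_unitary_rep mul invol \<rho>"
  by (simp add: irreps_def)

lemma irrep_unitary_rep: "(X, ip, \<pi>) \<in> irreps mul invol \<Longrightarrow> unitary_rep mul invol (X, ip, \<pi>)"
  by (simp add: irreps_def irreducible_unitary_rep_def)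

lemma unitarily_equivalent_refl: "unitarily_equivalent \<rho> \<rho>"
  by (cases \<rho>) (auto simp: unitarily_equivalent_def clinear_on_def intro!: exI[of _ "\<lambda>x. x"] bij_betw_imageI)

lemma unitarily_equivalent_sym:
  assumes rep: "unitary_rep mul invol (X, ip, \<pi>)" and eq: "unitarily_equivalent (X, ip, \<pi>) (X', ip', \<pi>')"
  shows "unitarily_equivalent (X', ip', \<pi>') (X, ip, \<pi>)"
proof -
  interpret inner_space X ip by (rule unitary_repD(1)[OF rep])
  obtain U where U: "clinear_on X U" "bij_betw U X X'"
    "\<And>x y. x \<in> X \<Longrightarrow> y \<in> X \<Longrightarrow> ip' (U x) (U y) = ip x y"
    "\<And>a x. x \<in> X \<Longrightarrow> U (\<pi> a x) = \<pi>' a (U x)"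
    using eq by (auto simp: unitarily_equivalent_def)
  define W where "W = inv_into X U"
  have W: "bij_betw W X' X" unfolding W_def by (rule bij_betw_inv_into[OF U(2)])
  have WX: "W x \<in> X" if "x \<in> X'" for x using W that by (auto simp: bij_betw_def)
  have UW: "U (W x) = x" if "x \<in> X'" for x
    unfolding W_def using U(2) that by (rule bij_betw_inv_into_right)
  have WU: "W (U x) = x" if "x \<in> X" for x
    unfolding W_def using U(2) that by (rule bij_betw_inv_into_left)
  have add: "U (x + y) = U x + U y" and scale: "U (c *\<^sub>C x) = c *\<^sub>C U x" if "x \<in> X" "y \<in> X" for x y c
    using U(1) that by (auto simp: clinear_on_def)
  have "W (x + y) = W x + W y" if "x \<in> X'" "y \<in> X'" for x y
    using add[OF WX[OF that(1)] WX[OF that(2)]] WU[of "W x + W y"] that by (simp add: UW WX)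
  moreover have "W (c *\<^sub>C x) = c *\<^sub>C W x" if "x \<in> X'" for x c
    using scale[OF WX[OF that] WX[OF that]] WU[of "c *\<^sub>C W x"] that by (simp add: UW WX)
  moreover have "ip (W x) (W y) = ip' x y" if "x \<in> X'" "y \<in> X'" for x y
    using U(3)[OF WX[OF that(1)] WX[OF that(2)]] that by (simp add: UW)
  moreover have "W (\<pi>' a x) = \<pi> a (W x)" if "x \<in> X'" for a x
    using U(4)[OF WX[OF that], of a] WU[of "\<pi> a (W x)"] that
    by (simp add: UW WX unitary_repD(3)[OF rep])
  ultimately show ?thesis
    unfolding unitarily_equivalent_def clinear_on_def prod.case using W by (intro exI[of _ W]) auto
qed

lemma unitarily_equivalent_trans:
  assumes "unitarily_equivalent (X, ip, \<pi>) (X', ip', \<pi>')" "unitarily_equivalent (X', ip', \<pi>') (X'', ip'', \<pi>'')"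
  shows "unitarily_equivalent (X, ip, \<pi>) (X'', ip'', \<pi>'')"
proof -
  obtain U where U: "clinear_on X U" "bij_betw U X X'"
    "\<And>x y. x \<in> X \<Longrightarrow> y \<in> X \<Longrightarrow> ip' (U x) (U y) = ip x y"
    "\<And>a x. x \<in> X \<Longrightarrow> U (\<pi> a x) = \<pi>' a (U x)"
    using assms(1) by (auto simp: unitarily_equivalent_def)
  obtain W where W: "clinear_on X' W" "bij_betw W X' X''"
    "\<And>x y. x \<in> X' \<Longrightarrow> y \<in> X' \<Longrightarrow> ip'' (W x) (W y) = ip' x y"
    "\<And>a x. x \<in> X' \<Longrightarrow> W (\<pi>' a x) = \<pi>'' a (W x)"
    using assms(2) by (auto simp: unitarily_equivalent_def)
  have UX: "U x \<in> X'" if "x \<in> X" for x using U(2) that by (auto simp: bij_betw_def)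
  have "bij_betw (\<lambda>x. W (U x)) X X''"
    using bij_betw_trans[OF U(2) W(2)] by (simp add: comp_def)
  moreover have "clinear_on X (\<lambda>x. W (U x))"
    using U(1) W(1) UX by (simp add: clinear_on_def)
  ultimately show ?thesis
    unfolding unitarily_equivalent_def prod.case
    using U(3,4) W(3,4) UX by (intro exI[of _ "\<lambda>x. W (U x)"]) simp
qed

lemma equiv_irrep_equiv: "equiv (irreps mul invol) (irrep_equiv mul invol)"
proof (rule equivI)
  show "irrep_equiv mul invol \<subseteq> irreps mul invol \<times> irreps mul invol"
    by (auto simp: irrep_equiv_def)
  show "refl_on (irreps mul invol) (irrep_equiv mul invol)"
    by (auto simp: refl_on_def irrep_equiv_def unitarily_equivalent_refl)
  show "sym (irrep_equiv mul invol)"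
    unfolding sym_def irrep_equiv_def
    by (auto intro: unitarily_equivalent_sym[OF irrep_unitary_rep])
  show "trans (irrep_equiv mul invol)"
    unfolding trans_def irrep_equiv_def by (auto intro: unitarily_equivalent_trans)
qed

lemma ex_bij_betw_quotient:
  assumes r: "equiv A r" and s: "equiv B s" and F: "\<And>x. x \<in> A \<Longrightarrow> F x \<in> B"
    and iff: "\<And>x y. x \<in> A \<Longrightarrow> y \<in> A \<Longrightarrow> (F x, F y) \<in> s \<longleftrightarrow> (x, y) \<in> r"
    and surj: "\<And>z. z \<in> B \<Longrightarrow> \<exists>x\<in>A. (F x, z) \<in> s"
  shows "\<exists>\<Phi>. bij_betw \<Phi> (A // r) (B // s) \<and> (\<forall>x\<in>A. \<Phi> (r `` {x}) = s `` {F x})"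
proof -
  \<comment> \<open>The image of a class is saturated under \<open>s\<close> to form a full class,
    so no representatives have to be chosen.\<close>
  define \<Phi> where "\<Phi> c = s `` (F ` c)" for c
  have \<Phi>: "\<Phi> (r `` {x}) = s `` {F x}" if x: "x \<in> A" for x
  proof (intro equalityI subsetI)
    fix z assume "z \<in> \<Phi> (r `` {x})"
    then obtain y where y: "(x, y) \<in> r" "(F y, z) \<in> s" by (auto simp: \<Phi>_def)
    then have "y \<in> A" using r by (auto simp: equiv_def)
    then have "(F x, F y) \<in> s" using iff x y(1) by simp
    then show "z \<in> s `` {F x}" using y(2) s by (auto simp: equiv_def dest: transD)
  next
    fix z assume "z \<in> s `` {F x}"
    moreover have "(x, x) \<in> r" using r x by (auto simp: equiv_def refl_on_def)
    ultimately show "z \<in> \<Phi> (r `` {x})" by (auto simp: \<Phi>_def)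
  qed
  have "inj_on \<Phi> (A // r)"
  proof (rule inj_onI)
    fix c d assume "c \<in> A // r" "d \<in> A // r" and eq: "\<Phi> c = \<Phi> d"
    then obtain x y where x: "x \<in> A" "c = r `` {x}" and y: "y \<in> A" "d = r `` {y}"
      by (auto simp: quotient_def)
    have "s `` {F x} = s `` {F y}" using eq x y by (simp add: \<Phi>)
    then have "(F x, F y) \<in> s" using eq_equiv_class[OF _ s F[OF y(1)]] by blast
    then show "c = d" using iff x y equiv_class_eq[OF r] by simp
  qed
  moreover have "\<Phi> ` (A // r) = B // s"
  proof (intro equalityI subsetI)
    fix e assume "e \<in> \<Phi> ` (A // r)"
    then obtain x where "x \<in> A" "e = \<Phi> (r `` {x})" by (auto simp: quotient_def)
    then show "e \<in> B // s" using F by (auto simp: \<Phi> intro: quotientI)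
  next
    fix e assume "e \<in> B // s"
    then obtain z where z: "z \<in> B" "e = s `` {z}" by (auto simp: quotient_def)
    obtain x where x: "x \<in> A" "(F x, z) \<in> s" using surj[OF z(1)] by blast
    then have "e = \<Phi> (r `` {x})" using equiv_class_eq[OF s x(2)] z by (simp add: \<Phi>)
    then show "e \<in> \<Phi> ` (A // r)" using x(1) by (auto intro: quotientI)
  qed
  ultimately show ?thesis using \<Phi> by (auto simp: bij_betw_def)
qed

text \<open>The correspondence is restriction along \<open>\<iota>\<close>. Density and continuity
  show that it neither loses invariant subspaces nor gains intertwiners, and \<open>ext\<close>
  supplies a preimage for each representation of the dense algebra.\<close>

theorem irreps_completion_bij:
  fixes \<iota> :: "'h::complex_vector \<Rightarrow> 'b::cstar_algebra"
  assumes lin: "clinear \<iota>" and mult: "\<And>a b. \<iota> (mul a b) = \<iota> a * \<iota> b"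
    and adj: "\<And>a. \<iota> (invol a) = cadj (\<iota> a)" and dense: "closure (range \<iota>) = UNIV"
    and bound: "\<And>(X :: 'v::complex_vector set) ip \<sigma> a x. unitary_rep mul invol (X, ip, \<sigma>) \<Longrightarrow> x \<in> X \<Longrightarrow>
      ip_norm ip (\<sigma> a x) \<le> norm (\<iota> a) * ip_norm ip x"
  shows "\<exists>\<Phi> :: ('b, 'v) rep set \<Rightarrow> ('h, 'v) rep set.
    bij_betw \<Phi> (irreps (*) cadj // irrep_equiv (*) cadj) (irreps mul invol // irrep_equiv mul invol) \<and>
    (\<forall>(X, ip, \<pi>) \<in> irreps (*) cadj.
      \<Phi> (irrep_equiv (*) cadj `` {(X, ip, \<pi>)}) = irrep_equiv mul invol `` {(X, ip, \<pi> \<circ> \<iota>)})"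
proof -
  define F :: "('b, 'v) rep \<Rightarrow> ('h, 'v) rep" where "F = (\<lambda>(X, ip, \<pi>). (X, ip, \<pi> \<circ> \<iota>))"
  have bounded: "bounded_rep mul invol \<iota> X ip \<sigma>" if "unitary_rep mul invol (X, ip, \<sigma>)" for X :: "'v set" and ip \<sigma>
    by (intro bounded_rep.intro that lin mult adj dense bound[OF that])
  \<comment> \<open>Contractivity is automatic for a C*-algebra: in
    \<open>unitary_rep_contractive\<close> take the identity for \<open>\<iota>\<close> and
    \<open>UNIV\<close>, which is trivially closed, for \<open>D\<close>.\<close>
  have contr: "ip_norm ip (\<pi> b x) \<le> norm b * ip_norm ip x"
    if rep: "unitary_rep (*) cadj (X, ip, \<pi>)" and x: "x \<in> X"
    for X :: "'v set" and ip and \<pi> :: "'b \<Rightarrow> 'v \<Rightarrow> 'v" and b x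
  proof (rule unitary_rep_contractive[OF rep _ _ _ _ _ x, where \<iota> = "\<lambda>b. b"])
    show "\<pi> a x = 0" if "a = 0" "x \<in> X" for a x
      using clinear_zero[OF unitary_repD(5)[OF rep that(2)]] that(1) by simp
  qed (auto intro!: clinear_ident exI[of _ UNIV])
  have pull: "unitary_rep mul invol (X, ip, \<pi> \<circ> \<iota>)"
    if "unitary_rep (*) cadj (X, ip, \<pi>)" for X :: "'v set" and ip \<pi>
    using that clinear_compose[OF _ lin]
    by (auto simp: unitary_rep_def mult adj)
  \<comment> \<open>Being contractive, \<open>\<pi>\<close> is continuous in the algebra variable,
    so \<open>\<pi> b x\<close> is the limit that defines the extension.\<close>
  have ext: "bounded_rep.ext \<iota> X ip (\<pi> \<circ> \<iota>) b x = \<pi> b x"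
    if repB: "unitary_rep (*) cadj (X, ip, \<pi>)" and x: "x \<in> X"
    for X :: "'v set" and ip and \<pi> :: "'b \<Rightarrow> 'v \<Rightarrow> 'v" and b x
  proof -
    interpret bounded_rep mul invol \<iota> X ip "\<pi> \<circ> \<iota>" by (rule bounded[OF pull[OF repB]])
    obtain s where s: "(\<lambda>k. \<iota> (s k)) \<longlonglongrightarrow> b" by (rule approx)
    show ?thesis
    proof (rule ext_eqI[OF x s])
      have "(\<lambda>k. norm (\<iota> (s k) - b)) \<longlonglongrightarrow> 0" using s by (simp add: LIM_zero tendsto_norm_zero)
      from tendsto_mult_right[OF this, of "n x"]
      have lim: "(\<lambda>k. norm (\<iota> (s k) - b) * n x) \<longlonglongrightarrow> 0" by simp
      show "conv (\<lambda>k. (\<pi> \<circ> \<iota>) (s k) x) (\<pi> b x)"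
      proof (rule conv_sandwich[OF _ lim])
        show "n ((\<pi> \<circ> \<iota>) (s k) x - \<pi> b x) \<le> norm (\<iota> (s k) - b) * n x" for k
          using contr[OF repB x, of "\<iota> (s k) - b"] clinear_diff[OF unitary_repD(5)[OF repB x]] by simp
      qed (use unitary_repD(3)[OF repB x] in auto)
    qed (rule unitary_repD(3)[OF repB x])
  qed
  have F_in: "F \<rho> \<in> irreps mul invol" if \<rho>: "\<rho> \<in> irreps (*) cadj" for \<rho>
  proof -
    obtain X ip \<pi> where \<rho>_eq: "\<rho> = (X, ip, \<pi>)" by (cases \<rho>)
    have repB: "unitary_rep (*) cadj (X, ip, \<pi>)" using \<rho> \<rho>_eq irrep_unitary_rep by blast
    interpret bounded_rep mul invol \<iota> X ip "\<pi> \<circ> \<iota>" by (rule bounded[OF pull[OF repB]])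
    have "irreducible_unitary_rep (*) cadj (X, ip, ext)"
      by (rule irreducible_unitary_rep_cong[of X \<pi>])
        (use \<rho> \<rho>_eq ext[OF repB] in \<open>simp_all add: irreps_iff\<close>)
    then show ?thesis by (simp add: irreps_iff F_def \<rho>_eq ext_irreducible)
  qed
  have F_iff: "(F \<rho>, F \<rho>') \<in> irrep_equiv mul invol \<longleftrightarrow> (\<rho>, \<rho>') \<in> irrep_equiv (*) cadj"
    if \<rho>: "\<rho> \<in> irreps (*) cadj" "\<rho>' \<in> irreps (*) cadj" for \<rho> \<rho>'
  proof -
    obtain X ip \<pi> where \<rho>_eq: "\<rho> = (X, ip, \<pi>)" by (cases \<rho>)
    obtain X' ip' \<pi>' where \<rho>'_eq: "\<rho>' = (X', ip', \<pi>')" by (cases \<rho>')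
    have rep: "unitary_rep (*) cadj (X, ip, \<pi>)" using \<rho> \<rho>_eq irrep_unitary_rep by blast
    have rep': "unitary_rep (*) cadj (X', ip', \<pi>')" using \<rho> \<rho>'_eq irrep_unitary_rep by blast
    interpret a: bounded_rep mul invol \<iota> X ip "\<pi> \<circ> \<iota>" by (rule bounded[OF pull[OF rep]])
    interpret b: bounded_rep mul invol \<iota> X' ip' "\<pi>' \<circ> \<iota>" by (rule bounded[OF pull[OF rep']])
    have "unitarily_equivalent (X, ip, \<pi> \<circ> \<iota>) (X', ip', \<pi>' \<circ> \<iota>) \<longleftrightarrow>
      unitarily_equivalent (X, ip, \<pi>) (X', ip', \<pi>')"
    proof
      assume "unitarily_equivalent (X, ip, \<pi>) (X', ip', \<pi>')"
      then show "unitarily_equivalent (X, ip, \<pi> \<circ> \<iota>) (X', ip', \<pi>' \<circ> \<iota>)"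
        unfolding unitarily_equivalent_def by auto
    next
      assume "unitarily_equivalent (X, ip, \<pi> \<circ> \<iota>) (X', ip', \<pi>' \<circ> \<iota>)"
      then obtain U where U: "clinear_on X U" "bij_betw U X X'"
        "\<And>x y. x \<in> X \<Longrightarrow> y \<in> X \<Longrightarrow> ip' (U x) (U y) = ip x y"
        "\<And>a x. x \<in> X \<Longrightarrow> U (\<pi> (\<iota> a) x) = \<pi>' (\<iota> a) (U x)"
        by (auto simp: unitarily_equivalent_def)
      have UX: "U x \<in> X'" if "x \<in> X" for x using U(2) that by (auto simp: bij_betw_def)
      have Ud: "U (x - y) = U x - U y" if "x \<in> X" "y \<in> X" for x y
      proof -
        have "U ((x - y) + y) = U (x - y) + U y"
          using U(1) that(2) a.X_closed(3)[OF that] unfolding clinear_on_def by blast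
        then show ?thesis by simp
      qed
      have Un: "b.n (U x) = a.n x" if "x \<in> X" for x
        using U(3) that by (simp add: ip_norm_def)
      have "U (\<pi> c x) = \<pi>' c (U x)" if x: "x \<in> X" for c x
      proof -
        obtain s where s: "(\<lambda>k. \<iota> (s k)) \<longlonglongrightarrow> c" by (rule a.approx)
        have in1: "\<pi> e x \<in> X" for e by (rule unitary_repD(3)[OF rep x])
        \<comment> \<open>\<open>U\<close> is isometric and preserves limits, so both sides of the
          intertwining relation at \<open>c\<close> are limits of the same sequence taken from the
          dense subalgebra.\<close>
        have "a.conv (\<lambda>k. \<pi> (\<iota> (s k)) x) (\<pi> c x)"
          using a.ext_conv[OF x s] by (simp add: ext[OF rep x])
        then have "b.conv (\<lambda>k. U (\<pi> (\<iota> (s k)) x)) (U (\<pi> c x))"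
          by (simp add: a.conv_def b.conv_def Un in1 flip: Ud)
        moreover have "b.conv (\<lambda>k. U (\<pi> (\<iota> (s k)) x)) (\<pi>' c (U x))"
          using b.ext_conv[OF UX[OF x] s] by (simp add: ext[OF rep' UX[OF x]] U(4)[OF x])
        ultimately show ?thesis
          by (rule b.conv_unique) (auto intro: UX in1 unitary_repD(3)[OF rep' UX[OF x]])
      qed
      then show "unitarily_equivalent (X, ip, \<pi>) (X', ip', \<pi>')"
        unfolding unitarily_equivalent_def using U(1-3) by auto
    qed
    then show ?thesis
      using \<rho> F_in[OF \<rho>(1)] F_in[OF \<rho>(2)] by (simp add: irrep_equiv_def F_def \<rho>_eq \<rho>'_eq)
  qed
  have F_surj: "\<exists>\<rho>\<in>irreps (*) cadj. (F \<rho>, \<tau>) \<in> irrep_equiv mul invol" if \<tau>: "\<tau> \<in> irreps mul invol" for \<tau>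
  proof -
    obtain X ip \<sigma> where \<tau>_eq: "\<tau> = (X, ip, \<sigma>)" by (cases \<tau>)
    interpret bounded_rep mul invol \<iota> X ip \<sigma> 
      by (rule bounded) (use \<tau> \<tau>_eq irrep_unitary_rep in blast)
    have irr: "(X, ip, ext) \<in> irreps (*) cadj" using \<tau> by (simp add: irreps_iff \<tau>_eq ext_irreducible)
    moreover have "unitarily_equivalent (X, ip, ext \<circ> \<iota>) (X, ip, \<sigma>)"
      unfolding unitarily_equivalent_def
      by (auto simp: clinear_on_def ext_\<iota> intro!: exI[of _ "\<lambda>x. x"] bij_betw_imageI)
    then have "(F (X, ip, ext), \<tau>) \<in> irrep_equiv mul invol"
      using F_in[OF irr] \<tau> by (simp add: irrep_equiv_def F_def \<tau>_eq)
    ultimately show ?thesis by blast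
  qed
  show ?thesis
    using ex_bij_betw_quotient[OF equiv_irrep_equiv equiv_irrep_equiv F_in F_iff F_surj]
    by (auto simp: F_def)
qed

section \<open>Finite-dimensional subspaces\<close>

text \<open>If \<open>a\<close> has positive distance \<open>d\<close> from the closed span of
  \<open>F\<close>, then the coefficient of \<open>a\<close> is bounded by the norm divided by
  \<open>d\<close>. Along a convergent sequence these coefficients are therefore Cauchy, and the
  remainders converge inside the span of \<open>F\<close>.\<close>

lemma closed_span_finite:
  fixes F :: "'b::cstar_algebra set"
  assumes "finite F"
  shows "closed (cvec.span F)"
  using assms
proof (induction F)
  case (insert a F)
  show ?case
  proof (cases "a \<in> cvec.span F")
    case True
    then show ?thesis using insert by (simp add: cvec.span_redundant)
  next
    case False
    obtain d where d: "d > 0" "ball a d \<subseteq> - cvec.span F"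
      using open_contains_ball[of "- cvec.span F"] insert(3) False by (auto simp: open_closed)
    have far: "cmod c * d \<le> norm (c *\<^sub>C a + y)" if y: "y \<in> cvec.span F" for c y
    proof (cases "c = 0")
      case c: False
      define z where "z = (- 1 / c) *\<^sub>C y"
      have "z \<in> cvec.span F" unfolding z_def by (rule cvec.span_scale[OF y])
      then have "z \<notin> ball a d" using d(2) by blast
      then have "d \<le> norm (a - z)" by (simp add: dist_norm)
      moreover have "c *\<^sub>C a + y = c *\<^sub>C (a - z)"
        using c by (simp add: z_def cvec.scale_right_diff_distrib scaleC_add_right scaleC_one)
      ultimately show ?thesis by (simp add: norm_scaleC mult_left_mono)
    qed simp
    show ?thesis
      unfolding closed_sequential_limits
    proof (intro allI impI, elim conjE)
      fix x l assume x: "\<forall>k. x k \<in> cvec.span (insert a F)" and l: "x \<longlonglongrightarrow> l"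
      have "\<forall>k. \<exists>c. x k - c *\<^sub>C a \<in> cvec.span F"
        using x by (simp add: cvec.span_insert)
      from choice[OF this] obtain c where c: "\<And>k. x k - c k *\<^sub>C a \<in> cvec.span F" by blast
      have cd: "cmod (c m - c k) * d \<le> norm (x m - x k)" for m k
      proof -
        have "x m - x k = (c m - c k) *\<^sub>C a + ((x m - c m *\<^sub>C a) - (x k - c k *\<^sub>C a))"
          by (simp add: cvec.scale_left_diff_distrib)
        then show ?thesis using far[OF cvec.span_diff[OF c[of m] c[of k]], of "c m - c k"] by metis
      qed
      have "Cauchy c"
        unfolding Cauchy_iff
      proof (intro allI impI)
        fix e :: real assume "e > 0"
        then have "e * d > 0" using d by simp
        then obtain N where N: "\<And>m k. m \<ge> N \<Longrightarrow> k \<ge> N \<Longrightarrow> norm (x m - x k) < e * d"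
          using LIMSEQ_imp_Cauchy[OF l] unfolding Cauchy_iff by meson
        have "norm (c m - c k) < e" if "m \<ge> N" "k \<ge> N" for m k
        proof -
          have "cmod (c m - c k) * d < e * d" using cd N[OF that] by (rule le_less_trans)
          then show ?thesis using d by simp
        qed
        then show "\<exists>M. \<forall>m\<ge>M. \<forall>n\<ge>M. norm (c m - c n) < e" by blast
      qed
      then have "convergent c" by (rule Cauchy_convergent)
      then obtain c0 where c0: "c \<longlonglongrightarrow> c0" unfolding convergent_def by blast
      have "(\<lambda>k. cmod (c k - c0)) \<longlonglongrightarrow> 0" using c0 by (simp add: LIM_zero tendsto_norm_zero)
      from tendsto_mult_right[OF this, of "norm a"]
      have "(\<lambda>k. norm (c k *\<^sub>C a - c0 *\<^sub>C a)) \<longlonglongrightarrow> 0"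
        unfolding cvec.scale_left_diff_distrib[symmetric] norm_scaleC by simp
      then have "(\<lambda>k. c k *\<^sub>C a) \<longlonglongrightarrow> c0 *\<^sub>C a"
        by (rule LIM_zero_cancel[OF tendsto_norm_zero_cancel])
      then have "(\<lambda>k. x k - c k *\<^sub>C a) \<longlonglongrightarrow> l - c0 *\<^sub>C a"
        by (intro tendsto_intros l)
      then have "l - c0 *\<^sub>C a \<in> cvec.span F"
        by (rule closed_sequentially[OF insert(3) c])
      then show "l \<in> cvec.span (insert a F)" by (auto simp: cvec.span_insert)
    qed
  qed
qed simp

lemma closed_image_finite_dim:
  fixes \<iota> :: "'h::complex_vector \<Rightarrow> 'b::cstar_algebra"
  assumes "clinear \<iota>" "cvec.subspace D" "D \<subseteq> cvec.span F" "finite F"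
  shows "closed (\<iota> ` D)"
proof -
  interpret vector_space_pair "scaleC :: complex \<Rightarrow> 'h \<Rightarrow> 'h" "scaleC :: complex \<Rightarrow> 'b \<Rightarrow> 'b"
    by unfold_locales
  obtain B where "finite B" "D = cvec.span B"
    by (rule finite_basis_of_subspace[OF assms(2-4)])
  then have "\<iota> ` D = cvec.span (\<iota> ` B)" "finite (\<iota> ` B)"
    using linear_span_image[OF assms(1)] by auto
  then show ?thesis by (simp add: closed_span_finite)
qed

section \<open>Orthogonal expansions and operator norms in finite dimension\<close>

context inner_space
begin

text \<open>
  Gram--Schmidt: the expansion formula by itself makes the projection onto the span selfadjoint,
  so the orthogonality of \<open>B\<close> need not be carried through the induction.
\<close>

lemma ex_orthogonal_expansion:
  assumes "finite F" "F \<subseteq> X"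
  shows "\<exists>B. finite B \<and> B \<subseteq> cvec.span F \<and>
    (\<forall>x\<in>cvec.span F. x = (\<Sum>b\<in>B. (ip x b / ip b b) *\<^sub>C b))"
  using assms
proof (induction F)
  case empty
  then show ?case by (intro exI[of _ "{}"]) simp
next
  case (insert a F)
  then obtain B where B: "finite B" "B \<subseteq> cvec.span F"
    "\<And>x. x \<in> cvec.span F \<Longrightarrow> x = (\<Sum>b\<in>B. (ip x b / ip b b) *\<^sub>C b)" by auto
  have sX: "x \<in> X" if "x \<in> cvec.span F" for x
    using cvec.span_minimal[OF _ X, of F] insert(4) that by blast
  have BX: "b \<in> X" if "b \<in> B" for b using sX B(2) that by blast
  have a: "a \<in> X" using insert(4) by simp
  define P where "P x = (\<Sum>b\<in>B. (ip x b / ip b b) *\<^sub>C b)" for x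
  have P_span: "P x \<in> cvec.span F" for x
    unfolding P_def using B(2) by (intro cvec.span_sum cvec.span_scale) blast
  have ip_sum: "ip (\<Sum>b\<in>C. f b *\<^sub>C b) y = (\<Sum>b\<in>C. f b * ip b y)"
    if "C \<subseteq> B" "y \<in> X" for C f y
  proof -
    have "finite C" using that(1) B(1) finite_subset by blast
    then show ?thesis using that
    proof (induction C)
      case (insert c C)
      have "(\<Sum>b\<in>C. f b *\<^sub>C b) \<in> X"
        using insert(4) BX by (intro cvec.subspace_sum[OF X]) auto
      then show ?case using insert BX by (simp add: ip_add_left ip_scale_left)
    qed (simp add: ip_zero)
  qed
  define a' where "a' = a - P a"
  have a'X: "a' \<in> X" using a sX[OF P_span] by (simp add: a'_def)
  have orth: "ip a' y = 0" if y: "y \<in> cvec.span F" for y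
  proof -
    have "ip (P a) y = (\<Sum>b\<in>B. ip a b / ip b b * ip b y)"
      unfolding P_def by (rule ip_sum) (use sX[OF y] in auto)
    \<comment> \<open>This is the selfadjointness of \<open>P\<close>: the denominators
      \<open>ip b b\<close> are real, so the coefficient moves from \<open>a\<close> to
      \<open>y\<close> under conjugation. As \<open>P y = y\<close>, the difference
      \<open>a - P a\<close> is orthogonal to \<open>y\<close>.\<close>
    also have "\<dots> = (\<Sum>b\<in>B. cnj (ip y b / ip b b * ip b a))"
    proof (rule sum.cong[OF refl])
      fix b assume b: "b \<in> B"
      show "ip a b / ip b b * ip b y = cnj (ip y b / ip b b * ip b a)"
        using ip_cnj[OF BX[OF b] a] ip_cnj[OF sX[OF y] BX[OF b]] ip_self[OF BX[OF b]] by simp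
    qed
    also have "\<dots> = cnj (ip (P y) a)"
      unfolding P_def using ip_sum[of B a "\<lambda>b. ip y b / ip b b"] a by simp
    also have "P y = y" using B(3)[OF y] by (simp add: P_def)
    also have "cnj (ip y a) = ip a y" using ip_cnj[OF sX[OF y] a] by simp
    finally show ?thesis using a sX[OF y] sX[OF P_span] by (simp add: a'_def ip_diff_left)
  qed
  have split: "\<exists>c y. y \<in> cvec.span F \<and> x = c *\<^sub>C a' + y" if "x \<in> cvec.span (insert a F)" for x
  proof -
    obtain c where c: "x - c *\<^sub>C a \<in> cvec.span F" using \<open>x \<in> cvec.span (insert a F)\<close> by (auto simp: cvec.span_insert)
    have "(x - c *\<^sub>C a) + c *\<^sub>C P a \<in> cvec.span F"
      by (intro cvec.span_add cvec.span_scale c P_span)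
    moreover have "x = c *\<^sub>C a' + ((x - c *\<^sub>C a) + c *\<^sub>C P a)"
      by (simp add: a'_def cvec.scale_right_diff_distrib)
    ultimately show ?thesis by blast
  qed
  have mono: "cvec.span F \<subseteq> cvec.span (insert a F)" by (rule cvec.span_mono) auto
  show ?case
  proof (cases "a' = 0")
    case True
    then have "cvec.span (insert a F) \<subseteq> cvec.span F" using split by force
    with mono B show ?thesis by (intro exI[of _ B]) auto
  next
    case False
    have "a' \<notin> B" using orth[of a'] False ip_pos[OF a'X] B(2) by auto
    have a'_span: "a' \<in> cvec.span (insert a F)"
      unfolding a'_def using mono P_span[of a] by (intro cvec.span_diff) (auto intro: cvec.span_base)
    have "x = (\<Sum>b\<in>insert a' B. (ip x b / ip b b) *\<^sub>C b)" if x: "x \<in> cvec.span (insert a F)" for x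
    proof -
      obtain c y where y: "y \<in> cvec.span F" and xeq: "x = c *\<^sub>C a' + y" using split[OF x] by blast
      have yX: "y \<in> X" by (rule sX[OF y])
      have "ip y a' = 0" using orth[OF y] ip_cnj[OF a'X yX] by simp
      then have "ip x a' / ip a' a' = c"
        using ip_pos[OF a'X False] a'X yX by (auto simp: xeq ip_add_left ip_scale_left)
      moreover have "ip x b = ip y b" if b: "b \<in> B" for b
        using orth[of b] B(2) b a'X yX BX[OF b] by (auto simp: xeq ip_add_left ip_scale_left)
      then have "(\<Sum>b\<in>B. (ip x b / ip b b) *\<^sub>C b) = y"
        using B(3)[OF y] by (simp cong: sum.cong)
      ultimately show ?thesis using B(1) \<open>a' \<notin> B\<close> xeq by simp
    qed
    moreover have "insert a' B \<subseteq> cvec.span (insert a F)" using a'_span B(2) mono by blast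
    ultimately show ?thesis using B(1) by (intro exI[of _ "insert a' B"]) auto
  qed
qed

lemma n_sum_le:
  "finite C \<Longrightarrow> (\<And>b. b \<in> C \<Longrightarrow> f b \<in> X) \<Longrightarrow> n (\<Sum>b\<in>C. f b) \<le> (\<Sum>b\<in>C. n (f b))"
proof (induction C rule: finite_induct)
  case (insert c C)
  have "(\<Sum>b\<in>C. f b) \<in> X" using insert by (intro cvec.subspace_sum[OF X]) auto
  then have "n (f c + sum f C) \<le> n (f c) + n (sum f C)" using insert by (intro n_triangle) auto
  also have "n (sum f C) \<le> (\<Sum>b\<in>C. n (f b))" using insert by simp
  finally show ?case using insert by simp
qed simp

text \<open>The coefficients of the orthogonal expansion are bounded by Cauchy-Schwarz, which yields
  the explicit constant \<open>K\<close>.\<close>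

lemma finite_dim_bounded:
  assumes F: "finite F" "X = cvec.span F" and T: "clinear_on X T" "\<And>x. x \<in> X \<Longrightarrow> T x \<in> X"
  obtains K where "K \<ge> 0" "\<And>x. x \<in> X \<Longrightarrow> n (T x) \<le> K * n x"
proof -
  have "F \<subseteq> X" using F(2) cvec.span_superset by blast
  then obtain B where B: "finite B" "B \<subseteq> X"
    "\<And>x. x \<in> X \<Longrightarrow> x = (\<Sum>b\<in>B. (ip x b / ip b b) *\<^sub>C b)"
    using ex_orthogonal_expansion[OF F(1)] F(2) by auto
  have T0: "T 0 = 0" using T(1) X_closed(1) unfolding clinear_on_def by (metis cvec.scale_zero_left)
  have Ts: "T (\<Sum>b\<in>C. f b *\<^sub>C b) = (\<Sum>b\<in>C. f b *\<^sub>C T b)" if "C \<subseteq> B" for C f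
  proof -
    have "finite C" using that B(1) finite_subset by blast
    then show ?thesis using that
    proof (induction C)
      case (insert c C)
      have "(\<Sum>b\<in>C. f b *\<^sub>C b) \<in> X" using insert(4) B(2) by (intro cvec.subspace_sum[OF X]) auto
      moreover have "c \<in> X" using insert(4) B(2) by auto
      ultimately show ?case using insert T(1) by (simp add: clinear_on_def)
    qed (simp add: T0)
  qed
  define K where "K = (\<Sum>b\<in>B. n b / cmod (ip b b) * n (T b))"
  have BX: "b \<in> X" "T b \<in> X" if "b \<in> B" for b using that B(2) T(2) by auto
  have "K \<ge> 0" unfolding K_def using BX by (intro sum_nonneg) simp
  moreover have "n (T x) \<le> K * n x" if x: "x \<in> X" for x
  proof -
    have "T x = (\<Sum>b\<in>B. (ip x b / ip b b) *\<^sub>C T b)"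
      using Ts[of B "\<lambda>b. ip x b / ip b b"] B(3)[OF x] by simp
    also have "n \<dots> \<le> (\<Sum>b\<in>B. n ((ip x b / ip b b) *\<^sub>C T b))"
      using B(1) BX by (intro n_sum_le) auto
    also have "\<dots> \<le> (\<Sum>b\<in>B. n b / cmod (ip b b) * n (T b) * n x)"
    proof (rule sum_mono)
      fix b assume b: "b \<in> B"
      have "n ((ip x b / ip b b) *\<^sub>C T b) = cmod (ip x b) * (n (T b) / cmod (ip b b))"
        using BX[OF b] by (simp add: n_scale norm_divide)
      also have "\<dots> \<le> (n x * n b) * (n (T b) / cmod (ip b b))"
        using BX[OF b] x by (intro mult_right_mono cauchy_schwarz) auto
      finally show "n ((ip x b / ip b b) *\<^sub>C T b) \<le> n b / cmod (ip b b) * n (T b) * n x"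
        by (simp add: mult_ac)
    qed
    also have "\<dots> = K * n x" by (simp add: K_def sum_distrib_right)
    finally show ?thesis .
  qed
  ultimately show ?thesis using that by blast
qed

lemma op_norm_least:
  assumes "\<And>x. x \<in> X \<Longrightarrow> n (T x) \<le> K * n x" "K \<ge> 0"
  shows "op_norm X ip T \<le> K"
  unfolding op_norm_def
proof (rule cSup_least)
  have "n (T 0) \<in> {n (T v) |v. v \<in> X \<and> n v \<le> 1}" by (intro CollectI exI[of _ 0]) simp
  then show "{n (T v) |v. v \<in> X \<and> n v \<le> 1} \<noteq> {}" by blast
  fix r assume "r \<in> {n (T v) |v. v \<in> X \<and> n v \<le> 1}"
  then obtain v where "v \<in> X" "n v \<le> 1" "r = n (T v)" by blast
  then show "r \<le> K" using assms(1)[of v] mult_left_mono[of "n v" 1 K] assms(2) by simp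
qed

text \<open>Some bound \<open>K\<close> makes the set in \<open>op_norm\<close> bounded above, so
  that its \<open>Sup\<close> is a genuine supremum; the conclusion then follows by normalizing
  \<open>x\<close>.\<close>

lemma op_norm_bound:
  assumes K: "\<And>x. x \<in> X \<Longrightarrow> n (T x) \<le> K * n x" "K \<ge> 0"
    and T: "clinear_on X T" "\<And>x. x \<in> X \<Longrightarrow> T x \<in> X" and x: "x \<in> X"
  shows "n (T x) \<le> op_norm X ip T * n x"
proof (cases "x = 0")
  case True
  then show ?thesis using K(1)[OF x] by simp
next
  case False
  then have nx: "n x > 0" using n_eq_0[OF x] n_nonneg[OF x] by linarith
  define u where "u = complex_of_real (1 / n x) *\<^sub>C x"
  have u: "u \<in> X" "n u \<le> 1" using x nx by (simp_all add: u_def n_scale norm_divide)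
  have "n (T v) \<le> K" if "v \<in> X" "n v \<le> 1" for v
    using K(1)[of v] mult_left_mono[of "n v" 1 K] K(2) that by simp
  then have "bdd_above {n (T v) |v. v \<in> X \<and> n v \<le> 1}" by (intro bdd_aboveI[of _ K]) auto
  then have "n (T u) \<le> op_norm X ip T"
    unfolding op_norm_def using u by (intro cSup_upper) auto
  moreover have "T u = complex_of_real (1 / n x) *\<^sub>C T x"
    using T(1) x unfolding u_def clinear_on_def by blast
  then have "n (T u) = n (T x) / n x" using T(2)[OF x] nx by (simp add: n_scale norm_divide)
  ultimately show ?thesis using nx by (simp add: field_simps)
qed

end

section \<open>The integral\<close>

lemma sweedler_pure_id: "sweedler t (\<otimes>) = t"
proof -
  obtain l where "t = abs_tensor l" by (rule tensor_exhaust)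
  then show ?thesis
    using sweedler_abs_tensor[OF cbilinear_pure, of l] abs_tensor_pair_sum[of l] by simp
qed

context hopf_algebra
begin

lemma antipode_one: "S 1 = 1"
proof -
  have "cbilinear (\<lambda>a b. S a * b)" by (intro cbilinearI clinear_intros linear_antipode)
  then have "S 1 * 1 = \<epsilon> 1 *\<^sub>C 1"
    using antipode_left[of 1] by (simp only: comult_one sweedler_pure)
  then show ?thesis by (simp add: counit_one)
qed

text \<open>Apply \<open>\<epsilon>\<close> to the antipode axiom and contract the second factor
  with the counit.\<close>

lemma counit_antipode: "\<epsilon> (S h) = \<epsilon> h"
proof -
  have lin: "clinear (\<lambda>h. \<epsilon> (S h))" by (rule clinear_compose[OF linear_counit linear_antipode])
  have "\<epsilon> h = \<epsilon> (\<epsilon> h *\<^sub>C 1)"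
    using linear_counit by (simp add: clinear_iff counit_one scaleC_complex_def)
  also have "\<dots> = sweedler (\<Delta> h) (\<lambda>a b. \<epsilon> (S a * b))"
    unfolding antipode_left[symmetric] by (rule clinear_sweedler_out[OF linear_counit])
  also have "\<dots> = sweedler (\<Delta> h) (\<lambda>a b. \<epsilon> (S (\<epsilon> b *\<^sub>C a)))"
    using lin by (simp add: counit_mult clinear_iff scaleC_complex_def mult.commute)
  also have "\<dots> = \<epsilon> (S h)"
    unfolding clinear_sweedler_out[OF lin, symmetric] counit_right ..
  finally show ?thesis by simp
qed

text \<open>\<open>D\<close> consists of the left slices of \<open>\<Delta> g\<close>.
  Multiplication by \<open>f\<close> on the right is itself a left slice, by the functional sending
  \<open>a\<close> to \<open>J (f * S a)\<close>, and slices of slices are slices.\<close>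

lemma convolution_finite_right_ideal:
  assumes J: "clinear J"
  obtains D F where "g \<in> D" "cvec.subspace D" "finite F" "D \<subseteq> cvec.span F"
    "\<And>d f. d \<in> D \<Longrightarrow> convolution \<Delta> S J d f \<in> D"
proof -
  define D where "D = {sweedler (\<Delta> g) (\<lambda>a b. \<phi> a *\<^sub>C b) |\<phi>. clinear \<phi>}"
  have "convolution \<Delta> S J d f \<in> D" if dD: "d \<in> D" for d f
  proof -
    obtain \<phi> where \<phi>: "clinear \<phi>" and d: "d = sweedler (\<Delta> g) (\<lambda>a b. \<phi> a *\<^sub>C b)"
      using dD unfolding D_def by blast
    have JS: "clinear (\<lambda>a. J (f * S a))"
      by (intro clinear_compose[OF J] clinear_mult_left linear_antipode)
    have lin: "clinear (\<lambda>x. sweedler (\<Delta> x) (\<lambda>a b. J (f * S a) *\<^sub>C b))"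
      by (intro clinear_compose[OF clinear_sweedler linear_comult] cbilinearI clinear_intros JS)
    have lin': "clinear (\<lambda>x. sweedler (\<Delta> x) (\<lambda>a b. \<phi> a * J (f * S b)))"
      by (intro clinear_compose[OF clinear_sweedler linear_comult] cbilinearI clinear_intros JS \<phi>)
    have T: "trilinear (\<lambda>a b c. \<phi> a *\<^sub>C J (f * S b) *\<^sub>C c)"
      by (intro trilinearI clinear_intros JS \<phi>)
    have out: "clinear (\<lambda>c. c *\<^sub>C y)" for y :: 'a by (intro clinear_intros)
    have "convolution \<Delta> S J d f =
        sweedler (\<Delta> g) (\<lambda>x y. \<phi> x *\<^sub>C sweedler (\<Delta> y) (\<lambda>a b. J (f * S a) *\<^sub>C b))"
      unfolding convolution_def d clinear_sweedler_out[OF lin]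
      using lin by (simp add: clinear_iff)
    also have "\<dots> = sweedler (\<Delta> g) (\<lambda>x y. sweedler (\<Delta> x) (\<lambda>a b. \<phi> a *\<^sub>C J (f * S b) *\<^sub>C y))"
      unfolding sweedler_on_scale[symmetric] by (rule coassoc_trilinear[OF T, symmetric])
    also have "\<dots> = sweedler (\<Delta> g) (\<lambda>x y. sweedler (\<Delta> x) (\<lambda>a b. \<phi> a * J (f * S b)) *\<^sub>C y)"
      by (simp add: clinear_sweedler_out[OF out] scaleC_scaleC)
    finally show ?thesis unfolding D_def
      by (intro CollectI exI[of _ "\<lambda>x. sweedler (\<Delta> x) (\<lambda>a b. \<phi> a * J (f * S b))"] conjI lin')
  qed
  moreover have "g \<in> D"
    unfolding D_def using counit_left[of g] linear_counit by (intro CollectI exI[of _ \<epsilon>]) simp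
  moreover have "cvec.subspace D" unfolding D_def by (rule subspace_slices)
  moreover obtain F where "finite F" "D \<subseteq> cvec.span F"
    unfolding D_def by (rule finite_span_slices[of "\<Delta> g"])
  ultimately show ?thesis by (intro that[of D F])
qed

text \<open>
  The right radical of the form \<open>(x, w) \<mapsto> \<integral> x w\<close> is a left ideal and a left coideal,
  so \<open>\<epsilon> w 1 = S w\<^sub>1 w\<^sub>2\<close> lies in it for each of its elements \<open>w\<close>.
\<close>

lemma counit_eq_0_of_radical:
  assumes J: "hopf_integral \<Delta> J" and w: "\<And>x. J (x * w) = 0"
  shows "\<epsilon> w = 0"
proof -
  have lin: "clinear J" and J1: "J 1 = 1"
    and inv: "\<And>x. sweedler (\<Delta> x) (\<lambda>a b. J b *\<^sub>C a) = J x *\<^sub>C 1"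
    using J by (auto simp: hopf_integral_def)
  have Jm: "clinear (\<lambda>b. J (x * b))" for x by (intro clinear_compose[OF lin] clinear_mult_left clinear_ident)
  have Jm': "clinear (\<lambda>b. J (b * x))" for x by (intro clinear_compose[OF lin] clinear_mult_right clinear_ident)
  have radical: "sweedler (\<Delta> w) (\<lambda>a b. J (x * b) *\<^sub>C a) = 0" for x
  proof -
    \<comment> \<open>The Sweedler sum of \<open>S x1 * x2 * w1\<close> with weight
      \<open>J (x3 * w2)\<close> is evaluated twice. Invariance of \<open>J\<close> on
      \<open>\<Delta> (x2 * w)\<close> turns it into \<open>S x1\<close> with weight
      \<open>J (x2 * w)\<close>, which is zero; the antipode axiom contracts it to \<open>w1\<close>
      with weight \<open>J (x * w2)\<close>.\<close>
    define T where "T a b c = S a * sweedler (\<Delta> w) (\<lambda>w1 w2. J (c * w2) *\<^sub>C (b * w1))" for a b c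
    have T: "trilinear T"
      unfolding T_def
      by (intro trilinearI clinear_mult_left clinear_mult_right linear_antipode clinear_sweedler_arg
          clinear_scaleC_left clinear_scaleC_right clinear_ident Jm')
    have e: "clinear (\<lambda>x. x * y)" for y :: 'a by (intro clinear_intros)
    have cbl: "cbilinear (\<lambda>a b. J b *\<^sub>C a)" by (intro cbilinearI clinear_intros lin)
    have "sweedler (\<Delta> x) (\<lambda>a y. sweedler (\<Delta> y) (T a)) = sweedler (\<Delta> x) (\<lambda>a y. S a * (J (y * w) *\<^sub>C 1))"
    proof -
      have "sweedler (\<Delta> y) (T a) = S a * (J (y * w) *\<^sub>C 1)" for a y
      proof -
        have "J (y * w) *\<^sub>C 1 = sweedler (\<Delta> (y * w)) (\<lambda>a b. J b *\<^sub>C a)" by (simp add: inv)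
        also have "\<dots> = sweedler (\<Delta> y) (\<lambda>b c. sweedler (\<Delta> w) (\<lambda>w1 w2. J (c * w2) *\<^sub>C (b * w1)))"
          by (simp add: comult_mult clinear_sweedler_out[OF clinear_sweedler[OF cbl]] sweedler_pure[OF cbl])
        finally have eq: "J (y * w) *\<^sub>C 1 =
          sweedler (\<Delta> y) (\<lambda>b c. sweedler (\<Delta> w) (\<lambda>w1 w2. J (c * w2) *\<^sub>C (b * w1)))" .
        have "clinear (\<lambda>z. S a * z)" by (intro clinear_intros)
        then show ?thesis unfolding eq T_def by (rule clinear_sweedler_out[symmetric])
      qed
      then show ?thesis by simp
    qed
    also have "\<dots> = 0" using w by (simp add: sweedler_on_zero)
    finally have "0 = sweedler (\<Delta> x) (\<lambda>y c. sweedler (\<Delta> y) (\<lambda>a b. T a b c))"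
      using coassoc_trilinear[OF T, of x] by simp
    also have "\<dots> = sweedler (\<Delta> x) (\<lambda>y c. sweedler (\<Delta> y) (\<lambda>a b. S a * b) *
        sweedler (\<Delta> w) (\<lambda>w1 w2. J (c * w2) *\<^sub>C w1))"
    proof -
      have "clinear (\<lambda>z. b * z)" for b :: 'a by (intro clinear_intros)
      note b = clinear_sweedler_out[OF this, of _ UNIV "\<Delta> w"]
      have "T a b c = S a * b * sweedler (\<Delta> w) (\<lambda>w1 w2. J (c * w2) *\<^sub>C w1)" for a b c
        by (simp add: T_def b mult_scaleC_right mult.assoc)
      then show ?thesis by (simp add: clinear_sweedler_out[OF e])
    qed
    also have "\<dots> = sweedler (\<Delta> x) (\<lambda>y c. sweedler (\<Delta> w) (\<lambda>w1 w2. J ((\<epsilon> y *\<^sub>C c) * w2) *\<^sub>C w1))"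
    proof -
      have "J ((k *\<^sub>C c) * w2) *\<^sub>C w1 = k *\<^sub>C J (c * w2) *\<^sub>C w1" for k c w2 and w1 :: 'a
        using lin by (simp add: mult_scaleC_left clinear_iff scaleC_complex_def scaleC_scaleC)
      then show ?thesis
        by (simp only: antipode_left mult_scaleC_left sweedler_on_scale mult_1_left)
    qed
    also have "\<dots> = sweedler (\<Delta> w) (\<lambda>w1 w2. J (x * w2) *\<^sub>C w1)"
    proof -
      have "clinear (\<lambda>z. sweedler (\<Delta> w) (\<lambda>w1 w2. J (z * w2) *\<^sub>C w1))"
        by (intro clinear_sweedler_arg clinear_scaleC_left Jm')
      from clinear_sweedler_out[OF this, of UNIV "\<Delta> x" "\<lambda>y c. \<epsilon> y *\<^sub>C c"] show ?thesis
        by (simp add: counit_left)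
    qed
    finally show ?thesis by simp
  qed
  \<comment> \<open>By \<open>radical\<close> every left slice of \<open>\<Delta> w\<close> lies in
    the radical again. The expansion therefore exhibits \<open>\<Delta> w\<close> with all second
    factors in the radical.\<close>
  obtain E \<phi> where E: "finite E" "\<And>e. clinear (\<phi> e :: 'a \<Rightarrow> complex)"
    "\<Delta> w = (\<Sum>e\<in>E. e \<otimes> sweedler (\<Delta> w) (\<lambda>a b. \<phi> e a *\<^sub>C b))"
    using tensor_expand_left[of "\<Delta> w" UNIV] by auto
  have zero: "J (x * sweedler (\<Delta> w) (\<lambda>a b. \<phi> e a *\<^sub>C b)) = 0" for x e
  proof -
    have "J (x * sweedler (\<Delta> w) (\<lambda>a b. \<phi> e a *\<^sub>C b)) = sweedler (\<Delta> w) (\<lambda>a b. \<phi> e (J (x * b) *\<^sub>C a))"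
      unfolding clinear_sweedler_out[OF Jm]
      using Jm[of x] E(2)[of e] by (simp add: clinear_iff scaleC_complex_def mult.commute mult_scaleC_right)
    also have "\<dots> = \<phi> e (sweedler (\<Delta> w) (\<lambda>a b. J (x * b) *\<^sub>C a))"
      by (rule clinear_sweedler_out[OF E(2), symmetric])
    also have "\<dots> = 0" by (simp add: radical clinear_zero[OF E(2)])
    finally show ?thesis .
  qed
  have bl: "cbilinear (\<lambda>a b. J (S a * b))"
    by (intro cbilinearI clinear_compose[OF lin] clinear_intros linear_antipode)
  have "\<epsilon> w = J (\<epsilon> w *\<^sub>C 1)" using lin J1 by (simp add: clinear_iff scaleC_complex_def)
  also have "\<dots> = sweedler (\<Delta> w) (\<lambda>a b. J (S a * b))"
    unfolding antipode_left[symmetric] by (rule clinear_sweedler_out[OF lin])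
  also have "\<dots> = (\<Sum>e\<in>E. sweedler (e \<otimes> sweedler (\<Delta> w) (\<lambda>a b. \<phi> e a *\<^sub>C b)) (\<lambda>a b. J (S a * b)))"
    by (subst E(3)) (rule clinear_sum[OF clinear_sweedler[OF bl]])
  also have "\<dots> = 0" by (simp add: sweedler_pure[OF bl] zero)
  finally show ?thesis .
qed

section \<open>The action on simple comodules\<close>

lemma conv_action_add:
  "clinear J \<Longrightarrow> conv_action S J V \<delta> (g + h) v = conv_action S J V \<delta> g v + conv_action S J V \<delta> h v"
  using linear_antipode
  by (simp add: conv_action_def clinear_iff distrib_left scaleC_add_left flip: sweedler_on_add)

lemma conv_action_scale:
  assumes J: "clinear J"
  shows "conv_action S J V \<delta> (c *\<^sub>C h) v = c *\<^sub>C conv_action S J V \<delta> h v"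
proof -
  have "J (b * S (c *\<^sub>C h)) = c * J (b * S h)" for b
    using J linear_antipode by (simp add: clinear_iff mult_scaleC_right scaleC_complex_def)
  then show ?thesis
    by (simp only: conv_action_def scaleC_scaleC[symmetric] sweedler_on_scale)
qed

lemma cbilinear_conv_action:
  assumes J: "clinear J"
  shows "cbilinear (\<lambda>a b. J (b * S h) *\<^sub>C a)"
proof -
  have "clinear (\<lambda>b. J (b * S h))"
    by (rule clinear_compose[OF J]) (intro clinear_intros)
  then show ?thesis by (intro cbilinearI clinear_intros)
qed

lemma conv_action_endomorphism:
  fixes V :: "'w::complex_vector set"
  assumes J: "clinear J" and cm: "comodule \<Delta> \<epsilon> V \<delta>"
  shows "clinear_on V (conv_action S J V \<delta> h)" "v \<in> V \<Longrightarrow> conv_action S J V \<delta> h v \<in> V"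
proof -
  have V: "cvec.subspace V" and lin: "clinear_on V \<delta>" and tw: "\<And>v. v \<in> V \<Longrightarrow> \<delta> v \<in> tensor_within V UNIV"
    using cm by (auto simp: comodule_def)
  have bl: "cbilinear (\<lambda>(a::'w) b. J (b * S h) *\<^sub>C a)" by (rule cbilinear_conv_action[OF J])
  have eq: "conv_action S J V \<delta> h v = sweedler (\<delta> v) (\<lambda>a b. J (b * S h) *\<^sub>C a)" if "v \<in> V" for v
    unfolding conv_action_def by (rule sweedler_on_eq[OF V tw[OF that] bl refl])
  show "v \<in> V \<Longrightarrow> conv_action S J V \<delta> h v \<in> V"
    by (simp only: eq, rule tensor_within_sweedler[OF tw bl V]) (auto intro: cvec.subspace_scale[OF V])
  show "clinear_on V (conv_action S J V \<delta> h)"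
    using lin clinear_sweedler[OF bl] cvec.subspace_add[OF V] cvec.subspace_scale[OF V]
    by (simp add: clinear_on_def eq clinear_iff)
qed

text \<open>The unit acts as the projection to the coinvariants, which form a subcomodule.\<close>

lemma conv_action_one:
  assumes J: "hopf_integral \<Delta> J" and V: "simple_comodule \<Delta> \<epsilon> V \<delta>" and v: "v \<in> V"
  shows "conv_action S J V \<delta> 1 v = 0 \<or> conv_action S J V \<delta> 1 v = v"
proof -
  have lin: "clinear J" and J1: "J 1 = 1"
    and inv: "\<And>x. sweedler (\<Delta> x) (\<lambda>a b. J b *\<^sub>C a) = J x *\<^sub>C 1"
    using J by (auto simp: hopf_integral_def)
  have cm: "comodule \<Delta> \<epsilon> V \<delta>"
    and sub: "\<And>W. cvec.subspace W \<Longrightarrow> W \<subseteq> V \<Longrightarrow> \<delta> ` W \<subseteq> tensor_within W UNIV \<Longrightarrow> W = {0} \<or> W = V"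
    using V by (auto simp: simple_comodule_def)
  obtain \<delta>' where \<delta>': "global_comodule \<Delta> \<epsilon> S V \<delta>'" "\<And>v. v \<in> V \<Longrightarrow> \<delta>' v = \<delta> v"
    using comodule_extend[OF cm] by blast
  interpret g: global_comodule \<Delta> \<epsilon> S V \<delta>' by fact
  have bl: "cbilinear (\<lambda>a b. J b *\<^sub>C a)" by (intro cbilinearI clinear_intros lin)
  have act: "conv_action S J V \<delta> 1 x = sweedler (\<delta>' x) (\<lambda>a b. J b *\<^sub>C a)" if "x \<in> V" for x
    unfolding conv_action_def antipode_one \<delta>'(2)[OF that, symmetric]
    by (rule sweedler_on_eq[OF g.V g.coact_in bl]) simp
  define u where "u = conv_action S J V \<delta> 1 v"
  have uV: "u \<in> V" unfolding u_def act[OF v] by (rule g.slice_in[OF lin])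
  \<comment> \<open>Coassociativity moves the integral to the last tensor factor of the
    comultiplication, where invariance replaces the remaining factor by \<open>1\<close>: the vector
    \<open>u\<close> is coinvariant.\<close>
  have "\<delta>' u = sweedler (\<delta>' v) (\<lambda>x y. sweedler (\<delta>' x) (\<lambda>a b. J y *\<^sub>C (a \<otimes> b)))"
    unfolding u_def act[OF v] clinear_sweedler_out[OF g.linear_coact] sweedler_on_scale sweedler_pure_id
    using g.linear_coact by (simp add: clinear_iff)
  also have "\<dots> = sweedler (\<delta>' v) (\<lambda>x y. sweedler (\<Delta> y) (\<lambda>b c. J c *\<^sub>C (x \<otimes> b)))"
    by (rule coaction_trilinear[OF g.coact_coassoc[OF v]]) (intro trilinearI clinear_intros lin)
  also have "\<dots> = sweedler (\<delta>' v) (\<lambda>x y. (J y *\<^sub>C x) \<otimes> 1)"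
  proof -
    have "sweedler (\<Delta> y) (\<lambda>b c. J c *\<^sub>C (x \<otimes> b)) = (J y *\<^sub>C x) \<otimes> 1" for x :: 'b and y
    proof -
      have "clinear (\<lambda>z::'a. x \<otimes> z)" by (intro clinear_intros)
      from clinear_sweedler_out[OF this, of UNIV "\<Delta> y" "\<lambda>b c. J c *\<^sub>C b"]
      show ?thesis by (simp add: inv cbilinearD[OF cbilinear_pure])
    qed
    then show ?thesis by simp
  qed
  also have "\<dots> = u \<otimes> 1"
  proof -
    have "clinear (\<lambda>z::'b. z \<otimes> (1::'a))" by (intro clinear_intros)
    then show ?thesis unfolding u_def act[OF v] by (rule clinear_sweedler_out[symmetric])
  qed
  finally have \<delta>u: "\<delta>' u = u \<otimes> 1" .
  \<comment> \<open>The line through a coinvariant vector is a subcomodule. Either \<open>u\<close>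
    vanishes, or \<open>V\<close> is this line with trivial coaction, on which \<open>1\<close> acts
    by \<open>J 1 = 1\<close>.\<close>
  have "cvec.span {u} = {0} \<or> cvec.span {u} = V"
  proof (rule sub)
    show span: "cvec.span {u} \<subseteq> V" by (rule cvec.span_minimal[OF _ g.V]) (simp add: uV)
    show "\<delta> ` cvec.span {u} \<subseteq> tensor_within (cvec.span {u}) UNIV"
    proof
      fix t assume "t \<in> \<delta> ` cvec.span {u}"
      then obtain c where "t = \<delta> (c *\<^sub>C u)" by (auto simp: cvec.span_singleton)
      then have "t = \<delta>' (c *\<^sub>C u)" using \<delta>'(2)[OF cvec.subspace_scale[OF g.V uV]] by simp
      then have "t = (c *\<^sub>C u) \<otimes> 1"
        using g.linear_coact \<delta>u by (simp add: clinear_iff cbilinearD[OF cbilinear_pure])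
      then show "t \<in> tensor_within (cvec.span {u}) UNIV"
        using sum_in_tensor_within[of "{()}" "\<lambda>_. c *\<^sub>C u" "cvec.span {u}" "\<lambda>_. 1::'a" UNIV]
        by (simp add: cvec.span_scale cvec.span_base)
    qed
  qed simp
  then show ?thesis
  proof
    assume "cvec.span {u} = {0}"
    then show ?thesis using cvec.span_base[of u "{u}"] by (simp add: u_def)
  next
    assume "cvec.span {u} = V"
    then obtain c where c: "v = c *\<^sub>C u" using v by (auto simp: cvec.span_singleton)
    have "conv_action S J V \<delta> 1 u = u"
      unfolding act[OF uV] \<delta>u by (simp add: sweedler_pure[OF bl] J1)
    then have "conv_action S J V \<delta> 1 v = v"
      using conv_action_endomorphism(1)[OF lin cm, of 1] uV unfolding c clinear_on_def by metis
    then show ?thesis by simp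
  qed
qed

text \<open>An isomorphism of comodules intertwines the actions of \<open>f\<close>. It is linear on
  \<open>W\<close> only, so it is extended by a projection onto \<open>W\<close> before entering
  Sweedler sums.\<close>

lemma conv_action_iso:
  assumes J: "clinear J" and W: "comodule \<Delta> \<epsilon> W \<Delta>" and V: "comodule \<Delta> \<epsilon> V \<delta>"
    and iso: "comodule_iso W \<Delta> V \<delta>" and zero: "\<And>v. v \<in> V \<Longrightarrow> conv_action S J V \<delta> f v = 0"
    and w: "w \<in> W"
  shows "sweedler (\<Delta> w) (\<lambda>a b. J (b * S f) *\<^sub>C a) = 0"
proof -
  have sW: "cvec.subspace W" and tW: "\<And>w. w \<in> W \<Longrightarrow> \<Delta> w \<in> tensor_within W UNIV"
    using W by (auto simp: comodule_def)
  have sV: "cvec.subspace V" and tV: "\<And>v. v \<in> V \<Longrightarrow> \<delta> v \<in> tensor_within V UNIV"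
    using V by (auto simp: comodule_def)
  obtain \<phi> where \<phi>: "clinear_on W \<phi>" "bij_betw \<phi> W V"
    "\<And>w. w \<in> W \<Longrightarrow> \<delta> (\<phi> w) = sweedler_on W (\<Delta> w) (\<lambda>a b. \<phi> a \<otimes> b)"
    using iso by (auto simp: comodule_iso_def)
  obtain p where p: "clinear p" "range p \<subseteq> W" "\<forall>v\<in>W. p v = v"
    using exists_projection[OF sW] by blast
  define \<psi> where "\<psi> x = \<phi> (p x)" for x
  have pW: "p x \<in> W" for x using p(2) by blast
  have \<psi>: "clinear \<psi>"
    using p(1) \<phi>(1) pW by (simp add: clinear_iff clinear_on_def \<psi>_def)
  have \<psi>\<phi>: "\<phi> x = \<psi> x" if "x \<in> W" for x using that p(3) by (simp add: \<psi>_def)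
  have \<phi>w: "\<phi> w \<in> V" using \<phi>(2) w by (auto simp: bij_betw_def)
  have bl: "cbilinear (\<lambda>a b. \<psi> a \<otimes> b)" by (intro cbilinearI clinear_intros \<psi>)
  note bl2 = cbilinear_conv_action[OF J, of f]
  have "\<delta> (\<phi> w) = sweedler (\<Delta> w) (\<lambda>a b. \<psi> a \<otimes> b)"
    unfolding \<phi>(3)[OF w] by (rule sweedler_on_eq[OF sW tW[OF w] bl]) (simp add: \<psi>\<phi>)
  then have "conv_action S J V \<delta> f (\<phi> w) =
      sweedler (sweedler (\<Delta> w) (\<lambda>a b. \<psi> a \<otimes> b)) (\<lambda>a b. J (b * S f) *\<^sub>C a)"
    unfolding conv_action_def using sweedler_on_eq[OF sV tV[OF \<phi>w] bl2 refl] by metis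
  also have "\<dots> = sweedler (\<Delta> w) (\<lambda>a b. J (b * S f) *\<^sub>C \<psi> a)"
    by (simp add: clinear_sweedler_out[OF clinear_sweedler[OF bl2]] sweedler_pure[OF bl2])
  also have "\<dots> = \<psi> (sweedler (\<Delta> w) (\<lambda>a b. J (b * S f) *\<^sub>C a))"
    unfolding clinear_sweedler_out[OF \<psi>] using \<psi> by (simp add: clinear_iff)
  finally have "\<psi> (sweedler (\<Delta> w) (\<lambda>a b. J (b * S f) *\<^sub>C a)) = 0"
    using zero[OF \<phi>w] by simp
  moreover have in_W: "sweedler (\<Delta> w) (\<lambda>a b. J (b * S f) *\<^sub>C a) \<in> W"
    by (rule tensor_within_sweedler[OF tW[OF w] bl2 sW]) (auto intro: cvec.subspace_scale[OF sW])
  ultimately have "\<phi> (sweedler (\<Delta> w) (\<lambda>a b. J (b * S f) *\<^sub>C a)) = \<phi> 0"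
    using \<psi>\<phi> cvec.subspace_0[OF sW] clinear_zero[OF \<psi>] by simp
  then show ?thesis
    using \<phi>(2) in_W cvec.subspace_0[OF sW] by (auto simp: bij_betw_def dest: inj_onD)
qed

end

text \<open>The real \<open>Sup\<close> is the \<open>LEAST\<close> upper bound. Without upper
  bounds the defining predicate is constantly \<open>False\<close>, so the resulting value is the
  same for all unbounded sets.\<close>

lemma Sup_real_eq_of_unbounded:
  fixes A B :: "real set"
  assumes "\<not> bdd_above A" "\<not> bdd_above B"
  shows "Sup A = Sup B"
proof -
  have "(\<lambda>z. \<forall>x\<in>C. x \<le> z) = (\<lambda>_. False)" if "\<not> bdd_above C" for C :: "real set"
    using that by (auto simp: bdd_above_def fun_eq_iff)
  then show ?thesis using assms by (simp add: Sup_real_def)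
qed

section \<open>Representations of the convolution algebra\<close>

locale convolution_completion = compact_hopf_star_algebra \<Delta> \<epsilon> S st
  for \<Delta> :: "'a::complex_algebra_1 \<Rightarrow> ('a, 'a) tensor" and \<epsilon> S st +
  fixes J :: "'a \<Rightarrow> complex" and \<Lambda> :: "'l set" and V :: "'l \<Rightarrow> 'w::complex_vector set"
    and \<delta> :: "'l \<Rightarrow> 'w \<Rightarrow> ('w, 'a) tensor" and ip :: "'l \<Rightarrow> 'w \<Rightarrow> 'w \<Rightarrow> complex"
    and \<iota> :: "'a \<Rightarrow> 'b::cstar_algebra"
  assumes integral: "hopf_integral \<Delta> J"
    and representatives: "simple_comodule_representatives \<Delta> \<epsilon> S st \<Lambda> V \<delta> ip"
    and completion: "cstar_completion (convolution \<Delta> S J) (conv_star S st) (cstar_norm S J \<Lambda> V \<delta> ip) \<iota>"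
begin

abbreviation act :: "'l \<Rightarrow> 'a \<Rightarrow> 'w \<Rightarrow> 'w"
  where "act \<alpha> \<equiv> conv_action S J (V \<alpha>) (\<delta> \<alpha>)"

lemma linear_J: "clinear J" and J_one: "J 1 = 1"
  using integral by (auto simp: hopf_integral_def)

lemma V_simple: "\<alpha> \<in> \<Lambda> \<Longrightarrow> simple_comodule \<Delta> \<epsilon> (V \<alpha>) (\<delta> \<alpha>)"
  and V_scalar_product: "\<alpha> \<in> \<Lambda> \<Longrightarrow> scalar_product (V \<alpha>) (ip \<alpha>)"
  using representatives by (auto simp: simple_comodule_representatives_def unitary_product_def)

lemma V_comodule: "\<alpha> \<in> \<Lambda> \<Longrightarrow> comodule \<Delta> \<epsilon> (V \<alpha>) (\<delta> \<alpha>)"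
  using V_simple by (simp add: simple_comodule_def)

lemma V_inner_space: "\<alpha> \<in> \<Lambda> \<Longrightarrow> inner_space (V \<alpha>) (ip \<alpha>)"
  using V_comodule V_scalar_product by (simp add: inner_space_def comodule_def)

lemmas act_endomorphism = conv_action_endomorphism[OF linear_J V_comodule]

text \<open>On a simple right coideal, the right slice by the functional sending \<open>w\<close> to
  \<open>J (w * S f)\<close> is the action of \<open>f\<close>. It vanishes because the coideal is
  isomorphic to some \<open>V \<alpha>\<close>, and \<open>functional_eq_0\<close> applies.\<close>

lemma integral_eq_0:
  assumes "\<And>\<alpha> v. \<alpha> \<in> \<Lambda> \<Longrightarrow> v \<in> V \<alpha> \<Longrightarrow> act \<alpha> f v = 0"
  shows "J (w * S f) = 0"
proof (rule functional_eq_0[OF cosemisimple, where F = "\<lambda>w. J (w * S f)"])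
  show "clinear (\<lambda>w. J (w * S f))"
    by (rule clinear_compose[OF linear_J]) (intro clinear_intros)
  fix W w assume W: "simple_comodule \<Delta> \<epsilon> W \<Delta>" and w: "w \<in> W"
  from representatives W obtain \<alpha> where \<alpha>: "\<alpha> \<in> \<Lambda>" "comodule_iso W \<Delta> (V \<alpha>) (\<delta> \<alpha>)"
    unfolding simple_comodule_representatives_def by blast
  have "comodule \<Delta> \<epsilon> W \<Delta>" using W by (simp add: simple_comodule_def)
  then show "sweedler (\<Delta> w) (\<lambda>a b. J (b * S f) *\<^sub>C a) = 0"
    by (rule conv_action_iso[OF linear_J _ V_comodule[OF \<alpha>(1)] \<alpha>(2) _ w]) (rule assms[OF \<alpha>(1)])
qed

lemma act_bounded:
  assumes \<alpha>: "\<alpha> \<in> \<Lambda>"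
  obtains K where "K \<ge> 0" "\<And>v. v \<in> V \<alpha> \<Longrightarrow> ip_norm (ip \<alpha>) (act \<alpha> f v) \<le> K * ip_norm (ip \<alpha>) v"
proof -
  interpret inner_space "V \<alpha>" "ip \<alpha>" by (rule V_inner_space[OF \<alpha>])
  obtain B where B: "finite B" "V \<alpha> = cvec.span B"
    by (rule simple_comodule_finite_dim[OF hopf_algebra_axioms V_simple[OF \<alpha>]])
  show ?thesis
    by (rule finite_dim_bounded[OF B act_endomorphism(1)[OF \<alpha>, of f] act_endomorphism(2)[OF \<alpha>, of _ f]])
      (assumption, rule that)
qed

abbreviation act_norm :: "'l \<Rightarrow> 'a \<Rightarrow> real"
  where "act_norm \<alpha> f \<equiv> op_norm (V \<alpha>) (ip \<alpha>) (act \<alpha> f)"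

lemma act_norm_bound:
  assumes \<alpha>: "\<alpha> \<in> \<Lambda>" and v: "v \<in> V \<alpha>"
  shows "ip_norm (ip \<alpha>) (act \<alpha> f v) \<le> act_norm \<alpha> f * ip_norm (ip \<alpha>) v"
proof -
  interpret inner_space "V \<alpha>" "ip \<alpha>" by (rule V_inner_space[OF \<alpha>])
  obtain K where "K \<ge> 0" "\<And>v. v \<in> V \<alpha> \<Longrightarrow> ip_norm (ip \<alpha>) (act \<alpha> f v) \<le> K * ip_norm (ip \<alpha>) v"
    by (rule act_bounded[OF \<alpha>, of f]) (rule that, assumption)
  then show ?thesis using act_endomorphism[OF \<alpha>] v by (intro op_norm_bound)
qed

section \<open>Finiteness of the supremum that defines the norm\<close>

text \<open>Phrased by explicit bounds, since \<open>cstar_norm\<close> says nothing about an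
  unbounded family. In this form stability under sums and multiples is immediate.\<close>

definition uniformly_bounded :: "'a \<Rightarrow> bool"
  where "uniformly_bounded f \<longleftrightarrow> (\<exists>K\<ge>0. \<forall>\<alpha>\<in>\<Lambda>. \<forall>v\<in>V \<alpha>.
    ip_norm (ip \<alpha>) (act \<alpha> f v) \<le> K * ip_norm (ip \<alpha>) v)"

lemma uniformly_bounded_iff: "uniformly_bounded f \<longleftrightarrow> bdd_above ((\<lambda>\<alpha>. act_norm \<alpha> f) ` \<Lambda>)"
proof
  assume "uniformly_bounded f"
  then obtain K where K: "K \<ge> 0"
    "\<And>\<alpha> v. \<alpha> \<in> \<Lambda> \<Longrightarrow> v \<in> V \<alpha> \<Longrightarrow> ip_norm (ip \<alpha>) (act \<alpha> f v) \<le> K * ip_norm (ip \<alpha>) v"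
    by (auto simp: uniformly_bounded_def)
  have "act_norm \<alpha> f \<le> K" if \<alpha>: "\<alpha> \<in> \<Lambda>" for \<alpha>
    by (rule inner_space.op_norm_least[OF V_inner_space[OF \<alpha>] K(2)[OF \<alpha>] K(1)])
  then show "bdd_above ((\<lambda>\<alpha>. act_norm \<alpha> f) ` \<Lambda>)" by (intro bdd_aboveI2[of _ _ K])
next
  assume "bdd_above ((\<lambda>\<alpha>. act_norm \<alpha> f) ` \<Lambda>)"
  then obtain K where K: "\<And>\<alpha>. \<alpha> \<in> \<Lambda> \<Longrightarrow> act_norm \<alpha> f \<le> K" by (auto simp: bdd_above_def)
  have "ip_norm (ip \<alpha>) (act \<alpha> f v) \<le> max K 0 * ip_norm (ip \<alpha>) v" if "\<alpha> \<in> \<Lambda>" "v \<in> V \<alpha>" for \<alpha> v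
  proof -
    have "act_norm \<alpha> f * ip_norm (ip \<alpha>) v \<le> max K 0 * ip_norm (ip \<alpha>) v"
      using K[OF that(1)] inner_space.n_nonneg[OF V_inner_space[OF that(1)] that(2)]
      by (intro mult_right_mono) auto
    with act_norm_bound[OF that, of f] show ?thesis by simp
  qed
  then show "uniformly_bounded f"
    unfolding uniformly_bounded_def by (intro exI[of _ "max K 0"]) auto
qed

lemma uniformly_bounded_add:
  assumes "uniformly_bounded f" "uniformly_bounded g"
  shows "uniformly_bounded (f + g)"
proof -
  obtain K L where K: "K \<ge> 0" "\<And>\<alpha> v. \<alpha> \<in> \<Lambda> \<Longrightarrow> v \<in> V \<alpha> \<Longrightarrow> ip_norm (ip \<alpha>) (act \<alpha> f v) \<le> K * ip_norm (ip \<alpha>) v"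
    and L: "L \<ge> 0" "\<And>\<alpha> v. \<alpha> \<in> \<Lambda> \<Longrightarrow> v \<in> V \<alpha> \<Longrightarrow> ip_norm (ip \<alpha>) (act \<alpha> g v) \<le> L * ip_norm (ip \<alpha>) v"
    using assms by (auto simp: uniformly_bounded_def)
  have "ip_norm (ip \<alpha>) (act \<alpha> (f + g) v) \<le> (K + L) * ip_norm (ip \<alpha>) v"
    if "\<alpha> \<in> \<Lambda>" "v \<in> V \<alpha>" for \<alpha> v
    using inner_space.n_triangle[OF V_inner_space[OF that(1)]
        act_endomorphism(2)[OF that, of f] act_endomorphism(2)[OF that, of g]] K(2)[OF that] L(2)[OF that]
    by (simp add: conv_action_add[OF linear_J] distrib_right)
  then show ?thesis unfolding uniformly_bounded_def using K(1) L(1) by (intro exI[of _ "K + L"]) auto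
qed

lemma uniformly_bounded_scale:
  assumes "uniformly_bounded f"
  shows "uniformly_bounded (c *\<^sub>C f)"
proof -
  obtain K where K: "K \<ge> 0" "\<And>\<alpha> v. \<alpha> \<in> \<Lambda> \<Longrightarrow> v \<in> V \<alpha> \<Longrightarrow> ip_norm (ip \<alpha>) (act \<alpha> f v) \<le> K * ip_norm (ip \<alpha>) v"
    using assms by (auto simp: uniformly_bounded_def)
  have "ip_norm (ip \<alpha>) (act \<alpha> (c *\<^sub>C f) v) \<le> (cmod c * K) * ip_norm (ip \<alpha>) v"
    if "\<alpha> \<in> \<Lambda>" "v \<in> V \<alpha>" for \<alpha> v
    using inner_space.n_scale[OF V_inner_space[OF that(1)] act_endomorphism(2)[OF that, of f], of c]
      mult_left_mono[OF K(2)[OF that], of "cmod c"]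
    by (simp add: conv_action_scale[OF linear_J] mult.assoc)
  then show ?thesis unfolding uniformly_bounded_def using K(1) by (intro exI[of _ "cmod c * K"]) auto
qed

lemma uniformly_bounded_one: "uniformly_bounded 1"
proof -
  have "ip_norm (ip \<alpha>) (act \<alpha> 1 v) \<le> 1 * ip_norm (ip \<alpha>) v" if "\<alpha> \<in> \<Lambda>" "v \<in> V \<alpha>" for \<alpha> v
    using conv_action_one[OF integral V_simple[OF that(1)] that(2)]
      inner_space.n_zero[OF V_inner_space[OF that(1)]] inner_space.n_nonneg[OF V_inner_space[OF that(1)] that(2)]
    by auto
  then show ?thesis unfolding uniformly_bounded_def by (intro exI[of _ 1]) auto
qed

lemma \<iota>:
  shows linear_\<iota>: "clinear \<iota>" and \<iota>_mult: "\<iota> (convolution \<Delta> S J f g) = \<iota> f * \<iota> g"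
    and \<iota>_star: "\<iota> (conv_star S st f) = cadj (\<iota> f)"
    and \<iota>_norm: "norm (\<iota> f) = (SUP \<alpha>\<in>\<Lambda>. act_norm \<alpha> f)" and \<iota>_dense: "closure (range \<iota>) = UNIV"
  using completion by (auto simp: cstar_completion_def cstar_norm_def)

text \<open>Uniform boundedness makes the \<open>SUP\<close> a true supremum, so that norm zero
  forces each operator norm to be at most zero.\<close>

lemma act_eq_0:
  assumes "uniformly_bounded f" "\<iota> f = 0" "\<alpha> \<in> \<Lambda>" "v \<in> V \<alpha>"
  shows "act \<alpha> f v = 0"
proof -
  interpret inner_space "V \<alpha>" "ip \<alpha>" by (rule V_inner_space[OF assms(3)])
  have "act_norm \<alpha> f \<le> (SUP \<alpha>\<in>\<Lambda>. act_norm \<alpha> f)"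
    using assms(1,3) by (intro cSUP_upper) (simp_all add: uniformly_bounded_iff)
  then have "act_norm \<alpha> f \<le> 0" using \<iota>_norm[of f] assms(2) by simp
  then have "act_norm \<alpha> f * n v \<le> 0" using assms(4) by (simp add: mult_nonpos_nonneg)
  then have "n (act \<alpha> f v) \<le> 0" using act_norm_bound[OF assms(3,4), of f] by linarith
  moreover have "act \<alpha> f v \<in> V \<alpha>" by (rule act_endomorphism(2)[OF assms(3,4)])
  ultimately show ?thesis using n_nonneg[of "act \<alpha> f v"] n_eq_0[of "act \<alpha> f v"] by linarith
qed

text \<open>
  All unbounded sets of reals have the same supremum (a junk value).  Hence \<open>\<iota> f = \<iota> (2 f)\<close> has
  to vanish if \<open>f\<close> is not uniformly bounded; as \<open>f + 1\<close> is not uniformly bounded either, this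
  would imply \<open>\<iota> 1 = 0\<close>, although \<open>1\<close> is uniformly bounded and acts nontrivially.
\<close>

lemma uniformly_bounded: "uniformly_bounded f"
proof (rule ccontr)
  assume f: "\<not> uniformly_bounded f"
  have zero: "\<iota> g = 0" if g: "\<not> uniformly_bounded g" for g
  proof -
    have "\<not> uniformly_bounded (2 *\<^sub>C g)"
      using uniformly_bounded_scale[of "2 *\<^sub>C g" "1 / 2"] g by (auto simp: scaleC_one)
    with g have "norm (\<iota> (2 *\<^sub>C g)) = norm (\<iota> g)"
      unfolding \<iota>_norm uniformly_bounded_iff by (intro Sup_real_eq_of_unbounded)
    then show ?thesis using linear_\<iota> by (simp add: clinear_iff norm_scaleC)
  qed
  \<comment> \<open>Subtracting the uniformly bounded element \<open>1\<close> would otherwise make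
    \<open>f\<close> uniformly bounded.\<close>
  have "\<not> uniformly_bounded (f + 1)"
    using uniformly_bounded_add[of "f + 1" "(- 1) *\<^sub>C 1"] uniformly_bounded_scale[OF uniformly_bounded_one, of "- 1"] f
    by (auto simp: scaleC_one)
  then have "\<iota> f + \<iota> 1 = 0" using zero[of "f + 1"] linear_\<iota> by (simp add: clinear_iff)
  then have "\<iota> 1 = 0" using zero[OF f] by simp
  then have "J (1 * S 1) = 0" by (intro integral_eq_0 act_eq_0 uniformly_bounded_one)
  then show False by (simp add: antipode_one J_one)
qed

lemma convolution_ker_\<iota>:
  assumes "\<iota> f = 0"
  shows "convolution \<Delta> S J g f = 0"
proof -
  have counit: "\<epsilon> h = 0" if "\<iota> h = 0" for h
    unfolding counit_antipode[of h, symmetric]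
    by (rule counit_eq_0_of_radical[OF integral], rule integral_eq_0, rule act_eq_0[OF uniformly_bounded that])
  have "J (f * S h) = 0" for h
  proof -
    have JS: "clinear (\<lambda>a. J (f * S a))"
      by (intro clinear_compose[OF linear_J] clinear_mult_left linear_antipode)
    \<comment> \<open>The counit contracts the second factor of \<open>\<Delta> h\<close>, so the
      integral form against \<open>f\<close> becomes a counit value, at an element that
      \<open>\<iota>\<close> kills by multiplicativity.\<close>
    have "\<epsilon> (convolution \<Delta> S J h f) = sweedler (\<Delta> h) (\<lambda>a b. J (f * S (\<epsilon> b *\<^sub>C a)))"
      unfolding convolution_def clinear_sweedler_out[OF linear_counit]
      using JS linear_counit by (simp add: clinear_iff scaleC_complex_def mult.commute)
    also have "\<dots> = J (f * S h)"
      unfolding clinear_sweedler_out[OF JS, symmetric] counit_right ..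
    finally show ?thesis using counit[of "convolution \<Delta> S J h f"] by (simp add: \<iota>_mult assms)
  qed
  then show ?thesis by (simp add: convolution_def sweedler_on_zero)
qed

lemma convolution_rep_contractive:
  assumes rep: "unitary_rep (convolution \<Delta> S J) (conv_star S st) (X, scp, \<sigma>)" and x: "x \<in> X"
  shows "ip_norm scp (\<sigma> f x) \<le> norm (\<iota> f) * ip_norm scp x"
proof (rule unitary_rep_contractive[where \<iota> = \<iota> and mul = "convolution \<Delta> S J" and invol = "conv_star S st",
      OF rep linear_\<iota> \<iota>_mult \<iota>_star _ _ x])
  interpret inner_space X scp by (rule unitary_repD(1)[OF rep])
  fix f y assume f: "\<iota> f = 0" and y: "y \<in> X"
  have fy: "\<sigma> f y \<in> X" by (rule unitary_repD(3)[OF rep y])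
  have "scp (\<sigma> f y) (\<sigma> f y) = scp y (\<sigma> (convolution \<Delta> S J (conv_star S st f) f) y)"
    by (simp add: unitary_repD(7)[OF rep y fy] unitary_repD(6)[OF rep y])
  also have "\<dots> = 0"
    using clinear_zero[OF unitary_repD(5)[OF rep y]] y by (simp add: convolution_ker_\<iota>[OF f] ip_zero)
  finally have "n (\<sigma> f y) = 0" by (simp add: ip_norm_def)
  then show "\<sigma> f y = 0" using n_eq_0[OF fy] by simp
next
  fix f
  obtain D F where "f \<in> D" and D: "cvec.subspace D" "D \<subseteq> cvec.span F" "finite F"
    and ideal: "\<And>d g. d \<in> D \<Longrightarrow> convolution \<Delta> S J d g \<in> D"
    by (rule convolution_finite_right_ideal[OF linear_J, of f]) (rule that, assumption+)
  with closed_image_finite_dim[OF linear_\<iota> D]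
  show "\<exists>D. f \<in> D \<and> cvec.subspace D \<and> closed (\<iota> ` D) \<and> (\<forall>b\<in>D. convolution \<Delta> S J b b \<in> D)"
    by blast
qed

end

text \<open>The second conjunct pins the bijection down as restriction along \<open>\<iota>\<close>;
  a bare bijection between the sets of classes would only compare cardinalities.\<close>

theorem proposition4p4:
  fixes \<Delta> :: "'a::complex_algebra_1 \<Rightarrow> ('a, 'a) tensor"
    and \<epsilon> :: "'a \<Rightarrow> complex" and S :: "'a \<Rightarrow> 'a" and st :: "'a \<Rightarrow> 'a"
    and J :: "'a \<Rightarrow> complex"
    and \<Lambda> :: "'l set" and V :: "'l \<Rightarrow> 'w::complex_vector set"
    and \<delta> :: "'l \<Rightarrow> 'w \<Rightarrow> ('w, 'a) tensor" and ip :: "'l \<Rightarrow> 'w \<Rightarrow> 'w \<Rightarrow> complex"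
    and \<iota> :: "'a \<Rightarrow> 'b::cstar_algebra"
  assumes "compact_hopf_star_algebra \<Delta> \<epsilon> S st"
    and "hopf_integral \<Delta> J"
    and "simple_comodule_representatives \<Delta> \<epsilon> S st \<Lambda> V \<delta> ip"
    and "cstar_completion (convolution \<Delta> S J) (conv_star S st) (cstar_norm S J \<Lambda> V \<delta> ip) \<iota>"
  shows "\<exists>\<Phi> :: ('b, 'v::complex_vector) rep set \<Rightarrow> ('a, 'v) rep set.
    bij_betw \<Phi>
      (irreps (*) cadj // irrep_equiv (*) cadj)
      (irreps (convolution \<Delta> S J) (conv_star S st) //
        irrep_equiv (convolution \<Delta> S J) (conv_star S st)) \<and>
    (\<forall>(X, scp, \<pi>) \<in> irreps (*) cadj.
      \<Phi> (irrep_equiv (*) cadj `` {(X, scp, \<pi>)}) =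
        irrep_equiv (convolution \<Delta> S J) (conv_star S st) `` {(X, scp, \<pi> \<circ> \<iota>)})"
proof -
  interpret convolution_completion \<Delta> \<epsilon> S st J \<Lambda> V \<delta> ip \<iota>
    using assms by (intro convolution_completion.intro convolution_completion_axioms.intro)
  show ?thesis
    by (rule irreps_completion_bij) (fact linear_\<iota> \<iota>_mult \<iota>_star \<iota>_dense convolution_rep_contractive)+
qed

end
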